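(* For every $k\ge1$, $\mathsf{TT}^1_k$ admits $\Pi^0_1$-class avoidance of bounded enumeration: for every $D\subseteq\omega$, every $S\subseteq 2^{<\omega}$ with no $D$-computable bounded enumeration, and every nonempty $\Pi^{0,D}_1$-class $Q$ of colorings $2^{<\omega}\to k$, there exist $C\in Q$ and an infinite perfect tree $T\subseteq 2^{<\omega}$ on which $C$ is constant such that $D\oplus T$ computes no bounded enumeration of $S$.
   Context: An infinite perfect tree is a subset of $2^{<\omega}$ which, ordered by the initial-segment relation, is isomorphic to $2^{<\omega}$. For $S\subseteq 2^{<\omega}$ and $l\in\omega$, an $l$-enumeration of $S$ is a function $g:\omega\to$ (finite subsets of $2^{<\omega}$) with $|g(n)|\le l$ and $g(n)\cap S\cap 2^n\ne\emptyset$ for all $n$; a bounded enumeration is an $l$-enumeration for some $l$. Colorings $2^{<\omega}\to k$ are regarded as elements of $k^{2^{<\omega}}$, so $\Pi^{0,D}_1$-classes of them make sense. *)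

theory Defs
  imports Main "HOL-Library.Nat_Bijection" "HOL-Library.Sublist"
begin

section \<open>Computability relative to an oracle\<close>

text \<open>
  Programs for the partial recursive functions relative to an oracle, taken as unary functions on
  the naturals; several arguments are passed through the Cantor pairing of
  \<^theory>\<open>HOL-Library.Nat_Bijection\<close>. Since the pairing is a bijection, the two projections can
  be basic functions, and \<open>PPair PFst PSnd\<close> is the identity.
\<close>

datatype prog =
    PZero | PSucc | PFst | PSnd | POracle
  | PPair prog prog
  | PComp prog prog
  | PPrec prog prog
  | PMu prog

text \<open>
  \<open>eval A p n y\<close>: program \<open>p\<close> with oracle \<open>A\<close> halts on input \<open>n\<close> with output \<open>y\<close>. Divergence is
  the absence of such a \<open>y\<close>; in particular \<open>PMu p\<close> requires \<open>p\<close> to converge at all smaller arguments.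
\<close>

inductive eval :: "nat set \<Rightarrow> prog \<Rightarrow> nat \<Rightarrow> nat \<Rightarrow> bool" for A :: "nat set" where
  Zero: "eval A PZero n 0"
| Succ: "eval A PSucc n (Suc n)"
| Fst: "eval A PFst n (fst (prod_decode n))"
| Snd: "eval A PSnd n (snd (prod_decode n))"
| Oracle: "eval A POracle n (of_bool (n \<in> A))"
| Pair: "eval A p n x \<Longrightarrow> eval A q n y \<Longrightarrow> eval A (PPair p q) n (prod_encode (x, y))"
| Comp: "eval A q n x \<Longrightarrow> eval A p x y \<Longrightarrow> eval A (PComp p q) n y"
| Prec_0: "eval A p x y \<Longrightarrow> eval A (PPrec p q) (prod_encode (x, 0)) y"
| Prec_Suc: "eval A (PPrec p q) (prod_encode (x, m)) y \<Longrightarrow>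
    eval A q (prod_encode (x, prod_encode (m, y))) z \<Longrightarrow>
    eval A (PPrec p q) (prod_encode (x, Suc m)) z"
| Mu: "eval A p (prod_encode (x, m)) 0 \<Longrightarrow>
    (\<forall>i<m. \<exists>y. eval A p (prod_encode (x, i)) (Suc y)) \<Longrightarrow>
    eval A (PMu p) x m"

inductive_cases eval_ZeroE: "eval A PZero n y"
inductive_cases eval_SuccE: "eval A PSucc n y"
inductive_cases eval_FstE: "eval A PFst n y"
inductive_cases eval_SndE: "eval A PSnd n y"
inductive_cases eval_OracleE: "eval A POracle n y"
inductive_cases eval_PairE: "eval A (PPair p q) n y"
inductive_cases eval_CompE: "eval A (PComp p q) n y"
inductive_cases eval_PrecE: "eval A (PPrec p q) n y"
inductive_cases eval_MuE: "eval A (PMu p) n y"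

lemma eval_deterministic: "eval A p n y \<Longrightarrow> eval A p n z \<Longrightarrow> y = z"
proof (induction arbitrary: z rule: eval.induct)
  case (Zero n) then show ?case by (elim eval_ZeroE) simp
next
  case (Succ n) then show ?case by (elim eval_SuccE) simp
next
  case (Fst n) then show ?case by (elim eval_FstE) simp
next
  case (Snd n) then show ?case by (elim eval_SndE) simp
next
  case (Oracle n) then show ?case by (elim eval_OracleE) simp
next
  case (Pair p n x q y) from Pair.prems show ?case
    by (rule eval_PairE) (metis Pair.IH)
next
  case (Comp q n x p y) from Comp.prems show ?case
    by (rule eval_CompE) (metis Comp.IH)
next
  case (Prec_0 p x y q) from Prec_0.prems show ?case
    by (rule eval_PrecE) (auto dest: Prec_0.IH)
next
  case (Prec_Suc p q x m y w) from Prec_Suc.prems show ?case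
    by (rule eval_PrecE) (auto dest: Prec_Suc.IH)
next
  case (Mu p x m) from Mu.prems show ?case
  proof (rule eval_MuE)
    assume z: "eval A p (prod_encode (x, z)) 0"
      and below: "\<forall>i<z. \<exists>y. eval A p (prod_encode (x, i)) (Suc y)"
    have "\<not> m < z" using below Mu.IH(1) by blast
    moreover have "\<not> z < m" using Mu.IH(2) z by blast
    ultimately show "m = z" by simp
  qed
qed

definition computable_in :: "nat set \<Rightarrow> (nat \<Rightarrow> nat) \<Rightarrow> bool" where
  "computable_in A f \<longleftrightarrow> (\<exists>p. \<forall>n. eval A p n (f n))"

definition decidable_in :: "nat set \<Rightarrow> nat set \<Rightarrow> bool" where
  "decidable_in A X \<longleftrightarrow> computable_in A (\<lambda>n. of_bool (n \<in> X))"

definition join :: "nat set \<Rightarrow> nat set \<Rightarrow> nat set" (infixl \<open>\<oplus>\<close> 65) where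
  "A \<oplus> B = (\<lambda>n. 2 * n) ` A \<union> (\<lambda>n. 2 * n + 1) ` B"


section \<open>Binary strings\<close>

text \<open>
  The set of finite binary strings is the type \<^typ>\<open>bool list\<close>, ordered by \<^const>\<open>prefix\<close>. Strings
  are identified with naturals through a computable bijection that lists them in order of length:
  the strings of length \<open>n\<close> receive the codes from \<open>2 ^ n - 1\<close> to \<open>2 ^ (n + 1) - 2\<close>.
\<close>

fun str_code :: "bool list \<Rightarrow> nat" where
  "str_code [] = 0"
| "str_code (b # \<sigma>) = 2 * str_code \<sigma> + 1 + of_bool b"

lemma inj_str_code: "inj str_code"
proof (rule injI)
  fix \<sigma> \<tau> show "str_code \<sigma> = str_code \<tau> \<Longrightarrow> \<sigma> = \<tau>"
  proof (induction \<sigma> arbitrary: \<tau>)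
    case Nil
    then show ?case by (cases \<tau>) auto
  next
    case (Cons b \<sigma>)
    then obtain c \<tau>' where \<tau>: "\<tau> = c # \<tau>'" by (cases \<tau>) auto
    have *: "2 * str_code \<sigma> + of_bool b = 2 * str_code \<tau>' + of_bool c"
      using Cons.prems \<tau> by simp
    then have "b = c" by (cases b; cases c; simp; presburger)
    with * Cons.IH \<tau> show ?case by simp
  qed
qed

lemma surj_str_code: "surj str_code"
proof -
  have "\<exists>\<sigma>. str_code \<sigma> = n" for n
  proof (induction n rule: less_induct)
    case (less n)
    show ?case
    proof (cases "n = 0")
      case True
      then show ?thesis by (metis str_code.simps(1))
    next
      case False
      then have "(n - 1) div 2 < n" by presburger
      from less[OF this] obtain \<sigma> where "str_code \<sigma> = (n - 1) div 2" ..
      then have "str_code (odd (n - 1) # \<sigma>) = 2 * ((n - 1) div 2) + 1 + (n - 1) mod 2"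
        by (simp only: str_code.simps of_bool_odd_eq_mod_2)
      also have "\<dots> = n" using False by presburger
      finally have "str_code (odd (n - 1) # \<sigma>) = n" .
      then show ?thesis by blast
    qed
  qed
  then show ?thesis by (metis surj_def)
qed

lemma bij_str_code: "bij str_code"
  using inj_str_code surj_str_code by (simp add: bij_def)

text \<open>An infinite perfect tree need not be closed under initial segments.\<close>

definition infinite_perfect_tree :: "bool list set \<Rightarrow> bool" where
  "infinite_perfect_tree T \<longleftrightarrow>
     (\<exists>h :: bool list \<Rightarrow> bool list. bij_betw h UNIV T \<and> (\<forall>\<sigma> \<tau>. prefix (h \<sigma>) (h \<tau>) \<longleftrightarrow> prefix \<sigma> \<tau>))"


section \<open>Bounded enumerations\<close>

definition enumeration :: "nat \<Rightarrow> bool list set \<Rightarrow> (nat \<Rightarrow> bool list set) \<Rightarrow> bool" where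
  "enumeration l S g \<longleftrightarrow>
     (\<forall>n. finite (g n) \<and> card (g n) \<le> l \<and> g n \<inter> S \<inter> {\<sigma>. length \<sigma> = n} \<noteq> {})"

definition bounded_enumeration :: "bool list set \<Rightarrow> (nat \<Rightarrow> bool list set) \<Rightarrow> bool" where
  "bounded_enumeration S g \<longleftrightarrow> (\<exists>l. enumeration l S g)"

text \<open>
  The values of an enumeration are given by canonical codes of finite sets; \<^const>\<open>set_encode\<close> is
  only meaningful on finite sets, and is used only on those.
\<close>

definition computes_bounded_enumeration :: "nat set \<Rightarrow> bool list set \<Rightarrow> bool" where
  "computes_bounded_enumeration A S \<longleftrightarrow>
     (\<exists>g. bounded_enumeration S g \<and> computable_in A (\<lambda>n. set_encode (str_code ` g n)))"


section \<open>Effectively closed classes of colorings\<close>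

definition colorings :: "nat \<Rightarrow> (bool list \<Rightarrow> nat) set" where
  "colorings k = {C. \<forall>\<sigma>. C \<sigma> < k}"

text \<open>
  The first \<open>n\<close> colors of \<open>C\<close>, the strings being taken in the order of their codes; this is how a
  coloring is viewed as an infinite sequence over \<open>{..<k}\<close>.
\<close>

definition initial_segment :: "(bool list \<Rightarrow> nat) \<Rightarrow> nat \<Rightarrow> nat list" where
  "initial_segment C n = map (C \<circ> inv str_code) [0..<n]"

text \<open>The sets of infinite paths through \<open>D\<close>-computable subtrees of the finite sequences over \<open>{..<k}\<close>.\<close>

definition Pi01_class :: "nat set \<Rightarrow> nat \<Rightarrow> (bool list \<Rightarrow> nat) set \<Rightarrow> bool" where
  "Pi01_class D k Q \<longleftrightarrow>
     (\<exists>R. R \<subseteq> lists {..<k} \<and> (\<forall>\<rho>\<in>R. \<forall>\<rho>'. prefix \<rho>' \<rho> \<longrightarrow> \<rho>' \<in> R) \<and>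
          decidable_in D (list_encode ` R) \<and>
          Q = {C \<in> colorings k. \<forall>n. initial_segment C n \<in> R})"

end

theory Submission
  imports Defs "HOL-Library.Countable"
begin

text \<open>
  The tree is built by forcing with conditions that consist of an effectively closed class of
  finite tuples of colorings from \<open>Q\<close> and finitely many \<^emph>\<open>parts\<close>. A part is a finite piece of a future
  tree, together with cones in which it may grow, some coordinates of the tuples, and a color that
  those coordinates must all have on the new nodes. The parts \<^emph>\<open>cover\<close> the class: whatever nodes are
  picked above the cones, some part finds its color at all of its cones.

  To defeat a functional as an \<open>l\<close>-enumeration, consider for a set \<open>V\<close> of strings of length \<open>n\<close> the
  class of tuples for which no extension of the pending parts makes the functional output at \<open>n\<close> a
  set disjoint from \<open>V\<close>. If, for all \<open>n\<close>, the sets \<open>V\<close> with nonempty class could be hit by boundedly many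
  strings, then \<open>D\<close> would compute a bounded enumeration of \<open>S\<close>. Otherwise one joins the tuples
  belonging to a family of sets \<open>V\<close> that cannot be hit by few strings; every possible color of the joint
  tuple then has many \<open>V\<close> in common with one part, so that this part forces the outputs to
  have more than \<open>l\<close> elements. Parts for which wrong outputs can be produced everywhere are simply
  extended to produce one. A path through the finitely branching tree of parts gives the tree,
  and compactness gives a single coloring in \<open>Q\<close> for which it is monochromatic.
\<close>


section \<open>Relative computability\<close>

text \<open>A nonempty class for one \<open>V\<close> only ensures that outputs meet
  \<open>V\<close>, which is no contradiction. They have to meet many \<open>V\<close> at once,
  while each \<open>V\<close> comes with its own tuple; hence a part carries a set of coordinates in
  which its color is demanded simultaneously. That some part can meet its demand is what covering
  expresses: it is a pigeonhole statement for every choice of nodes, and it survives raising the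
  cones and passing to a subclass. Pigeonhole also explains the threshold \<open>l * card P\<close>:
  if for each part the sets \<open>V\<close> assigned to it could be hit by \<open>l\<close>
  strings, all \<open>V\<close> together could be hit by that many. The recursion is needed because
  the coloring that shows a part to be spoilable is lost when the class is cut down to the tuples
  for one \<open>V\<close>. The remaining parts are then judged again by a coloring of the smaller
  class; each round deals with at least one further part, so their number drops.\<close>

abbreviation pfst :: "nat \<Rightarrow> nat" where "pfst x \<equiv> fst (prod_decode x)"
abbreviation psnd :: "nat \<Rightarrow> nat" where "psnd x \<equiv> snd (prod_decode x)"

definition decp :: "nat set \<Rightarrow> (nat \<Rightarrow> bool) \<Rightarrow> bool" where
  "decp A P \<longleftrightarrow> computable_in A (\<lambda>n. of_bool (P n))"

text \<open>The Sigma-0-1 predicates relative to \<open>A\<close>, as projections of decidable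
  ones.\<close>

definition cep :: "nat set \<Rightarrow> (nat \<Rightarrow> bool) \<Rightarrow> bool" where
  "cep A P \<longleftrightarrow> (\<exists>R. decp A R \<and> (\<forall>n. P n \<longleftrightarrow> (\<exists>m. R (prod_encode (n, m)))))"

section \<open>Closure properties of computable functions and decidable predicates\<close>

lemma computable_const: "computable_in A (\<lambda>n. c)"
proof (induction c)
  case 0
  then show ?case unfolding computable_in_def by (metis eval.Zero)
next
  case (Suc c)
  then show ?case unfolding computable_in_def by (metis eval.Comp eval.Succ)
qed

lemma computable_comp:
  assumes "computable_in A f" "computable_in A g"
  shows "computable_in A (\<lambda>n. f (g n))"
  using assms unfolding computable_in_def by (metis eval.Comp)

lemma computable_pair:
  assumes "computable_in A f" "computable_in A g"
  shows "computable_in A (\<lambda>n. prod_encode (f n, g n))"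
  using assms unfolding computable_in_def by (metis eval.Pair)

lemma computable_pfst:
  assumes "computable_in A f"
  shows "computable_in A (\<lambda>n. pfst (f n))"
  using assms unfolding computable_in_def by (metis eval.Comp eval.Fst)

lemma computable_psnd:
  assumes "computable_in A f"
  shows "computable_in A (\<lambda>n. psnd (f n))"
  using assms unfolding computable_in_def by (metis eval.Comp eval.Snd)

lemma computable_id: "computable_in A (\<lambda>n. n)"
proof -
  have "eval A (PPair PFst PSnd) n n" for n
    using eval.Pair[OF eval.Fst[of A n] eval.Snd[of A n]] by simp
  then show ?thesis unfolding computable_in_def by blast
qed

lemma computable_Suc:
  assumes "computable_in A f"
  shows "computable_in A (\<lambda>n. Suc (f n))"
  using assms unfolding computable_in_def by (metis eval.Comp eval.Succ)

text \<open>\<open>PPrec\<close> passes parameter, counter and previous value as nested pairs; the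
  last premise is computability of the step function in this packing. Arithmetic, case distinction
  and bounded quantification all become instances.\<close>

lemma computable_rec:
  assumes "computable_in A f" "computable_in A h"
    and "computable_in A (\<lambda>x. g (pfst x) (pfst (psnd x)) (psnd (psnd x)))"
  shows "computable_in A (\<lambda>n. rec_nat (f n) (g n) (h n))"
proof -
  obtain p where p: "\<And>n. eval A p n (f n)" using assms(1) unfolding computable_in_def by blast
  obtain q where q: "\<And>x. eval A q x (g (pfst x) (pfst (psnd x)) (psnd (psnd x)))"
    using assms(3) unfolding computable_in_def by blast
  obtain r where r: "\<And>n. eval A r n (h n)" using assms(2) unfolding computable_in_def by blast
  have *: "eval A (PPrec p q) (prod_encode (n, m)) (rec_nat (f n) (g n) m)" for n m
  proof (induction m)
    case 0
    then show ?case using eval.Prec_0[OF p] by simp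
  next
    case (Suc m)
    then show ?case
      using eval.Prec_Suc[OF Suc q[of "prod_encode (n, prod_encode (m, rec_nat (f n) (g n) m))"]] by simp
  qed
  obtain i where i: "\<And>n. eval A i n n" using computable_id[of A] unfolding computable_in_def by blast
  have "eval A (PComp (PPrec p q) (PPair i r)) n (rec_nat (f n) (g n) (h n))" for n
    by (rule eval.Comp[OF eval.Pair[OF i r] *])
  then show ?thesis unfolding computable_in_def by blast
qed

lemmas computable_base = computable_const computable_id computable_pair computable_pfst
  computable_psnd computable_Suc

lemma computable_add:
  assumes "computable_in A f" "computable_in A g"
  shows "computable_in A (\<lambda>n. f n + g n)"
proof -
  have "rec_nat a (\<lambda>_ y. Suc y) b = a + b" for a b :: nat by (induction b) auto
  then show ?thesis
    using computable_rec[OF assms, of "\<lambda>_ _ y. Suc y"] by (simp add: computable_base)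
qed

lemma computable_pred:
  assumes "computable_in A f"
  shows "computable_in A (\<lambda>n. f n - 1)"
proof -
  have "rec_nat 0 (\<lambda>m _. m) b = b - 1" for b :: nat by (induction b) auto
  then show ?thesis
    using computable_rec[OF computable_const[of A 0] assms, of "\<lambda>_ m _. m"] by (simp add: computable_base)
qed

lemma computable_diff:
  assumes "computable_in A f" "computable_in A g"
  shows "computable_in A (\<lambda>n. f n - g n)"
proof -
  have "rec_nat a (\<lambda>_ y. y - 1) b = a - b" for a b :: nat by (induction b) auto
  then show ?thesis
    using computable_rec[OF assms, of "\<lambda>_ _ y. y - 1"] computable_pred
    by (simp add: computable_base)
qed

lemma computable_mult:
  assumes "computable_in A f" "computable_in A g"
  shows "computable_in A (\<lambda>n. f n * g n)"
proof -
  have "rec_nat 0 (\<lambda>_ y. y + a) b = a * b" for a b :: nat by (induction b) auto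
  then show ?thesis
    using computable_rec[OF computable_const[of A 0] assms(2), of "\<lambda>n _ y. y + f n"]
      computable_comp[OF assms(1)]
    by (simp add: computable_base computable_add)
qed

lemma computable_power:
  assumes "computable_in A f" "computable_in A g"
  shows "computable_in A (\<lambda>n. f n ^ g n)"
proof -
  have "rec_nat 1 (\<lambda>_ y. y * a) b = a ^ b" for a b :: nat by (induction b) auto
  then show ?thesis
    using computable_rec[OF computable_const[of A 1] assms(2), of "\<lambda>n _ y. y * f n"]
      computable_comp[OF assms(1)]
    by (simp add: computable_base computable_mult)
qed

lemma computable_of_bool:
  assumes "decp A P"
  shows "computable_in A (\<lambda>n. of_bool (P n))"
  using assms by (simp add: decp_def)

lemma decp_comp:
  assumes "decp A P" "computable_in A f"
  shows "decp A (\<lambda>n. P (f n))"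
  using assms unfolding decp_def by (rule computable_comp)

lemma computable_if:
  assumes "decp A P" "computable_in A f" "computable_in A g"
  shows "computable_in A (\<lambda>n. if P n then f n else g n)"
proof -
  \<comment> \<open>A recursion of length 0 or 1 chooses between the two branches.\<close>
  have "rec_nat (g n) (\<lambda>_ _. f n) (of_bool (P n)) = (if P n then f n else g n)" for n by simp
  then show ?thesis
    using computable_rec[OF assms(3) computable_of_bool[OF assms(1)], of "\<lambda>n _ _. f n"]
      computable_comp[OF assms(2) computable_pfst[OF computable_id]] by simp
qed

lemma decp_const: "decp A (\<lambda>n. c)"
  unfolding decp_def by (rule computable_const)

lemma decp_eq_0:
  assumes "computable_in A f"
  shows "decp A (\<lambda>n. f n = 0)"
proof -
  have "(\<lambda>n. of_bool (f n = 0)) = (\<lambda>n. 1 - f n)" by (auto simp: fun_eq_iff)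
  then show ?thesis unfolding decp_def using computable_diff[OF computable_const[of A 1] assms] by simp
qed

lemma decp_not:
  assumes "decp A P" shows "decp A (\<lambda>n. \<not> P n)"
proof -
  have "(\<lambda>n. of_bool (P n) = (0::nat)) = (\<lambda>n. \<not> P n)" by (auto simp: fun_eq_iff)
  then show ?thesis using decp_eq_0[OF computable_of_bool[OF assms]] by simp
qed

lemma decp_conj:
  assumes "decp A P" "decp A Q" shows "decp A (\<lambda>n. P n \<and> Q n)"
proof -
  have "(\<lambda>n. of_bool (P n \<and> Q n)) = (\<lambda>n. of_bool (P n) * of_bool (Q n) :: nat)" by (auto simp: fun_eq_iff)
  then show ?thesis using assms computable_mult unfolding decp_def by simp
qed

lemma decp_disj:
  assumes "decp A P" "decp A Q" shows "decp A (\<lambda>n. P n \<or> Q n)"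
  using decp_not[OF decp_conj[OF decp_not[OF assms(1)] decp_not[OF assms(2)]]] by simp

lemma decp_imp:
  assumes "decp A P" "decp A Q" shows "decp A (\<lambda>n. P n \<longrightarrow> Q n)"
  unfolding imp_conv_disj by (rule decp_disj[OF decp_not[OF assms(1)] assms(2)])

lemma decp_le:
  assumes "computable_in A f" "computable_in A g" shows "decp A (\<lambda>n. f n \<le> g n)"
  using decp_eq_0[OF computable_diff[OF assms]] by simp

lemma decp_less:
  assumes "computable_in A f" "computable_in A g" shows "decp A (\<lambda>n. f n < g n)"
  using decp_le[OF computable_Suc[OF assms(1)] assms(2)] by (simp add: Suc_le_eq)

lemma decp_eq:
  assumes "computable_in A f" "computable_in A g" shows "decp A (\<lambda>n. f n = g n)"
  using decp_conj[OF decp_le[OF assms] decp_le[OF assms(2,1)]] by (simp add: eq_iff)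

lemma decp_ball:
  assumes "computable_in A h" "decp A (\<lambda>x. R (pfst x) (psnd x))"
  shows "decp A (\<lambda>n. \<forall>i<h n. R n i)"
proof -
  have *: "rec_nat 1 (\<lambda>i y. if R n i then y else 0) b = (of_bool (\<forall>i<b. R n i) :: nat)" for n b
    by (induction b) (auto simp: less_Suc_eq)
  have "decp A (\<lambda>x. R (pfst x) (pfst (psnd x)))"
    using decp_comp[OF assms(2), of "\<lambda>x. prod_encode (pfst x, pfst (psnd x))"]
    by (simp add: computable_base)
  then have "computable_in A (\<lambda>n. rec_nat 1 (\<lambda>i y. if R n i then y else 0) (h n))"
    using computable_rec[OF computable_const[of A 1] assms(1), of "\<lambda>n i y. if R n i then y else 0"]
    by (simp add: computable_base computable_if)
  then show ?thesis unfolding decp_def by (simp only: *)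
qed

lemma decp_bex:
  assumes "computable_in A h" "decp A (\<lambda>x. R (pfst x) (psnd x))"
  shows "decp A (\<lambda>n. \<exists>i<h n. R n i)"
  using decp_not[OF decp_ball[OF assms(1) decp_not[OF assms(2)]]] by simp

lemma computable_Least:
  assumes "decp A (\<lambda>x. R (pfst x) (psnd x))" and ex: "\<And>n. \<exists>m. R n m"
  shows "computable_in A (\<lambda>n. LEAST m. R n m)"
proof -
  \<comment> \<open>\<open>PMu\<close> searches for the value 0, hence the program computes the
    negation of \<open>R\<close>; its value 1 below the least witness is the \<open>Suc\<close>
    demanded by \<open>eval.Mu\<close>.\<close>
  obtain p where p: "\<And>x. eval A p x (of_bool (\<not> R (pfst x) (psnd x)))"
    using decp_not[OF assms(1)] unfolding decp_def computable_in_def by blast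
  have "eval A (PMu p) n (LEAST m. R n m)" for n
  proof (rule eval.Mu)
    have "R n (LEAST m. R n m)" using ex by (rule LeastI_ex)
    then show "eval A p (prod_encode (n, LEAST m. R n m)) 0"
      using p[of "prod_encode (n, LEAST m. R n m)"] by simp
    show "\<forall>i<LEAST m. R n m. \<exists>y. eval A p (prod_encode (n, i)) (Suc y)"
    proof (intro allI impI)
      fix i assume "i < (LEAST m. R n m)"
      then have "\<not> R n i" by (rule not_less_Least)
      then show "\<exists>y. eval A p (prod_encode (n, i)) (Suc y)"
        using p[of "prod_encode (n, i)"] by auto
    qed
  qed
  then show ?thesis unfolding computable_in_def by blast
qed

lemma computable_div:
  assumes "computable_in A f" "computable_in A g"
  shows "computable_in A (\<lambda>n. f n div g n)"
proof -
  \<comment> \<open>The disjunct \<open>b = 0\<close> lets the search stop at once for divisor 0,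
    with the value 0 that \<open>div\<close> has by convention.\<close>
  have ex: "\<exists>q. b = 0 \<or> a < Suc q * b" for a b :: nat
    by (rule exI[of _ a]) (cases b, auto)
  have *: "(LEAST q. b = 0 \<or> a < Suc q * b) = a div b" for a b :: nat
  proof (rule Least_equality)
    show "b = 0 \<or> a < Suc (a div b) * b"
      by (metis dividend_less_div_times mult.commute mult_Suc neq0_conv)
    show "a div b \<le> q" if "b = 0 \<or> a < Suc q * b" for q
      using that by (metis div_by_0 le0 less_Suc_eq_le less_mult_imp_div_less)
  qed
  have "computable_in A (\<lambda>n. LEAST q. g n = 0 \<or> f n < Suc q * g n)"
    by (rule computable_Least[OF _ ex])
      (intro decp_disj decp_eq_0 decp_less computable_mult computable_base
        computable_comp[OF assms(1)] computable_comp[OF assms(2)])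
  then show ?thesis by (simp only: *)
qed

lemma computable_mod:
  assumes "computable_in A f" "computable_in A g"
  shows "computable_in A (\<lambda>n. f n mod g n)"
proof -
  have "(\<lambda>n. f n mod g n) = (\<lambda>n. f n - g n * (f n div g n))" by (simp add: minus_mult_div_eq_mod)
  then show ?thesis using assms by (simp add: computable_diff computable_mult computable_div)
qed

lemma decp_set_decode:
  assumes "computable_in A f" "computable_in A g"
  shows "decp A (\<lambda>n. f n \<in> set_decode (g n))"
proof -
  have "(\<lambda>n. f n \<in> set_decode (g n)) = (\<lambda>n. (g n div 2 ^ f n) mod 2 = 1)"
    by (auto simp: set_decode_def odd_iff_mod_2_eq_one fun_eq_iff)
  then show ?thesis
    using assms by (simp add: decp_eq computable_mod computable_div computable_power computable_const)
qed

text \<open>Since \<open>x < 2 ^ x \<le> w\<close>, quantifiers over the finite set coded by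
  \<open>w\<close> are bounded by \<open>w\<close> itself, which keeps statements about coded sets
  decidable.\<close>

lemma set_decode_less: "x \<in> set_decode w \<Longrightarrow> x < w"
proof -
  assume "x \<in> set_decode w"
  then have "w div 2 ^ x \<noteq> 0" unfolding set_decode_def by (metis even_zero mem_Collect_eq)
  then have "2 ^ x \<le> w" by (metis div_less not_le)
  then show "x < w" using less_exp[of x] by linarith
qed

lemma computable_card_set_decode:
  assumes "computable_in A f"
  shows "computable_in A (\<lambda>n. card (set_decode (f n)))"
proof -
  have *: "rec_nat 0 (\<lambda>i y. if i \<in> set_decode w then Suc y else y) b = card (set_decode w \<inter> {..<b})" for w b
    by (induction b) (auto simp: lessThan_Suc)
  have **: "set_decode w \<inter> {..<w} = set_decode w" for w
    using set_decode_less by auto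
  have "computable_in A (\<lambda>n. rec_nat 0 (\<lambda>i y. if i \<in> set_decode (f n) then Suc y else y) (f n))"
    by (rule computable_rec)
      (intro computable_if decp_set_decode computable_base computable_comp[OF assms] assms)+
  then show ?thesis by (simp add: * **)
qed

lemmas computable_intros = computable_base computable_add computable_diff computable_mult
  computable_power computable_if computable_div computable_mod computable_card_set_decode
lemmas decp_intros = decp_const decp_not decp_conj decp_disj decp_imp decp_ball decp_bex
  decp_le decp_less decp_eq decp_set_decode

section \<open>Closure properties of enumerable predicates\<close>

lemma cep_decp:
  assumes "decp A P" shows "cep A P"
  unfolding cep_def
  by (rule exI[of _ "\<lambda>x. P (pfst x)"]) (simp add: decp_comp[OF assms] computable_base)

lemma cep_comp:
  assumes "cep A P" "computable_in A f" shows "cep A (\<lambda>n. P (f n))"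
proof -
  obtain R where R: "decp A R" "\<And>n. P n \<longleftrightarrow> (\<exists>m. R (prod_encode (n, m)))"
    using assms(1) unfolding cep_def by blast
  have "decp A (\<lambda>x. R (prod_encode (f (pfst x), psnd x)))"
    by (rule decp_comp[OF R(1)]) (intro computable_base computable_comp[OF assms(2)])
  with R(2) show ?thesis
    unfolding cep_def by (intro exI[of _ "\<lambda>x. R (prod_encode (f (pfst x), psnd x))"]) simp
qed

lemma cep_ex:
  assumes "cep A (\<lambda>x. R (pfst x) (psnd x))" shows "cep A (\<lambda>n. \<exists>m. R n m)"
proof -
  obtain T where T: "decp A T" "\<And>x. R (pfst x) (psnd x) \<longleftrightarrow> (\<exists>m. T (prod_encode (x, m)))"
    using assms unfolding cep_def by blast
  have T': "R n m \<longleftrightarrow> (\<exists>j. T (prod_encode (prod_encode (n, m), j)))" for n m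
    using T(2)[of "prod_encode (n, m)"] by simp
  let ?T = "\<lambda>x. T (prod_encode (prod_encode (pfst x, pfst (psnd x)), psnd (psnd x)))"
  have "decp A ?T" by (rule decp_comp[OF T(1)]) (intro computable_base)
  moreover have "(\<exists>m. R n m) \<longleftrightarrow> (\<exists>m. ?T (prod_encode (n, m)))" for n
  proof
    assume "\<exists>m. R n m"
    then obtain m j where "T (prod_encode (prod_encode (n, m), j))" using T' by blast
    then have "?T (prod_encode (n, prod_encode (m, j)))" by simp
    then show "\<exists>m. ?T (prod_encode (n, m))" by blast
  next
    assume "\<exists>m. ?T (prod_encode (n, m))"
    then show "\<exists>m. R n m" using T' by auto
  qed
  ultimately show ?thesis unfolding cep_def by blast
qed

lemma cep_conj:
  assumes "cep A P" "cep A Q" shows "cep A (\<lambda>n. P n \<and> Q n)"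
proof -
  obtain R where R: "decp A R" "\<And>n. P n \<longleftrightarrow> (\<exists>m. R (prod_encode (n, m)))"
    using assms(1) unfolding cep_def by blast
  obtain T where T: "decp A T" "\<And>n. Q n \<longleftrightarrow> (\<exists>m. T (prod_encode (n, m)))"
    using assms(2) unfolding cep_def by blast
  have "cep A (\<lambda>n. \<exists>i. \<exists>j. R (prod_encode (n, i)) \<and> T (prod_encode (n, j)))"
    by (intro cep_ex cep_decp decp_conj decp_comp[OF R(1)] decp_comp[OF T(1)] computable_base)
  then show ?thesis using R(2) T(2) by simp
qed

lemma cep_disj:
  assumes "cep A P" "cep A Q" shows "cep A (\<lambda>n. P n \<or> Q n)"
proof -
  obtain R where R: "decp A R" "\<And>n. P n \<longleftrightarrow> (\<exists>m. R (prod_encode (n, m)))"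
    using assms(1) unfolding cep_def by blast
  obtain T where T: "decp A T" "\<And>n. Q n \<longleftrightarrow> (\<exists>m. T (prod_encode (n, m)))"
    using assms(2) unfolding cep_def by blast
  have "cep A (\<lambda>n. \<exists>i. R (prod_encode (n, i)) \<or> T (prod_encode (n, i)))"
    by (intro cep_ex cep_decp decp_disj decp_comp[OF R(1)] decp_comp[OF T(1)] computable_base)
  then show ?thesis using R(2) T(2) by (simp add: ex_disj_distrib)
qed

lemma cep_imp:
  assumes "decp A P" "cep A Q" shows "cep A (\<lambda>n. P n \<longrightarrow> Q n)"
  unfolding imp_conv_disj by (rule cep_disj[OF cep_decp[OF decp_not[OF assms(1)]] assms(2)])

text \<open>Collection: finitely many witnesses have a common bound \<open>b\<close>, so one
  existential quantifier can be moved in front of the bounded universal one.\<close>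

lemma cep_ball:
  assumes "computable_in A h" "cep A (\<lambda>x. R (pfst x) (psnd x))"
  shows "cep A (\<lambda>n. \<forall>i<h n. R n i)"
proof -
  obtain T where T: "decp A T" "\<And>x. R (pfst x) (psnd x) \<longleftrightarrow> (\<exists>m. T (prod_encode (x, m)))"
    using assms unfolding cep_def by blast
  have T': "R n m \<longleftrightarrow> (\<exists>j. T (prod_encode (prod_encode (n, m), j)))" for n m
    using T(2)[of "prod_encode (n, m)"] by simp
  have "cep A (\<lambda>n. \<exists>b. \<forall>i<h n. \<exists>j<b. T (prod_encode (prod_encode (n, i), j)))"
    by (intro cep_ex cep_decp decp_ball decp_bex decp_comp[OF T(1)] computable_base
        computable_comp[OF assms(1)])
  moreover have "(\<exists>b. \<forall>i<a. \<exists>j<b. Z i j) \<longleftrightarrow> (\<forall>i<a. \<exists>j. Z i j)" for a :: nat and Z :: "nat \<Rightarrow> nat \<Rightarrow> bool"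
  proof
    assume "\<forall>i<a. \<exists>j. Z i j"
    then show "\<exists>b. \<forall>i<a. \<exists>j<b. Z i j"
    proof (induction a)
      case (Suc a)
      then obtain b where b: "\<forall>i<a. \<exists>j<b. Z i j" by auto
      from Suc.prems obtain j where "Z a j" by auto
      with b have "\<forall>i<Suc a. \<exists>l<max b (Suc j). Z i l" by (metis less_Suc_eq less_max_iff_disj)
      then show ?case by (rule exI)
    qed simp
  qed blast
  ultimately show ?thesis by (simp add: T')
qed

lemma cep_bex:
  assumes "computable_in A h" "cep A (\<lambda>x. R (pfst x) (psnd x))"
  shows "cep A (\<lambda>n. \<exists>i<h n. R n i)"
proof -
  have "decp A (\<lambda>x. psnd x < h (pfst x))"
    by (rule decp_less) (intro computable_base computable_comp[OF assms(1)])+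
  then show ?thesis
    using cep_ex[of A "\<lambda>n i. i < h n \<and> R n i"] cep_conj[OF cep_decp assms(2)] by blast
qed

lemma cep_Bex_finite:
  assumes "finite X" "\<And>a. a \<in> X \<Longrightarrow> cep A (R a)"
  shows "cep A (\<lambda>n. \<exists>a\<in>X. R a n)"
  using assms
proof (induction X)
  case empty
  then show ?case by (simp add: cep_decp decp_const)
next
  case (insert a X)
  then show ?case by (simp add: cep_disj)
qed

lemmas cep_intros = cep_ex cep_conj cep_disj cep_imp cep_ball cep_bex

text \<open>The search runs over pairs of a value and a witness that the value is correct; the value
  in the least such pair is returned.\<close>

lemma cep_uniformization:
  assumes "cep A (\<lambda>x. R (pfst x) (psnd x))" and "\<And>n. \<exists>m. R n m"
  shows "\<exists>g. computable_in A g \<and> (\<forall>n. R n (g n))"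
proof -
  obtain T where T: "decp A T" "\<And>x. R (pfst x) (psnd x) \<longleftrightarrow> (\<exists>m. T (prod_encode (x, m)))"
    using assms unfolding cep_def by blast
  have T': "R n m \<longleftrightarrow> (\<exists>j. T (prod_encode (prod_encode (n, m), j)))" for n m
    using T(2)[of "prod_encode (n, m)"] by simp
  let ?Z = "\<lambda>n c. T (prod_encode (prod_encode (n, pfst c), psnd c))"
  let ?g = "\<lambda>n. LEAST c. ?Z n c"
  have ex: "\<exists>c. ?Z n c" for n
  proof -
    obtain m j where "T (prod_encode (prod_encode (n, m), j))" using assms(2) T' by blast
    then have "?Z n (prod_encode (m, j))" by simp
    then show ?thesis by blast
  qed
  have "computable_in A ?g"
    by (rule computable_Least[OF _ ex]) (rule decp_comp[OF T(1)], intro computable_base)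
  moreover have "R n (pfst (?g n))" for n
    using LeastI_ex[OF ex] T' by blast
  ultimately show ?thesis using computable_pfst by blast
qed

section \<open>Oracle use, and enumerability of halting computations\<close>

lemma decp_oracle: "decp A (\<lambda>n. n \<in> A)"
  unfolding decp_def computable_in_def by (metis eval.Oracle)

lemma join_iff: "n \<in> A \<oplus> B \<longleftrightarrow> (n mod 2 = 0 \<and> n div 2 \<in> A) \<or> (n mod 2 = 1 \<and> n div 2 \<in> B)"
proof (cases "even n")
  case True
  then obtain m where "n = 2 * m" ..
  then show ?thesis by (auto simp: join_def) presburger
next
  case False
  then obtain m where "n = 2 * m + 1" by (rule oddE)
  then show ?thesis by (auto simp: join_def) presburger
qed

text \<open>The use principle: a halting computation consults only finitely many bits of its
  oracle.\<close>

lemma eval_use: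
  assumes "eval A p n y"
  shows "\<exists>u. \<forall>A'. (\<forall>i<u. i \<in> A' \<longleftrightarrow> i \<in> A) \<longrightarrow> eval A' p n y"
  using assms
proof (induction rule: eval.induct)
  case (Oracle n)
  have "eval A' POracle n (of_bool (n \<in> A))" if "\<forall>i<Suc n. i \<in> A' \<longleftrightarrow> i \<in> A" for A'
    using eval.Oracle[of A' n] that by simp
  then show ?case by blast
next
  case (Pair p n x q y)
  then obtain u v where "\<forall>A'. (\<forall>i<u. i \<in> A' \<longleftrightarrow> i \<in> A) \<longrightarrow> eval A' p n x"
    "\<forall>A'. (\<forall>i<v. i \<in> A' \<longleftrightarrow> i \<in> A) \<longrightarrow> eval A' q n y" by blast
  then show ?case
    by - (intro exI[of _ "max u v"] allI impI, rule eval.Pair, auto)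
next
  case (Comp q n x p y)
  then obtain u v where "\<forall>A'. (\<forall>i<u. i \<in> A' \<longleftrightarrow> i \<in> A) \<longrightarrow> eval A' q n x"
    "\<forall>A'. (\<forall>i<v. i \<in> A' \<longleftrightarrow> i \<in> A) \<longrightarrow> eval A' p x y" by blast
  then show ?case
    by - (intro exI[of _ "max u v"] allI impI, rule eval.Comp[where x = x], auto)
next
  case (Prec_Suc p q x m y z)
  then obtain u v where "\<forall>A'. (\<forall>i<u. i \<in> A' \<longleftrightarrow> i \<in> A) \<longrightarrow> eval A' (PPrec p q) (prod_encode (x, m)) y"
    "\<forall>A'. (\<forall>i<v. i \<in> A' \<longleftrightarrow> i \<in> A) \<longrightarrow> eval A' q (prod_encode (x, prod_encode (m, y))) z" by blast
  then show ?case
    by - (intro exI[of _ "max u v"] allI impI, rule eval.Prec_Suc[where y = y], auto)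
next
  case (Mu p x m)
  from Mu.IH(1) obtain u where u: "\<forall>A'. (\<forall>i<u. i \<in> A' \<longleftrightarrow> i \<in> A) \<longrightarrow> eval A' p (prod_encode (x, m)) 0"
    by blast
  have "\<forall>i. \<exists>v. i < m \<longrightarrow> (\<forall>A'. (\<forall>j<v. j \<in> A' \<longleftrightarrow> j \<in> A) \<longrightarrow> (\<exists>y. eval A' p (prod_encode (x, i)) (Suc y)))"
    using Mu.IH(2) by meson
  then obtain v where v: "\<And>i. i < m \<Longrightarrow> \<forall>A'. (\<forall>j<v i. j \<in> A' \<longleftrightarrow> j \<in> A) \<longrightarrow> (\<exists>y. eval A' p (prod_encode (x, i)) (Suc y))"
    by metis
  \<comment> \<open>The sum of the finitely many uses is a common bound for them.\<close>
  let ?w = "u + (\<Sum>i<m. v i)"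
  have "eval A' (PMu p) x m" if A': "\<forall>i<?w. i \<in> A' \<longleftrightarrow> i \<in> A" for A'
  proof (rule eval.Mu)
    show "eval A' p (prod_encode (x, m)) 0" using u A' by simp
    show "\<forall>i<m. \<exists>y. eval A' p (prod_encode (x, i)) (Suc y)"
    proof (intro allI impI)
      fix i assume "i < m"
      then have "v i \<le> (\<Sum>i<m. v i)" by (intro member_le_sum) auto
      then have "v i \<le> ?w" by simp
      then show "\<exists>y. eval A' p (prod_encode (x, i)) (Suc y)"
        using v[OF \<open>i < m\<close>] A' by (meson less_le_trans)
    qed
  qed
  then show ?case by blast
qed (auto intro: eval.intros)

lemma eval_join_use:
  assumes "eval (A \<oplus> X) p n y"
  shows "\<exists>u. \<forall>X'. (\<forall>i<u. i \<in> X' \<longleftrightarrow> i \<in> X) \<longrightarrow> eval (A \<oplus> X') p n y"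
proof -
  obtain u where u: "\<And>A'. (\<forall>i<u. i \<in> A' \<longleftrightarrow> i \<in> A \<oplus> X) \<Longrightarrow> eval A' p n y"
    using eval_use[OF assms] by blast
  have "eval (A \<oplus> X') p n y" if "\<forall>i<u. i \<in> X' \<longleftrightarrow> i \<in> X" for X'
  proof (rule u, intro allI impI)
    fix i assume "i < u"
    \<comment> \<open>Bit \<open>i\<close> of a join asks about \<open>i div 2\<close>, so the bound
      for the join also works for its second half.\<close>
    then have "i div 2 < u" by simp
    with that show "i \<in> A \<oplus> X' \<longleftrightarrow> i \<in> A \<oplus> X" by (auto simp: join_iff)
  qed
  then show ?thesis by blast
qed

text \<open>A primitive recursion is witnessed by the finite set of its intermediate values, which replaces
  a coding of sequences.\<close>

lemma eval_Prec_iff: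
  "eval A (PPrec p q) n y \<longleftrightarrow>
    (\<exists>z. prod_encode (psnd n, y) \<in> set_decode z \<and>
      (\<forall>v<z. v \<in> set_decode z \<longrightarrow>
        (pfst v = 0 \<and> eval A p (pfst n) (psnd v)) \<or>
        (\<exists>u<z. u \<in> set_decode z \<and> pfst v = Suc (pfst u) \<and>
           eval A q (prod_encode (pfst n, u)) (psnd v))))"
  (is "_ \<longleftrightarrow> (\<exists>z. _ \<and> ?ok z)")
proof
  have "\<exists>Z. finite Z \<and> prod_encode (m, y) \<in> Z \<and>
      (\<forall>v\<in>Z. (pfst v = 0 \<and> eval A p x (psnd v)) \<or>
        (\<exists>u\<in>Z. pfst v = Suc (pfst u) \<and> eval A q (prod_encode (x, u)) (psnd v)))"
    if "eval A (PPrec p q) (prod_encode (x, m)) y" for x m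
    using that
  proof (induction m arbitrary: y)
    case 0
    then have "eval A p x y" by (auto elim: eval_PrecE)
    then show ?case by (intro exI[of _ "{prod_encode (0, y)}"]) auto
  next
    case (Suc m)
    from Suc.prems obtain w where w: "eval A (PPrec p q) (prod_encode (x, m)) w"
      "eval A q (prod_encode (x, prod_encode (m, w))) y" by (auto elim: eval_PrecE)
    from Suc.IH[OF w(1)] obtain Z where Z: "finite Z" "prod_encode (m, w) \<in> Z"
      "\<forall>v\<in>Z. (pfst v = 0 \<and> eval A p x (psnd v)) \<or>
        (\<exists>u\<in>Z. pfst v = Suc (pfst u) \<and> eval A q (prod_encode (x, u)) (psnd v))" by blast
    show ?case
      using Z w(2) by (intro exI[of _ "insert (prod_encode (Suc m, y)) Z"]) force
  qed
  moreover assume "eval A (PPrec p q) n y"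
  ultimately obtain Z where Z: "finite Z" "prod_encode (psnd n, y) \<in> Z"
      "\<forall>v\<in>Z. (pfst v = 0 \<and> eval A p (pfst n) (psnd v)) \<or>
        (\<exists>u\<in>Z. pfst v = Suc (pfst u) \<and> eval A q (prod_encode (pfst n, u)) (psnd v))"
    by (metis prod.collapse prod_decode_inverse)
  then show "\<exists>z. prod_encode (psnd n, y) \<in> set_decode z \<and> ?ok z"
    by (intro exI[of _ "set_encode Z"]) (metis set_decode_less set_encode_inverse)
next
  assume "\<exists>z. prod_encode (psnd n, y) \<in> set_decode z \<and> ?ok z"
  then obtain z where z: "prod_encode (psnd n, y) \<in> set_decode z" "?ok z" by blast
  have "eval A (PPrec p q) (prod_encode (pfst n, m)) w" if "prod_encode (m, w) \<in> set_decode z" for m w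
    using that
  proof (induction m arbitrary: w)
    case 0
    with z(2) set_decode_less[OF 0] have "eval A p (pfst n) w" by force
    then show ?case by (rule eval.Prec_0)
  next
    case (Suc m)
    from z(2) set_decode_less[OF Suc.prems] Suc.prems obtain u where u: "u \<in> set_decode z" "pfst u = m"
      "eval A q (prod_encode (pfst n, u)) w" by force
    then have "u = prod_encode (m, psnd u)" by (metis prod.collapse prod_decode_inverse)
    with u Suc.IH show ?case by (metis eval.Prec_Suc)
  qed
  from this[OF z(1)] show "eval A (PPrec p q) n y" by simp
qed

text \<open>The varying half of the oracle is finite and enters through its code, so it can be an
  argument of an enumerable predicate. The program is fixed, so induction on \<open>p\<close>
  replaces a universal program.\<close>

lemma cep_eval:
  "cep A (\<lambda>x. eval (A \<oplus> set_decode (pfst x)) p (pfst (psnd x)) (psnd (psnd x)))"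
proof (induction p)
  case PZero
  have "eval B PZero n y \<longleftrightarrow> y = 0" for B n y by (auto intro: eval.intros elim: eval_ZeroE)
  then show ?case by (simp add: cep_decp decp_intros computable_intros)
next
  case PSucc
  have "eval B PSucc n y \<longleftrightarrow> y = Suc n" for B n y by (auto intro: eval.intros elim: eval_SuccE)
  then show ?case by (simp add: cep_decp decp_intros computable_intros)
next
  case PFst
  have "eval B PFst n y \<longleftrightarrow> y = pfst n" for B n y by (auto intro: eval.intros elim: eval_FstE)
  then show ?case by (simp add: cep_decp decp_intros computable_intros)
next
  case PSnd
  have "eval B PSnd n y \<longleftrightarrow> y = psnd n" for B n y by (auto intro: eval.intros elim: eval_SndE)
  then show ?case by (simp add: cep_decp decp_intros computable_intros)
next
  case POracle
  have "eval B POracle n y \<longleftrightarrow> y = of_bool (n \<in> B)" for B n y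
    using eval.Oracle[of B n] eval_deterministic by blast
  then have "eval (A \<oplus> X) POracle n y \<longleftrightarrow>
      (y = 1 \<and> (n mod 2 = 0 \<and> n div 2 \<in> A \<or> n mod 2 = 1 \<and> n div 2 \<in> X)) \<or>
      (y = 0 \<and> \<not> (n mod 2 = 0 \<and> n div 2 \<in> A \<or> n mod 2 = 1 \<and> n div 2 \<in> X))" for X n y
    by (auto simp: join_iff)
  then show ?case
    by (simp only:) (intro cep_decp decp_intros computable_intros decp_comp[OF decp_oracle])
next
  case (PPair p q)
  have "eval B (PPair p q) n y \<longleftrightarrow> eval B p n (pfst y) \<and> eval B q n (psnd y)" for B n y
    by (auto intro: eval.Pair[of B p n "pfst y" q "psnd y", simplified] elim!: eval_PairE)
  moreover have "cep A (\<lambda>x. eval (A \<oplus> set_decode (pfst x)) p (pfst (psnd x)) (pfst (psnd (psnd x))))"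
    using cep_comp[OF PPair(1), of "\<lambda>x. prod_encode (pfst x, prod_encode (pfst (psnd x), pfst (psnd (psnd x))))"]
    by (simp add: computable_intros)
  moreover have "cep A (\<lambda>x. eval (A \<oplus> set_decode (pfst x)) q (pfst (psnd x)) (psnd (psnd (psnd x))))"
    using cep_comp[OF PPair(2), of "\<lambda>x. prod_encode (pfst x, prod_encode (pfst (psnd x), psnd (psnd (psnd x))))"]
    by (simp add: computable_intros)
  ultimately show ?case by (simp add: cep_conj)
next
  case (PComp p q)
  have *: "eval B (PComp p q) n y \<longleftrightarrow> (\<exists>x. eval B q n x \<and> eval B p x y)" for B n y
    by (auto intro: eval.Comp elim!: eval_CompE)
  have "cep A (\<lambda>x. eval (A \<oplus> set_decode (pfst (pfst x))) q (pfst (psnd (pfst x))) (psnd x))"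
    using cep_comp[OF PComp(2), of "\<lambda>x. prod_encode (pfst (pfst x), prod_encode (pfst (psnd (pfst x)), psnd x))"]
    by (simp add: computable_intros)
  moreover have "cep A (\<lambda>x. eval (A \<oplus> set_decode (pfst (pfst x))) p (psnd x) (psnd (psnd (pfst x))))"
    using cep_comp[OF PComp(1), of "\<lambda>x. prod_encode (pfst (pfst x), prod_encode (psnd x, psnd (psnd (pfst x))))"]
    by (simp add: computable_intros)
  ultimately show ?case unfolding * by (intro cep_ex cep_conj)
next
  case (PPrec p q)
  have p: "cep A (\<lambda>x. eval (A \<oplus> set_decode (f x)) p (g x) (h x))"
    if "computable_in A f" "computable_in A g" "computable_in A h" for f g h
    using cep_comp[OF PPrec(1), of "\<lambda>x. prod_encode (f x, prod_encode (g x, h x))"] that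
    by (simp add: computable_intros)
  have q: "cep A (\<lambda>x. eval (A \<oplus> set_decode (f x)) q (g x) (h x))"
    if "computable_in A f" "computable_in A g" "computable_in A h" for f g h
    using cep_comp[OF PPrec(2), of "\<lambda>x. prod_encode (f x, prod_encode (g x, h x))"] that
    by (simp add: computable_intros)
  show ?case unfolding eval_Prec_iff
    by (intro cep_intros p q computable_intros decp_set_decode cep_decp[OF decp_eq] cep_decp[OF decp_set_decode])
next
  case (PMu p)
  have *: "eval B (PMu p) n y \<longleftrightarrow> eval B p (prod_encode (n, y)) 0 \<and>
      (\<forall>i<y. \<exists>v. eval B p (prod_encode (n, i)) (Suc v))" for B n y
    by (auto intro: eval.Mu elim!: eval_MuE)
  have p: "cep A (\<lambda>x. eval (A \<oplus> set_decode (f x)) p (g x) (h x))"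
    if "computable_in A f" "computable_in A g" "computable_in A h" for f g h
    using cep_comp[OF PMu, of "\<lambda>x. prod_encode (f x, prod_encode (g x, h x))"] that
    by (simp add: computable_intros)
  show ?case unfolding *
    by (intro cep_intros p computable_intros)
qed

lemma cep_eval':
  assumes "computable_in A f" "computable_in A g" "computable_in A h"
  shows "cep A (\<lambda>x. eval (A \<oplus> set_decode (f x)) p (g x) (h x))"
  using cep_comp[OF cep_eval, of A "\<lambda>x. prod_encode (f x, prod_encode (g x, h x))" p] assms
  by (simp add: computable_intros)


section \<open>Effectively closed classes\<close>

text \<open>Codes are numerals in base 2 with the digits 1 and 2, the first bit being the least
  significant; appending therefore adds a multiple of a power of 2.\<close>

lemma str_code_append: "str_code (\<sigma> @ \<tau>) = str_code \<sigma> + 2 ^ length \<sigma> * str_code \<tau>"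
  by (induction \<sigma>) auto

lemma str_code_bounds: "2 ^ length \<sigma> \<le> Suc (str_code \<sigma>)" "Suc (str_code \<sigma>) < 2 ^ Suc (length \<sigma>)"
  by (induction \<sigma>) auto

lemma inv_str_code [simp]: "inv str_code (str_code \<sigma>) = \<sigma>" "str_code (inv str_code n) = n"
  using inj_str_code surj_str_code by (simp_all add: surj_f_inv_f)

lemma str_code_prefix_le: "prefix \<sigma> \<tau> \<Longrightarrow> str_code \<sigma> \<le> str_code \<tau>"
  by (auto simp: prefix_def str_code_append)

lemma str_code_ge_length: "length \<sigma> \<le> str_code \<sigma>"
  using str_code_bounds(1)[of \<sigma>] less_exp[of "length \<sigma>"] by linarith

definition code_prefix :: "nat \<Rightarrow> nat \<Rightarrow> bool" where
  "code_prefix a b \<longleftrightarrow> prefix (inv str_code a) (inv str_code b)"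

lemma code_prefix_le: "code_prefix a b \<Longrightarrow> a \<le> b"
  using str_code_prefix_le unfolding code_prefix_def by fastforce

text \<open>The two inequalities pin down \<open>l\<close> as the length of the string coded by
  \<open>a\<close>; by \<open>str_code_append\<close> its extensions then have the codes
  \<open>a + 2 ^ l * t\<close>, with \<open>t\<close> coding the appended string. The bounded
  quantifiers make the relation decidable.\<close>

lemma code_prefix_iff:
  "code_prefix a b \<longleftrightarrow>
    (\<exists>l<Suc a. \<exists>t<Suc b. 2 ^ l \<le> Suc a \<and> Suc a < 2 ^ Suc l \<and> b = a + 2 ^ l * t)"
proof -
  define \<sigma> where "\<sigma> = inv str_code a"
  have a: "a = str_code \<sigma>" by (simp add: \<sigma>_def)
  have unique: "l = length \<sigma>" if "2 ^ l \<le> Suc a" "Suc a < 2 ^ Suc l" for l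
  proof -
    have "2 ^ l < (2::nat) ^ Suc (length \<sigma>)" "2 ^ length \<sigma> < (2::nat) ^ Suc l"
      using that str_code_bounds[of \<sigma>] a by linarith+
    then have "l < Suc (length \<sigma>)" "length \<sigma> < Suc l" by (simp_all only: power_strict_increasing_iff one_less_numeral_iff semiring_norm)
    then show ?thesis by simp
  qed
  show ?thesis
  proof
    assume "code_prefix a b"
    then obtain \<tau> where \<tau>: "inv str_code b = \<sigma> @ \<tau>" unfolding code_prefix_def \<sigma>_def prefix_def by blast
    then have b: "b = a + 2 ^ length \<sigma> * str_code \<tau>" by (metis a inv_str_code(2) str_code_append)
    moreover have "str_code \<tau> \<le> b" unfolding b by (metis One_nat_def le_add2 le_trans mult_le_mono1 nat_mult_1 one_le_numeral one_le_power)
    ultimately show "\<exists>l<Suc a. \<exists>t<Suc b. 2 ^ l \<le> Suc a \<and> Suc a < 2 ^ Suc l \<and> b = a + 2 ^ l * t"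
      using str_code_bounds[of \<sigma>] str_code_ge_length[of \<sigma>] a by (metis less_Suc_eq_le)
  next
    assume "\<exists>l<Suc a. \<exists>t<Suc b. 2 ^ l \<le> Suc a \<and> Suc a < 2 ^ Suc l \<and> b = a + 2 ^ l * t"
    then obtain t where "b = str_code \<sigma> + 2 ^ length \<sigma> * t" using unique a by metis
    then have "b = str_code (\<sigma> @ inv str_code t)" by (simp add: str_code_append)
    then show "code_prefix a b" unfolding code_prefix_def \<sigma>_def[symmetric] by simp
  qed
qed

lemma decp_code_prefix:
  assumes "computable_in A f" "computable_in A g"
  shows "decp A (\<lambda>n. code_prefix (f n) (g n))"
  unfolding code_prefix_iff
  by (intro decp_intros computable_intros computable_comp[OF assms(1)] computable_comp[OF assms(2)] assms)

text \<open>Closure under branching points takes the place of closure under initial segments: it is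
  decidable for finite sets, passes to increasing unions, and provides the least extensions from
  which the isomorphism is built.\<close>

definition meet_closed :: "bool list set \<Rightarrow> bool" where
  "meet_closed G \<longleftrightarrow> (\<forall>\<sigma>\<in>G. \<forall>\<tau>\<in>G. \<exists>\<rho>\<in>G. prefix \<rho> \<sigma> \<and> prefix \<rho> \<tau> \<and>
     (\<forall>\<nu>. prefix \<nu> \<sigma> \<and> prefix \<nu> \<tau> \<longrightarrow> prefix \<nu> \<rho>))"

lemma meet_closed_code:
  "meet_closed (inv str_code ` set_decode g) \<longleftrightarrow>
    (\<forall>y<g. y \<in> set_decode g \<longrightarrow> (\<forall>z<g. z \<in> set_decode g \<longrightarrow>
      (\<exists>w<g. w \<in> set_decode g \<and> code_prefix w y \<and> code_prefix w z \<and>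
        (\<forall>v<Suc y. code_prefix v y \<and> code_prefix v z \<longrightarrow> code_prefix v w))))"
proof -
  \<comment> \<open>A prefix has at most the code of the whole string, so codes up to
    \<open>y\<close> include all common prefixes.\<close>
  have all: "(\<forall>v<Suc y. code_prefix v y \<and> code_prefix v z \<longrightarrow> code_prefix v w) \<longleftrightarrow>
      (\<forall>\<nu>. prefix \<nu> (inv str_code y) \<and> prefix \<nu> (inv str_code z) \<longrightarrow> prefix \<nu> (inv str_code w))" for y z w
  proof
    assume *: "\<forall>v<Suc y. code_prefix v y \<and> code_prefix v z \<longrightarrow> code_prefix v w"
    show "\<forall>\<nu>. prefix \<nu> (inv str_code y) \<and> prefix \<nu> (inv str_code z) \<longrightarrow> prefix \<nu> (inv str_code w)"
    proof (intro allI impI)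
      fix \<nu> assume "prefix \<nu> (inv str_code y) \<and> prefix \<nu> (inv str_code z)"
      then have "code_prefix (str_code \<nu>) y" "code_prefix (str_code \<nu>) z" by (simp_all add: code_prefix_def)
      with * code_prefix_le have "code_prefix (str_code \<nu>) w" by (simp add: less_Suc_eq_le)
      then show "prefix \<nu> (inv str_code w)" by (simp add: code_prefix_def)
    qed
  qed (simp add: code_prefix_def)
  have ball: "(\<forall>y<g. y \<in> set_decode g \<longrightarrow> P y) \<longleftrightarrow> (\<forall>y\<in>set_decode g. P y)" for P
    using set_decode_less by blast
  have bex: "(\<exists>y<g. y \<in> set_decode g \<and> P y) \<longleftrightarrow> (\<exists>y\<in>set_decode g. P y)" for P
    using set_decode_less by blast
  show ?thesis
    unfolding all ball bex unfolding meet_closed_def code_prefix_def ball_simps bex_simps by (rule refl)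
qed

lemma decp_meet_closed:
  assumes "computable_in A f"
  shows "decp A (\<lambda>n. meet_closed (inv str_code ` set_decode (f n)))"
proof -
  have "decp A (\<lambda>g. meet_closed (inv str_code ` set_decode g))"
    unfolding meet_closed_code by (intro decp_intros decp_code_prefix computable_intros)
  from decp_comp[OF this assms] show ?thesis .
qed

text \<open>A function \<open>C\<close> codes the sequence of colorings \<open>\<lambda>\<tau>. C (prod_encode (b, str_code \<tau>))\<close>, one for
  each coordinate \<open>b\<close>; effectively closed classes are given by forbidden finite pieces of graphs.\<close>

definition pattern_in :: "nat \<Rightarrow> (nat \<Rightarrow> nat) \<Rightarrow> bool" where
  "pattern_in w C \<longleftrightarrow> (\<forall>z\<in>set_decode w. C (pfst z) = psnd z)"

definition avoiding :: "nat \<Rightarrow> (nat \<Rightarrow> bool) \<Rightarrow> (nat \<Rightarrow> nat) set" where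
  "avoiding k W = {C. (\<forall>x. C x < k) \<and> \<not> (\<exists>w. W w \<and> pattern_in w C)}"

text \<open>A uniform sequence of effectively closed classes. Forbidden pieces are enumerated rather
  than decided, so that a condition such as the absence of a halting run can be imposed
  directly.\<close>

definition closed_family :: "nat \<Rightarrow> nat set \<Rightarrow> (nat \<Rightarrow> (nat \<Rightarrow> nat) set) \<Rightarrow> bool" where
  "closed_family k D Q \<longleftrightarrow> (\<exists>W. cep D (\<lambda>x. W (pfst x) (psnd x)) \<and> (\<forall>m. Q m = avoiding k (W m)))"

lemma pfst_le: "pfst z \<le> z"
  using le_prod_encode_1[of "pfst z" "psnd z"] by simp

text \<open>Compactness of the space of colorings with \<open>k\<close> colors: infinite sets of
  stages are thinned out so that the value at one argument after another becomes constant, and the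
  constants form the limit.\<close>

lemma avoiding_compact:
  assumes "\<And>s. \<exists>C. (\<forall>x. C x < k) \<and> (\<forall>w<s. W w \<longrightarrow> \<not> pattern_in w C)"
  shows "avoiding k W \<noteq> {}"
proof -
  obtain C where C: "\<And>s x. C s x < k" "\<And>s w. w < s \<Longrightarrow> W w \<Longrightarrow> \<not> pattern_in w (C s)"
    using assms by metis
  have step: "\<exists>Y c. Y \<subseteq> X \<and> infinite Y \<and> (\<forall>s\<in>Y. C s t = c)" if "infinite X" for X t
  proof -
    have "finite ((\<lambda>s. C s t) ` X)" by (rule finite_subset[of _ "{..<k}"]) (use C in auto)
    from pigeonhole_infinite[OF that this] obtain a where "infinite {s\<in>X. C s t = C a t}" by auto
    then show ?thesis by (intro exI[of _ "{s\<in>X. C s t = C a t}"]) auto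
  qed
  have "\<exists>X. \<forall>t. (infinite (X t) \<and> (\<exists>c. \<forall>s\<in>X (Suc t). C s t = c)) \<and> X (Suc t) \<subseteq> X t"
  proof -
    have "\<exists>X. \<forall>t. infinite (X t) \<and> (X (Suc t) \<subseteq> X t \<and> (\<exists>c. \<forall>s\<in>X (Suc t). C s t = c))"
    proof (rule dependent_nat_choice)
      show "\<exists>X :: nat set. infinite X" using infinite_UNIV_nat by (rule exI)
      show "\<exists>Y. infinite Y \<and> (Y \<subseteq> X \<and> (\<exists>c. \<forall>s\<in>Y. C s t = c))" if "infinite X" for X t
        using step[OF that, of t] by blast
    qed
    then show ?thesis by blast
  qed
  then obtain X where X: "\<And>t. infinite (X t)" "\<And>t. X (Suc t) \<subseteq> X t" "\<And>t. \<exists>c. \<forall>s\<in>X (Suc t). C s t = c"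
    by blast
  then obtain c where c: "\<And>t s. s \<in> X (Suc t) \<Longrightarrow> C s t = c t" by metis
  have anti: "X t' \<subseteq> X t" if "t \<le> t'" for t t'
    using lift_Suc_antimono_le[of X t t'] X(2) that by blast
  have "c t < k" for t
    using X(1)[of "Suc t"] c C(1) by (metis ex_in_conv finite.emptyI)
  moreover have "\<not> pattern_in w c" if w: "W w" for w
  proof
    assume p: "pattern_in w c"
    \<comment> \<open>A piece with code \<open>w\<close> mentions only arguments below
      \<open>w\<close>, and on these the coloring of any stage in \<open>X w\<close> agrees with
      \<open>c\<close>.\<close>
    obtain s where s: "s \<in> X w" "w < s" using X(1)[of w] by (meson finite_nat_set_iff_bounded_le not_le)
    have "pattern_in w (C s)"
      unfolding pattern_in_def
    proof
      fix z assume z: "z \<in> set_decode w"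
      then have "Suc (pfst z) \<le> w" using set_decode_less pfst_le[of z] by fastforce
      then have "s \<in> X (Suc (pfst z))" using anti s(1) by blast
      then show "C s (pfst z) = psnd z" using p z c unfolding pattern_in_def by metis
    qed
    then show False using C(2) s w by blast
  qed
  ultimately show ?thesis unfolding avoiding_def by blast
qed

text \<open>Base-\<open>k\<close> digits: the numbers below \<open>k ^ s\<close> run through all
  colorings of the first \<open>s\<close> arguments.\<close>

definition digit :: "nat \<Rightarrow> nat \<Rightarrow> nat \<Rightarrow> nat" where
  "digit k c x = c div k ^ x mod k"

lemma ex_digits:
  assumes "\<And>x. C x < k"
  shows "\<exists>c<k ^ s. \<forall>x<s. digit k c x = C x"
  using assms
proof (induction s arbitrary: C)
  case 0
  then show ?case by simp
next
  case (Suc s)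
  from Suc.IH[of "C \<circ> Suc"] Suc.prems obtain c where c: "c < k ^ s" "\<forall>x<s. digit k c x = C (Suc x)" by auto
  have k: "k > 0" using Suc.prems[of 0] by simp
  have div: "(C 0 + k * c) div k = c" using Suc.prems[of 0] by simp
  have "digit k (C 0 + k * c) x = C x" if "x < Suc s" for x
  proof (cases x)
    case 0
    then show ?thesis using Suc.prems[of 0] by (simp add: digit_def)
  next
    case (Suc y)
    then have "digit k (C 0 + k * c) x = digit k c y"
      using div by (simp add: digit_def div_mult2_eq)
    then show ?thesis using c Suc that by simp
  qed
  moreover have "C 0 + k * c < k ^ Suc s"
  proof -
    have "C 0 + k * c < k * Suc c" using Suc.prems[of 0] by simp
    also have "\<dots> \<le> k * k ^ s" using c(1) by (intro mult_le_mono2) simp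
    finally show ?thesis by simp
  qed
  ultimately show ?case by blast
qed

lemma computable_digit:
  assumes "computable_in A f" "computable_in A g"
  shows "computable_in A (\<lambda>n. digit k (f n) (g n))"
  unfolding digit_def by (intro computable_intros assms)

text \<open>By compactness an empty class is refuted at a finite stage, where only finitely many
  initial segments have to be examined; hence emptiness is enumerable. A piece with code below
  \<open>s\<close> mentions only arguments below \<open>s\<close>, so the first \<open>s\<close>
  digits of \<open>c\<close> decide it.\<close>

lemma avoiding_empty_iff:
  "avoiding k W = {} \<longleftrightarrow>
    (\<exists>s. \<forall>c<k ^ s. \<exists>w<s. W w \<and> (\<forall>z<w. z \<in> set_decode w \<longrightarrow> digit k c (pfst z) = psnd z))"
proof
  assume e: "avoiding k W = {}"
  show "\<exists>s. \<forall>c<k ^ s. \<exists>w<s. W w \<and> (\<forall>z<w. z \<in> set_decode w \<longrightarrow> digit k c (pfst z) = psnd z)"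
  proof (rule ccontr)
    assume *: "\<nexists>s. \<forall>c<k ^ s. \<exists>w<s. W w \<and> (\<forall>z<w. z \<in> set_decode w \<longrightarrow> digit k c (pfst z) = psnd z)"
    \<comment> \<open>For \<open>k = 0\<close> stage 1 has no candidates \<open>c\<close> and is
      already a witness.\<close>
    have "k > 0"
    proof (rule ccontr)
      assume "\<not> k > 0"
      then have "k ^ 1 = 0" by simp
      with *[unfolded not_ex, THEN spec, of 1] show False by simp
    qed
    have "\<exists>C. (\<forall>x. C x < k) \<and> (\<forall>w<s. W w \<longrightarrow> \<not> pattern_in w C)" for s
    proof -
      from *[unfolded not_ex, THEN spec, of s] obtain c where c: "\<forall>w<s. W w \<longrightarrow> (\<exists>z<w. z \<in> set_decode w \<and> digit k c (pfst z) \<noteq> psnd z)"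
        by blast
      have "\<forall>x. digit k c x < k" using \<open>k > 0\<close> by (simp add: digit_def)
      moreover have "\<forall>w<s. W w \<longrightarrow> \<not> pattern_in w (digit k c)"
        using c unfolding pattern_in_def by blast
      ultimately show ?thesis by (intro exI[of _ "digit k c"] conjI)
    qed
    then show False using avoiding_compact e by blast
  qed
next
  assume "\<exists>s. \<forall>c<k ^ s. \<exists>w<s. W w \<and> (\<forall>z<w. z \<in> set_decode w \<longrightarrow> digit k c (pfst z) = psnd z)"
  then obtain s where s: "\<forall>c<k ^ s. \<exists>w<s. W w \<and> (\<forall>z<w. z \<in> set_decode w \<longrightarrow> digit k c (pfst z) = psnd z)" ..
  have False if C: "C \<in> avoiding k W" for C
  proof -
    from C obtain c where c: "c < k ^ s" "\<forall>x<s. digit k c x = C x"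
      using ex_digits[of C k s] unfolding avoiding_def by auto
    with s obtain w where w: "w < s" "W w" "\<forall>z<w. z \<in> set_decode w \<longrightarrow> digit k c (pfst z) = psnd z"
      by blast
    have "pattern_in w C"
      unfolding pattern_in_def
    proof
      fix z assume z: "z \<in> set_decode w"
      then have "z < w" by (rule set_decode_less)
      moreover have "pfst z < s" using \<open>z < w\<close> w(1) pfst_le[of z] by linarith
      ultimately show "C (pfst z) = psnd z" using w(3) z c(2) by metis
    qed
    with w(2) C show False unfolding avoiding_def by blast
  qed
  then show "avoiding k W = {}" by blast
qed

lemma cep_closed_family_empty:
  assumes "closed_family k D Q"
  shows "cep D (\<lambda>m. Q m = {})"
proof -
  obtain W where W: "cep D (\<lambda>x. W (pfst x) (psnd x))" "\<And>m. Q m = avoiding k (W m)"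
    using assms unfolding closed_family_def by blast
  have W': "cep D (\<lambda>n. W (f n) (g n))" if "computable_in D f" "computable_in D g" for f g
    using cep_comp[OF W(1) computable_pair[OF that]] by simp
  show ?thesis
    unfolding W(2) avoiding_empty_iff
    by (intro cep_intros W' cep_decp[OF decp_imp] cep_decp[OF decp_eq] decp_intros computable_intros
       computable_digit)
qed

section \<open>Closure properties of uniformly closed classes\<close>

lemma closed_family_comp:
  assumes "closed_family k D Q" "computable_in D f"
  shows "closed_family k D (\<lambda>m. Q (f m))"
proof -
  obtain W where W: "cep D (\<lambda>x. W (pfst x) (psnd x))" "\<And>m. Q m = avoiding k (W m)"
    using assms unfolding closed_family_def by blast
  have "cep D (\<lambda>x. W (f (pfst x)) (psnd x))"
    using cep_comp[OF W(1) computable_pair[OF computable_comp[OF assms(2) computable_pfst[OF computable_id]]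
        computable_psnd[OF computable_id]]] by simp
  then show ?thesis
    using W(2) unfolding closed_family_def by (intro exI[of _ "\<lambda>m. W (f m)"]) simp
qed

lemma closed_family_valid: "closed_family k D Q \<Longrightarrow> C \<in> Q m \<Longrightarrow> C x < k"
  unfolding closed_family_def avoiding_def by blast

lemma closed_family_Int:
  assumes "closed_family k D Q" "closed_family k D Q'"
  shows "closed_family k D (\<lambda>m. Q m \<inter> Q' m)"
proof -
  obtain W where W: "cep D (\<lambda>x. W (pfst x) (psnd x))" "\<And>m. Q m = avoiding k (W m)"
    using assms unfolding closed_family_def by blast
  obtain W' where W': "cep D (\<lambda>x. W' (pfst x) (psnd x))" "\<And>m. Q' m = avoiding k (W' m)"
    using assms unfolding closed_family_def by blast
  show ?thesis
    unfolding closed_family_def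
    by (intro exI[of _ "\<lambda>m w. W m w \<or> W' m w"] conjI cep_disj W(1) W'(1))
      (auto simp: W(2) W'(2) avoiding_def)
qed

text \<open>The bound on the colors is stated separately so that the empty intersection is still a
  class of colorings.\<close>

lemma closed_family_INT:
  assumes "finite X" "\<And>a. a \<in> X \<Longrightarrow> closed_family k D (Q a)"
  shows "closed_family k D (\<lambda>m. {C. (\<forall>x. C x < k) \<and> (\<forall>a\<in>X. C \<in> Q a m)})"
  using assms
proof (induction X)
  case empty
  have "closed_family k D (\<lambda>m. avoiding k (\<lambda>_. False))"
    unfolding closed_family_def by (intro exI[of _ "\<lambda>_ _. False"]) (simp add: cep_decp decp_const)
  then show ?case by (simp add: avoiding_def)
next
  case (insert a X)
  from insert closed_family_Int[of k D "Q a" "\<lambda>m. {C. (\<forall>x. C x < k) \<and> (\<forall>a\<in>X. C \<in> Q a m)}"]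
  have "closed_family k D (\<lambda>m. Q a m \<inter> {C. (\<forall>x. C x < k) \<and> (\<forall>a\<in>X. C \<in> Q a m)})" by blast
  then show ?case
    by (rule back_subst[of "closed_family k D"]) auto
qed

text \<open>Serves to form products of classes: with \<open>r = place v\<close> it speaks about the
  component \<open>v\<close> of a joint tuple.\<close>

lemma closed_family_reindex:
  assumes "closed_family k D Q" "computable_in D r"
  shows "closed_family k D (\<lambda>m. {C. (\<forall>x. C x < k) \<and> C \<circ> r \<in> Q m})"
proof -
  obtain W where W: "cep D (\<lambda>x. W (pfst x) (psnd x))" "\<And>m. Q m = avoiding k (W m)"
    using assms unfolding closed_family_def by blast
  \<comment> \<open>Any finite piece \<open>w'\<close> containing the translate of \<open>w\<close>
    is forbidden; this spares computing the code of the translate, and the larger pieces exclude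
    nothing more.\<close>
  let ?W = "\<lambda>m w'. \<exists>w. W m w \<and> (\<forall>z<w. z \<in> set_decode w \<longrightarrow> prod_encode (r (pfst z), psnd z) \<in> set_decode w')"
  have W': "cep D (\<lambda>n. W (f n) (g n))" if "computable_in D f" "computable_in D g" for f g
    using cep_comp[OF W(1) computable_pair[OF that]] by simp
  have "cep D (\<lambda>x. ?W (pfst x) (psnd x))"
    by (intro cep_ex cep_conj W' cep_decp[OF decp_ball] decp_intros computable_intros
        computable_comp[OF assms(2)])
  moreover have "{C. (\<forall>x. C x < k) \<and> C \<circ> r \<in> Q m} = avoiding k (?W m)" for m
  proof -
    have "(\<exists>w'. ?W m w' \<and> pattern_in w' C) \<longleftrightarrow> (\<exists>w. W m w \<and> pattern_in w (C \<circ> r))" for C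
    proof
      assume "\<exists>w'. ?W m w' \<and> pattern_in w' C"
      then obtain w' w where *: "W m w" "\<forall>z<w. z \<in> set_decode w \<longrightarrow> prod_encode (r (pfst z), psnd z) \<in> set_decode w'"
        "pattern_in w' C" by blast
      have "pattern_in w (C \<circ> r)"
        unfolding pattern_in_def
      proof
        fix z assume z: "z \<in> set_decode w"
        then have "prod_encode (r (pfst z), psnd z) \<in> set_decode w'" using * set_decode_less by blast
        with *(3) show "(C \<circ> r) (pfst z) = psnd z" unfolding pattern_in_def by fastforce
      qed
      with * show "\<exists>w. W m w \<and> pattern_in w (C \<circ> r)" by blast
    next
      assume "\<exists>w. W m w \<and> pattern_in w (C \<circ> r)"
      then obtain w where w: "W m w" "pattern_in w (C \<circ> r)" by blast
      let ?w' = "set_encode ((\<lambda>z. prod_encode (r (pfst z), psnd z)) ` set_decode w)"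
      have "set_decode ?w' = (\<lambda>z. prod_encode (r (pfst z), psnd z)) ` set_decode w" by simp
      then have "?W m ?w'" "pattern_in ?w' C" using w unfolding pattern_in_def by auto
      then show "\<exists>w'. ?W m w' \<and> pattern_in w' C" by blast
    qed
    then show ?thesis
      by (intro set_eqI) (simp only: avoiding_def mem_Collect_eq W(2) o_apply, blast)
  qed
  ultimately show ?thesis unfolding closed_family_def by (intro exI[of _ ?W]) blast
qed

text \<open>The sets coded by \<open>e\<close> will be the finite candidate trees of a part, with
  \<open>F\<close> its old nodes, or single nodes. Each of them turns into one finite piece of graph
  to be forbidden.\<close>

lemma closed_family_avoid_uniform:
  assumes "cep D (\<lambda>x. Z (pfst x) (psnd x))" "finite F" "finite B"
  shows "closed_family k D (\<lambda>m. {C. (\<forall>x. C x < k) \<and>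
    (\<forall>e. Z m e \<longrightarrow> \<not> (\<forall>x\<in>set_decode e - F. \<forall>b\<in>B. C (prod_encode (b, x)) = i))})"
proof -
  let ?f = "set_encode F" and ?b = "set_encode B"
  let ?W = "\<lambda>m w. \<exists>e. Z m e \<and> (\<forall>x<e. x \<in> set_decode e \<and> \<not> x \<in> set_decode ?f \<longrightarrow>
      (\<forall>b<?b. b \<in> set_decode ?b \<longrightarrow> prod_encode (prod_encode (b, x), i) \<in> set_decode w))"
  have Z': "cep D (\<lambda>n. Z (f n) (g n))" if "computable_in D f" "computable_in D g" for f g
    using cep_comp[OF assms(1) computable_pair[OF that]] by simp
  have "cep D (\<lambda>x. ?W (pfst x) (psnd x))"
    by (intro cep_ex cep_conj Z' cep_decp[OF decp_ball] decp_intros computable_intros)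
  moreover have "{C. (\<forall>x. C x < k) \<and>
    (\<forall>e. Z m e \<longrightarrow> \<not> (\<forall>x\<in>set_decode e - F. \<forall>b\<in>B. C (prod_encode (b, x)) = i))} = avoiding k (?W m)" for m
  proof -
    have "(\<exists>w. ?W m w \<and> pattern_in w C) \<longleftrightarrow>
        (\<exists>e. Z m e \<and> (\<forall>x\<in>set_decode e - F. \<forall>b\<in>B. C (prod_encode (b, x)) = i))" for C
    proof
      assume "\<exists>w. ?W m w \<and> pattern_in w C"
      then obtain w e where *: "Z m e" "pattern_in w C"
        "\<And>x b. x \<in> set_decode e \<Longrightarrow> x \<notin> F \<Longrightarrow> b \<in> B \<Longrightarrow> prod_encode (prod_encode (b, x), i) \<in> set_decode w"
        using set_decode_less assms(2,3) by fastforce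
      have "C (prod_encode (b, x)) = i" if "x \<in> set_decode e" "x \<notin> F" "b \<in> B" for x b
        using *(3)[OF that] *(2) unfolding pattern_in_def by fastforce
      with * show "\<exists>e. Z m e \<and> (\<forall>x\<in>set_decode e - F. \<forall>b\<in>B. C (prod_encode (b, x)) = i)" by blast
    next
      assume "\<exists>e. Z m e \<and> (\<forall>x\<in>set_decode e - F. \<forall>b\<in>B. C (prod_encode (b, x)) = i)"
      then obtain e where e: "Z m e" "\<forall>x\<in>set_decode e - F. \<forall>b\<in>B. C (prod_encode (b, x)) = i" by blast
      let ?w = "set_encode ((\<lambda>(b, x). prod_encode (prod_encode (b, x), i)) ` (B \<times> (set_decode e - F)))"
      have "set_decode ?w = (\<lambda>(b, x). prod_encode (prod_encode (b, x), i)) ` (B \<times> (set_decode e - F))"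
        using assms(3) by simp
      then have "?W m ?w" "pattern_in ?w C" using e assms(2,3) unfolding pattern_in_def by auto
      then show "\<exists>w. ?W m w \<and> pattern_in w C" by blast
    qed
    then show ?thesis by (intro set_eqI) (simp only: avoiding_def mem_Collect_eq, blast)
  qed
  ultimately show ?thesis unfolding closed_family_def by (intro exI[of _ ?W]) blast
qed

text \<open>Only finitely many values of \<open>E\<close> matter and can be built into the
  enumeration. This permits freezing a coloring of unknown complexity.\<close>

lemma closed_family_agree:
  assumes "finite X"
  shows "closed_family k D (\<lambda>m. {C. (\<forall>x. C x < k) \<and> (\<forall>x\<in>X. C x = E x)})"
proof -
  let ?W = "\<lambda>(m::nat) w. \<exists>z<w. z \<in> set_decode w \<and> (\<exists>x\<in>X. pfst z = x \<and> \<not> psnd z = E x)"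
  have "cep D (\<lambda>x. ?W (pfst x) (psnd x))"
    by (intro cep_bex cep_conj cep_Bex_finite assms cep_decp decp_conj[OF decp_eq decp_not] decp_set_decode decp_eq computable_intros)
  moreover have "{C. (\<forall>x. C x < k) \<and> (\<forall>x\<in>X. C x = E x)} = avoiding k (?W m)" for m :: nat
  proof -
    have "(\<exists>w. ?W m w \<and> pattern_in w C) \<longleftrightarrow> \<not> (\<forall>x\<in>X. C x = E x)" for C
    proof
      assume "\<not> (\<forall>x\<in>X. C x = E x)"
      then obtain x where x: "x \<in> X" "C x \<noteq> E x" by blast
      let ?w = "set_encode {prod_encode (x, C x)}"
      have w: "set_decode ?w = {prod_encode (x, C x)}" by (rule set_encode_inverse) simp
      then have "prod_encode (x, C x) < ?w" using set_decode_less by blast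
      with w x have "?W m ?w" by force
      moreover have "pattern_in ?w C" unfolding pattern_in_def w by simp
      ultimately show "\<exists>w. ?W m w \<and> pattern_in w C" by blast
    qed (metis pattern_in_def)
    then show ?thesis by (intro set_eqI) (simp only: avoiding_def mem_Collect_eq, blast)
  qed
  ultimately show ?thesis unfolding closed_family_def by (intro exI[of _ ?W]) blast
qed

text \<open>The given class is imposed on coordinate 0 of the tuples, the others being free. A
  forbidden piece contains the first \<open>n\<close> colors of a sequence outside
  \<open>R\<close>.\<close>

lemma closed_family_Pi01:
  assumes "Pi01_class D k Q"
  shows "closed_family k D (\<lambda>_. {C. (\<forall>x. C x < k) \<and> (\<lambda>\<sigma>. C (prod_encode (0, str_code \<sigma>))) \<in> Q})"
proof -
  obtain R where R: "R \<subseteq> lists {..<k}" "decidable_in D (list_encode ` R)"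
    "Q = {C \<in> colorings k. \<forall>n. initial_segment C n \<in> R}"
    using assms unfolding Pi01_class_def by blast
  have decR: "decp D (\<lambda>n. n \<in> list_encode ` R)" using R(2) unfolding decidable_in_def decp_def .
  let ?e = "\<lambda>c n. list_encode (map (digit k c) [0..<n])"
  \<comment> \<open>The code of a list is built from its last entry, so the recursion reads the
    digits backwards.\<close>
  have rec: "j \<le> n \<Longrightarrow> rec_nat 0 (\<lambda>j y. Suc (prod_encode (digit k c (n - Suc j), y))) j
      = list_encode (map (digit k c) [n - j..<n])" for c n j
  proof (induction j)
    case (Suc j)
    then have "[n - Suc j..<n] = (n - Suc j) # [n - j..<n]"
      by (simp add: upt_conv_Cons Suc_diff_Suc)
    with Suc show ?case by simp
  qed simp
  have e: "computable_in D (\<lambda>x. ?e (f x) (g x))" if fg: "computable_in D f" "computable_in D g" for f g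
  proof -
    have "computable_in D (\<lambda>x. rec_nat 0 (\<lambda>j y. Suc (prod_encode (digit k (f x) (g x - Suc j), y))) (g x))"
      by (rule computable_rec)
        (intro computable_intros computable_digit fg computable_comp[OF fg(1)] computable_comp[OF fg(2)])+
    then show ?thesis using rec by simp
  qed
  let ?W = "\<lambda>(m::nat) w. \<exists>c. \<exists>n. \<not> (?e c n \<in> list_encode ` R) \<and>
      (\<forall>j<n. prod_encode (prod_encode (0, j), digit k c j) \<in> set_decode w)"
  have "cep D (\<lambda>x. ?W (pfst x) (psnd x))"
    by (intro cep_ex cep_decp decp_intros decp_comp[OF decR] e computable_intros computable_digit)
  moreover have "{C. (\<forall>x. C x < k) \<and> (\<lambda>\<sigma>. C (prod_encode (0, str_code \<sigma>))) \<in> Q} = avoiding k (?W m)" for m :: nat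
  proof -
    have "(\<exists>w. ?W m w \<and> pattern_in w C) \<longleftrightarrow> (\<lambda>\<sigma>. C (prod_encode (0, str_code \<sigma>))) \<notin> Q"
      if C: "\<forall>x. C x < k" for C
    proof -
      let ?C = "\<lambda>j. C (prod_encode (0, j))"
      have seg: "initial_segment (\<lambda>\<sigma>. ?C (str_code \<sigma>)) n = map ?C [0..<n]" for n
        by (simp add: initial_segment_def)
      have inR: "map (digit k c) [0..<n] \<in> R \<longleftrightarrow> ?e c n \<in> list_encode ` R" for c n
        using inj_list_encode[of UNIV] by (simp add: inj_image_mem_iff)
      have "(\<exists>w. ?W m w \<and> pattern_in w C) \<longleftrightarrow> (\<exists>n. map ?C [0..<n] \<notin> R)"
      proof
        assume "\<exists>w. ?W m w \<and> pattern_in w C"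
        then obtain w c n where *: "?e c n \<notin> list_encode ` R"
          "\<forall>j<n. prod_encode (prod_encode (0, j), digit k c j) \<in> set_decode w" "pattern_in w C" by blast
        have "?C j = digit k c j" if "j < n" for j
          using *(2,3) that unfolding pattern_in_def by fastforce
        then have "map ?C [0..<n] = map (digit k c) [0..<n]" by simp
        with *(1) inR show "\<exists>n. map ?C [0..<n] \<notin> R" by metis
      next
        assume "\<exists>n. map ?C [0..<n] \<notin> R"
        then obtain n where n: "map ?C [0..<n] \<notin> R" ..
        obtain c where c: "\<forall>j<n. digit k c j = ?C j" using ex_digits[of ?C k n] C by blast
        then have "map (digit k c) [0..<n] = map ?C [0..<n]" by simp
        with n inR have "?e c n \<notin> list_encode ` R" by metis
        moreover let ?w = "set_encode ((\<lambda>j. prod_encode (prod_encode (0, j), digit k c j)) ` {..<n})"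
        have "set_decode ?w = (\<lambda>j. prod_encode (prod_encode (0, j), digit k c j)) ` {..<n}" by simp
        then have "\<forall>j<n. prod_encode (prod_encode (0, j), digit k c j) \<in> set_decode ?w" "pattern_in ?w C"
          using c unfolding pattern_in_def by auto
        ultimately show "\<exists>w. ?W m w \<and> pattern_in w C" by blast
      qed
      moreover have "(\<lambda>\<sigma>. ?C (str_code \<sigma>)) \<in> colorings k" using C by (simp add: colorings_def)
      ultimately show ?thesis unfolding R(3) by (simp add: seg)
    qed
    then show ?thesis by (intro set_eqI) (simp only: avoiding_def mem_Collect_eq, blast)
  qed
  ultimately show ?thesis unfolding closed_family_def by (intro exI[of _ ?W]) blast
qed


section \<open>Parts, cones and coverings\<close>

definition is_meet :: "bool list \<Rightarrow> bool list \<Rightarrow> bool list \<Rightarrow> bool" where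
  "is_meet \<rho> \<sigma> \<tau> \<longleftrightarrow> prefix \<rho> \<sigma> \<and> prefix \<rho> \<tau> \<and> (\<forall>\<nu>. prefix \<nu> \<sigma> \<and> prefix \<nu> \<tau> \<longrightarrow> prefix \<nu> \<rho>)"

lemma meet_closed_iff: "meet_closed G \<longleftrightarrow> (\<forall>\<sigma>\<in>G. \<forall>\<tau>\<in>G. \<exists>\<rho>\<in>G. is_meet \<rho> \<sigma> \<tau>)"
  by (simp add: meet_closed_def is_meet_def)

lemma is_meet_commute: "is_meet \<rho> \<sigma> \<tau> \<longleftrightarrow> is_meet \<rho> \<tau> \<sigma>"
  by (auto simp: is_meet_def)

lemma is_meet_refl: "is_meet \<sigma> \<sigma> \<sigma>"
  by (auto simp: is_meet_def)

text \<open>If \<open>\<sigma>\<close> is not below \<open>\<tau>\<close>, either the two have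
  already parted or \<open>\<tau>\<close> lies below \<open>\<sigma>\<close>; extending
  \<open>\<sigma>\<close> does not change where they separate.\<close>

lemma is_meet_extend:
  assumes "is_meet \<rho> \<sigma> \<tau>" "\<not> prefix \<sigma> \<tau>" "prefix \<sigma> \<sigma>'"
  shows "is_meet \<rho> \<sigma>' \<tau>"
  using assms unfolding is_meet_def by (meson prefix_order.trans prefix_same_cases)

text \<open>Here \<open>\<sigma>\<close> may lie below \<open>\<tau>\<close>; the new bit then
  leaves \<open>\<tau>\<close> and the meet is still \<open>\<sigma>\<close>.\<close>

lemma is_meet_snoc:
  assumes "is_meet \<rho> \<sigma> \<tau>" "\<not> prefix (\<sigma> @ [b]) \<tau>"
  shows "is_meet \<rho> (\<sigma> @ [b]) \<tau>"
  using assms unfolding is_meet_def by (metis prefix_order.trans prefix_snoc prefixI)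

datatype part = Part (nodes: "bool list set") (cones: "bool list set") (coords: "nat set") (hue: nat)

definition matches :: "(nat \<Rightarrow> nat) \<Rightarrow> part \<Rightarrow> bool list \<Rightarrow> bool" where
  "matches C p \<tau> \<longleftrightarrow> (\<forall>b\<in>coords p. C (prod_encode (b, str_code \<tau>)) = hue p)"

text \<open>The finite pieces of the final tree that are still possible. Colors are demanded of new
  nodes only; those of the old nodes are secured by \<open>freeze_coloring\<close>.\<close>

definition gen :: "part \<Rightarrow> (nat \<Rightarrow> nat) \<Rightarrow> bool list set set" where
  "gen p C = {G. finite G \<and> meet_closed G \<and> nodes p \<subseteq> G \<and>
     (\<forall>x\<in>G - nodes p. (\<exists>\<kappa>\<in>cones p. prefix \<kappa> x) \<and> matches C p x)}"

definition extending :: "(bool list \<Rightarrow> bool list) \<Rightarrow> bool" where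
  "extending g \<longleftrightarrow> (\<forall>\<tau>. prefix \<tau> (g \<tau>))"

definition shrink :: "(bool list \<Rightarrow> bool list) \<Rightarrow> part \<Rightarrow> part" where
  "shrink g p = Part (nodes p) (g ` cones p) (coords p) (hue p)"

text \<open>One \<open>h\<close> serves all parts, so parts that share a cone receive the same node
  there; \<open>covers_eliminate_kind\<close> depends on this. Quantifying over all \<open>h\<close>
  makes the notion stable under raising the cones.\<close>

definition covers :: "(nat \<Rightarrow> nat) set \<Rightarrow> part set \<Rightarrow> bool" where
  "covers Q P \<longleftrightarrow> (\<forall>C\<in>Q. \<forall>h. extending h \<longrightarrow> (\<exists>p\<in>P. \<forall>\<kappa>\<in>cones p. matches C p (h \<kappa>)))"

text \<open>Cones are the open ends: pairwise incomparable, with no node above them. Each immediate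
  successor of a node is a prefix of a node or a cone, so adding nodes above all cones again and
  again yields a perfect tree.\<close>

definition wf_part :: "part \<Rightarrow> bool" where
  "wf_part p \<longleftrightarrow> finite (nodes p) \<and> finite (cones p) \<and> finite (coords p) \<and> coords p \<noteq> {} \<and>
     meet_closed (nodes p \<union> cones p) \<and>
     (\<forall>\<kappa>\<in>cones p. \<forall>x\<in>nodes p \<union> cones p. prefix \<kappa> x \<longrightarrow> x = \<kappa> \<and> x \<notin> nodes p) \<and>
     (\<forall>x\<in>nodes p. \<forall>b. \<exists>y\<in>nodes p \<union> cones p. prefix (x @ [b]) y) \<and>
     (nodes p = {} \<longrightarrow> cones p \<noteq> {})"

lemma wf_partI:
  assumes "finite (nodes p)" "finite (cones p)" "finite (coords p)" "coords p \<noteq> {}"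
    and "\<And>y z. y \<in> nodes p \<union> cones p \<Longrightarrow> z \<in> nodes p \<union> cones p \<Longrightarrow> \<exists>w\<in>nodes p \<union> cones p. is_meet w y z"
    and "\<And>l x. l \<in> cones p \<Longrightarrow> x \<in> nodes p \<union> cones p \<Longrightarrow> prefix l x \<Longrightarrow> x = l \<and> x \<notin> nodes p"
    and "\<And>x b. x \<in> nodes p \<Longrightarrow> \<exists>y\<in>nodes p \<union> cones p. prefix (x @ [b]) y"
    and "nodes p = {} \<Longrightarrow> cones p \<noteq> {}"
  shows "wf_part p"
  unfolding wf_part_def meet_closed_iff
proof (intro conjI)
  show "\<forall>\<kappa>\<in>cones p. \<forall>x\<in>nodes p \<union> cones p. prefix \<kappa> x \<longrightarrow> x = \<kappa> \<and> x \<notin> nodes p"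
    using assms(6) by blast
qed (intro assms ballI allI impI; assumption)+

definition extends_part :: "(nat \<Rightarrow> nat) \<Rightarrow> part \<Rightarrow> part \<Rightarrow> bool" where
  "extends_part C q p \<longleftrightarrow> coords q = coords p \<and> hue q = hue p \<and> nodes p \<subseteq> nodes q \<and>
     (\<forall>x\<in>nodes q - nodes p. (\<exists>\<kappa>\<in>cones p. prefix \<kappa> x) \<and> matches C p x) \<and>
     (\<forall>\<mu>\<in>cones q. \<exists>\<kappa>\<in>cones p. prefix \<kappa> \<mu>) \<and> (\<forall>\<kappa>\<in>cones p. \<exists>\<mu>\<in>cones q. prefix \<kappa> \<mu>)"

lemma shrink_sel [simp]: "nodes (shrink g p) = nodes p" "cones (shrink g p) = g ` cones p"
  "coords (shrink g p) = coords p" "hue (shrink g p) = hue p"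
  by (simp_all add: shrink_def)

lemma matches_shrink [simp]: "matches C (shrink g p) \<tau> \<longleftrightarrow> matches C p \<tau>"
  by (simp add: matches_def)

lemma shrink_shrink: "shrink f (shrink g p) = shrink (f \<circ> g) p"
  by (simp add: shrink_def image_comp)

lemma shrink_id [simp]: "shrink id p = p"
  by (simp add: shrink_def)

lemma extending_comp: "extending f \<Longrightarrow> extending g \<Longrightarrow> extending (f \<circ> g)"
  unfolding extending_def by (metis comp_apply prefix_order.trans)

lemma extending_id: "extending id"
  by (simp add: extending_def)

lemma gen_shrink:
  assumes "extending g" shows "gen (shrink g p) C \<subseteq> gen p C"
proof
  fix G assume G: "G \<in> gen (shrink g p) C"
  have "\<exists>\<kappa>\<in>cones p. prefix \<kappa> x" if x: "x \<in> G - nodes p" for x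
  proof -
    obtain \<kappa> where "\<kappa> \<in> cones p" "prefix (g \<kappa>) x" using G x unfolding gen_def by auto
    then show ?thesis using assms unfolding extending_def by (meson prefix_order.trans)
  qed
  with G show "G \<in> gen p C" unfolding gen_def by simp
qed

lemma covers_shrink:
  assumes "covers Q P" "extending g" shows "covers Q (shrink g ` P)"
  unfolding covers_def
proof (intro ballI allI impI)
  fix C h assume "C \<in> Q" "extending h"
  then obtain p where "p \<in> P" "\<forall>\<kappa>\<in>cones p. matches C p ((h \<circ> g) \<kappa>)"
    using assms extending_comp unfolding covers_def by blast
  then show "\<exists>p\<in>shrink g ` P. \<forall>\<kappa>\<in>cones p. matches C p (h \<kappa>)" by (intro bexI[of _ "shrink g p"]) auto
qed

lemma covers_mono: "covers Q P \<Longrightarrow> Q' \<subseteq> Q \<Longrightarrow> P \<subseteq> P' \<Longrightarrow> covers Q' P'"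
  unfolding covers_def by blast

text \<open>Distinct cones are incomparable and no cone lies below a node, so their meets with each
  other and with nodes are nodes, and raising the cones does not affect these.\<close>

lemma wf_shrink:
  assumes "wf_part p" "extending g" shows "wf_part (shrink g p)"
proof -
  have g: "\<And>\<tau>. prefix \<tau> (g \<tau>)" using assms(2) by (simp add: extending_def)
  have mc: "\<And>y z. y \<in> nodes p \<union> cones p \<Longrightarrow> z \<in> nodes p \<union> cones p \<Longrightarrow> \<exists>w\<in>nodes p \<union> cones p. is_meet w y z"
    and anti: "\<And>l x. l \<in> cones p \<Longrightarrow> x \<in> nodes p \<union> cones p \<Longrightarrow> prefix l x \<Longrightarrow> x = l \<and> x \<notin> nodes p"
    and live: "\<And>x b. x \<in> nodes p \<Longrightarrow> \<exists>y\<in>nodes p \<union> cones p. prefix (x @ [b]) y"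
    using assms(1) unfolding wf_part_def meet_closed_iff by blast+
  have anti': "x = l" if "l \<in> cones p" "x \<in> cones p" "prefix l (g x)" for l x
    using that anti[of l x] anti[of x l] g[of x] prefix_same_cases[of l "g x" x] by blast
  have nopre: "\<not> prefix (g l) x" "\<not> prefix l x" if "l \<in> cones p" "x \<in> nodes p" for l x
    using that anti[of l x] g[of l] prefix_order.trans by blast+
  have "\<exists>w\<in>nodes p \<union> g ` cones p. is_meet w y z"
    if y: "y \<in> nodes p \<union> g ` cones p" and z: "z \<in> nodes p \<union> g ` cones p" for y z
  proof -
    have mixed: "\<exists>w\<in>nodes p. is_meet w (g l) x" if l: "l \<in> cones p" and x: "x \<in> nodes p" for l x
    proof -
      obtain w where w: "w \<in> nodes p \<union> cones p" "is_meet w l x" using mc l x by blast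
      have "w \<in> nodes p" using w nopre(2)[of w x] x unfolding is_meet_def by blast
      then show ?thesis using is_meet_extend[OF w(2) nopre(2)[OF l x] g] by blast
    qed
    have both: "\<exists>w\<in>nodes p \<union> g ` cones p. is_meet w (g l) (g l')" if l: "l \<in> cones p" and l': "l' \<in> cones p" for l l'
    proof (cases "l = l'")
      case True
      then show ?thesis using is_meet_refl l by blast
    next
      case False
      obtain w where w: "w \<in> nodes p \<union> cones p" "is_meet w l l'" using mc l l' by blast
      then have "w \<in> nodes p" using anti[of w l] anti[of w l'] l l' False unfolding is_meet_def by blast
      moreover have "is_meet w (g l) l'"
        using is_meet_extend[OF w(2) _ g] anti[of l l'] l l' False by blast
      then have "is_meet w (g l') (g l)"
        using is_meet_extend[of w l' "g l" "g l'"] is_meet_commute anti'[of l' l] l l' False g by blast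
      ultimately show ?thesis using is_meet_commute by blast
    qed
    have nn: "\<exists>w\<in>nodes p. is_meet w x x'" if x: "x \<in> nodes p" and x': "x' \<in> nodes p" for x x'
    proof -
      obtain w where w: "w \<in> nodes p \<union> cones p" "is_meet w x x'" using mc x x' by blast
      then show ?thesis using anti[of w x] x unfolding is_meet_def by blast
    qed
    consider "y \<in> nodes p" "z \<in> nodes p" | l where "l \<in> cones p" "y = g l" "z \<in> nodes p"
      | l where "l \<in> cones p" "z = g l" "y \<in> nodes p"
      | l l' where "l \<in> cones p" "y = g l" "l' \<in> cones p" "z = g l'" using y z by blast
    then show ?thesis
    proof cases
      case 1
      then show ?thesis using nn by blast
    next
      case 2
      then show ?thesis using mixed by blast
    next
      case 3
      then show ?thesis using mixed is_meet_commute by blast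
    next
      case 4
      then show ?thesis using both by blast
    qed
  qed
  moreover have "\<exists>y\<in>nodes p \<union> g ` cones p. prefix (x @ [b]) y" if "x \<in> nodes p" for x b
    using live[OF that, of b] g prefix_order.trans by blast
  moreover have "x = l \<and> x \<notin> nodes p"
    if l: "l \<in> g ` cones p" and x: "x \<in> nodes p \<union> g ` cones p" and le: "prefix l x" for l x
  proof -
    obtain m where m: "m \<in> cones p" "l = g m" using l by blast
    have "x \<notin> nodes p" using nopre(1) m le by blast
    with x obtain m' where m': "m' \<in> cones p" "x = g m'" by blast
    have "prefix m (g m')" using le m m' g prefix_order.trans by blast
    then have "m = m'" using anti' m m' by blast
    with m m' \<open>x \<notin> nodes p\<close> show ?thesis by blast
  qed
  moreover have "finite (nodes p)" "finite (cones p)" "finite (coords p)" "coords p \<noteq> {}"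
    "nodes p = {} \<Longrightarrow> cones p \<noteq> {}"
    using assms(1) unfolding wf_part_def by blast+
  ultimately show ?thesis
    by (intro wf_partI) (simp_all only: shrink_sel finite_imageI image_is_empty not_False_eq_True)
qed

lemma wf_meet_closed_nodes:
  assumes "wf_part p" shows "meet_closed (nodes p)"
proof -
  have mc: "\<And>y z. y \<in> nodes p \<union> cones p \<Longrightarrow> z \<in> nodes p \<union> cones p \<Longrightarrow> \<exists>w\<in>nodes p \<union> cones p. is_meet w y z"
    and anti: "\<And>l x. l \<in> cones p \<Longrightarrow> x \<in> nodes p \<union> cones p \<Longrightarrow> prefix l x \<Longrightarrow> x = l \<and> x \<notin> nodes p"
    using assms(1) unfolding wf_part_def meet_closed_iff by blast+
  show ?thesis
    unfolding meet_closed_iff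
  proof (intro ballI)
    fix y z assume "y \<in> nodes p" "z \<in> nodes p"
    then obtain w where "w \<in> nodes p \<union> cones p" "is_meet w y z" using mc by blast
    then show "\<exists>w\<in>nodes p. is_meet w y z" using anti[of w y] \<open>y \<in> nodes p\<close> unfolding is_meet_def by blast
  qed
qed

lemma extends_part_shrink_right:
  assumes "extends_part C q (shrink g p)" "extending g"
  shows "extends_part C q p"
proof -
  have g: "prefix \<kappa> \<tau>" if "prefix (g \<kappa>) \<tau>" for \<kappa> \<tau>
    using assms(2) that prefix_order.trans unfolding extending_def by blast
  have q: "nodes p \<subseteq> nodes q" "coords q = coords p" "hue q = hue p"
    "\<And>x. x \<in> nodes q - nodes p \<Longrightarrow> \<exists>\<kappa>\<in>cones p. prefix (g \<kappa>) x"
    "\<And>x. x \<in> nodes q - nodes p \<Longrightarrow> matches C p x"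
    "\<And>\<mu>. \<mu> \<in> cones q \<Longrightarrow> \<exists>\<kappa>\<in>cones p. prefix (g \<kappa>) \<mu>"
    "\<And>\<kappa>. \<kappa> \<in> cones p \<Longrightarrow> \<exists>\<mu>\<in>cones q. prefix (g \<kappa>) \<mu>"
    using assms(1) unfolding extends_part_def by auto
  show ?thesis unfolding extends_part_def using q g by meson
qed

lemma extends_part_shrink_left:
  assumes "extends_part C q p" "extending g"
  shows "extends_part C (shrink g q) p"
proof -
  have g: "prefix \<kappa> (g \<tau>)" if "prefix \<kappa> \<tau>" for \<kappa> \<tau>
    using assms(2) that prefix_order.trans unfolding extending_def by blast
  have q: "nodes p \<subseteq> nodes q" "coords q = coords p" "hue q = hue p"
    "\<And>x. x \<in> nodes q - nodes p \<Longrightarrow> (\<exists>\<kappa>\<in>cones p. prefix \<kappa> x) \<and> matches C p x"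
    "\<And>\<mu>. \<mu> \<in> cones q \<Longrightarrow> \<exists>\<kappa>\<in>cones p. prefix \<kappa> \<mu>"
    "\<And>\<kappa>. \<kappa> \<in> cones p \<Longrightarrow> \<exists>\<mu>\<in>cones q. prefix \<kappa> \<mu>"
    using assms(1) unfolding extends_part_def by auto
  have "\<forall>\<mu>\<in>g ` cones q. \<exists>\<kappa>\<in>cones p. prefix \<kappa> \<mu>" using q(5) g by blast
  moreover have "\<forall>\<kappa>\<in>cones p. \<exists>\<mu>\<in>g ` cones q. prefix \<kappa> \<mu>" using q(6) g by blast
  ultimately show ?thesis unfolding extends_part_def shrink_sel using q by blast
qed

lemma grow_part:
  assumes wf: "wf_part p" and G: "G \<in> gen p C"
  shows "\<exists>q. wf_part q \<and> nodes q = G \<and> extends_part C q p \<and> (\<forall>\<mu>\<in>cones q. u \<le> length \<mu>)"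
proof -
  have mc: "\<And>y z. y \<in> nodes p \<union> cones p \<Longrightarrow> z \<in> nodes p \<union> cones p \<Longrightarrow> \<exists>w\<in>nodes p \<union> cones p. is_meet w y z"
    and anti: "\<And>l x. l \<in> cones p \<Longrightarrow> x \<in> nodes p \<union> cones p \<Longrightarrow> prefix l x \<Longrightarrow> x = l \<and> x \<notin> nodes p"
    and live: "\<And>x b. x \<in> nodes p \<Longrightarrow> \<exists>y\<in>nodes p \<union> cones p. prefix (x @ [b]) y"
    and fin: "finite (nodes p)" "finite (cones p)" "finite (coords p)" "coords p \<noteq> {}"
    and ne: "nodes p = {} \<Longrightarrow> cones p \<noteq> {}"
    using wf unfolding wf_part_def meet_closed_iff by blast+
  have G': "finite G" "\<And>y z. y \<in> G \<Longrightarrow> z \<in> G \<Longrightarrow> \<exists>w\<in>G. is_meet w y z" "nodes p \<subseteq> G"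
    "\<And>x. x \<in> G \<Longrightarrow> x \<notin> nodes p \<Longrightarrow> \<exists>l\<in>cones p. prefix l x"
    "\<And>x. x \<in> G \<Longrightarrow> x \<notin> nodes p \<Longrightarrow> matches C p x"
    using G unfolding gen_def meet_closed_iff by blast+
  define R where "R = {l\<in>cones p. \<not> (\<exists>y\<in>G. prefix l y)}"
  define N where "N = {x @ [b] | x b. x \<in> G \<and> x \<notin> nodes p \<and> \<not> (\<exists>y\<in>G. prefix (x @ [b]) y)}"
  have finR: "finite R" unfolding R_def using fin by simp
  have "N \<subseteq> (\<lambda>(x, b). x @ [b]) ` (G \<times> UNIV)" unfolding N_def by auto
  then have finN: "finite N" by (rule finite_subset) (simp add: G'(1))
  have NR: "\<not> prefix (x @ [b]) l" if prem: "x \<in> G" "x \<notin> nodes p" "l \<in> R" for x b l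
  proof
    assume le: "prefix (x @ [b]) l"
    obtain l2 where l2: "l2 \<in> cones p" "prefix l2 x" using G'(4) prem by blast
    then have "prefix l2 l" using le by (meson append_prefixD prefix_order.trans)
    then have "l = l2" using anti[of l2 l] l2(1) prem(3) unfolding R_def by blast
    then show False using l2 prem unfolding R_def by blast
  qed
  have meetGR: "\<exists>w\<in>G. is_meet w y l" if y: "y \<in> G" and l: "l \<in> R" for y l
  proof -
    have lc: "l \<in> cones p" "\<not> prefix l y" using l y unfolding R_def by blast+
    show ?thesis
    proof (cases "y \<in> nodes p")
      case True
      then obtain w where w: "w \<in> nodes p \<union> cones p" "is_meet w y l" using mc lc by blast
      then have "w \<in> nodes p" using anti[of w y] True unfolding is_meet_def by blast
      then show ?thesis using w G'(3) by blast
    next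
      case False
      then obtain l2 where l2: "l2 \<in> cones p" "prefix l2 y" using G'(4) y by blast
      have ne: "l2 \<noteq> l" using l2 lc by blast
      obtain w where w: "w \<in> nodes p \<union> cones p" "is_meet w l2 l" using mc l2 lc by blast
      then have "w \<in> nodes p" using anti[of w l] anti[of w l2] l2 lc ne unfolding is_meet_def by blast
      moreover have "\<not> prefix l2 l" using anti[of l2 l] l2 lc ne by blast
      then have "is_meet w y l" using is_meet_extend[OF w(2)] l2 by blast
      ultimately show ?thesis using G'(3) by blast
    qed
  qed
  have meetRR: "\<exists>w\<in>G \<union> R. is_meet w l l'" if "l \<in> R" "l' \<in> R" for l l'
  proof (cases "l = l'")
    case True
    then show ?thesis using is_meet_refl that by blast
  next
    case False
    have lc: "l \<in> cones p" "l' \<in> cones p" using that unfolding R_def by blast+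
    then obtain w where w: "w \<in> nodes p \<union> cones p" "is_meet w l l'" using mc by blast
    then have "w \<in> nodes p" using anti[of w l] anti[of w l'] lc False unfolding is_meet_def by blast
    then show ?thesis using w G'(3) by blast
  qed
  have meetNH: "\<exists>w\<in>G. is_meet w z y" if z: "z \<in> N" and y: "y \<in> G \<union> R" for z y
  proof -
    obtain x b where x: "z = x @ [b]" "x \<in> G" "x \<notin> nodes p" "\<not> (\<exists>y\<in>G. prefix (x @ [b]) y)"
      using z unfolding N_def by blast
    obtain w where w: "w \<in> G" "is_meet w x y" using y G'(2) meetGR x(2) by blast
    have "\<not> prefix (x @ [b]) y" using y x NR by blast
    then show ?thesis using is_meet_snoc[OF w(2)] w(1) x(1) by blast
  qed
  have meetNN: "\<exists>w\<in>G \<union> N. is_meet w z z'" if z: "z \<in> N" and z': "z' \<in> N" for z z'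
  proof (cases "z = z'")
    case True
    then show ?thesis using is_meet_refl z by blast
  next
    case False
    obtain x b where x: "z = x @ [b]" "x \<in> G" "x \<notin> nodes p" "\<not> (\<exists>y\<in>G. prefix (x @ [b]) y)"
      using z unfolding N_def by blast
    obtain w where w: "w \<in> G" "is_meet w z' x" using meetNH[OF z'] x(2) by blast
    have "\<not> prefix (x @ [b]) z'"
    proof
      assume le: "prefix (x @ [b]) z'"
      obtain x' b' where x': "z' = x' @ [b']" "x' \<in> G" using z' unfolding N_def by blast
      then have "prefix (x @ [b]) x' \<or> x @ [b] = z'" using le prefix_snoc by auto
      then show False using x x' False by blast
    qed
    then have "is_meet w (x @ [b]) z'" using is_meet_snoc w(2) is_meet_commute by blast
    then show ?thesis using w(1) x(1) by blast
  qed
  let ?q = "Part G (R \<union> N) (coords p) (hue p)"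
  have "\<exists>w\<in>G \<union> (R \<union> N). is_meet w y z" if "y \<in> G \<union> (R \<union> N)" "z \<in> G \<union> (R \<union> N)" for y z
    using that G'(2) meetGR meetRR meetNH meetNN is_meet_commute by (metis UnCI UnE)
  moreover have "x = l \<and> x \<notin> G" if l: "l \<in> R \<union> N" and x: "x \<in> G \<union> (R \<union> N)" and le: "prefix l x" for l x
  proof -
    have xG: "x \<notin> G" using l le unfolding R_def N_def by blast
    have "x = l"
    proof (cases "l \<in> R")
      case True
      show ?thesis
      proof (cases "x \<in> R")
        case True
        then show ?thesis using anti[of l x] \<open>l \<in> R\<close> le unfolding R_def by blast
      next
        case False
        then obtain y b where y: "x = y @ [b]" "y \<in> G" "y \<notin> nodes p" using x xG unfolding N_def by blast
        have "prefix l y \<or> l = y @ [b]" using le y(1) prefix_snoc by auto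
        then show ?thesis using y True unfolding R_def by blast
      qed
    next
      case False
      then obtain y b where y: "l = y @ [b]" "y \<in> G" "y \<notin> nodes p" "\<not> (\<exists>z\<in>G. prefix (y @ [b]) z)"
        using l unfolding N_def by blast
      have "x \<notin> R" using NR y le by blast
      then obtain y' b' where y': "x = y' @ [b']" "y' \<in> G" using x xG unfolding N_def by blast
      have "prefix l y' \<or> l = x" using le y'(1) prefix_snoc by auto
      then show ?thesis using y y' by blast
    qed
    with xG show ?thesis by blast
  qed
  moreover have "\<exists>y\<in>G \<union> (R \<union> N). prefix (x @ [b]) y" if x: "x \<in> G" for x b
  proof (cases "x \<in> nodes p")
    case True
    then obtain y where y: "y \<in> nodes p \<union> cones p" "prefix (x @ [b]) y" using live by blast
    show ?thesis
    proof (cases "y \<in> nodes p \<or> y \<in> R")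
      case True
      then show ?thesis using y G'(3) by blast
    next
      case False
      then obtain z where "z \<in> G" "prefix y z" using y(1) unfolding R_def by blast
      then show ?thesis using y(2) prefix_order.trans by blast
    qed
  next
    case False
    then show ?thesis using x unfolding N_def by blast
  qed
  moreover have "G = {} \<Longrightarrow> R \<union> N \<noteq> {}" using ne G'(3) unfolding R_def by blast
  ultimately have wfq: "wf_part ?q"
    using finR finN fin G'(1) by (intro wf_partI) (simp_all only: part.sel finite_Un not_False_eq_True)
  have "\<exists>\<mu>\<in>R \<union> N. prefix l \<mu>" if l: "l \<in> cones p" for l
  proof (cases "l \<in> R")
    case False
    \<comment> \<open>A used cone still has an open end above it: a longest element of
      \<open>G\<close> above \<open>l\<close> has a vacant successor.\<close>
    then have "{y\<in>G. prefix l y} \<noteq> {}" using l unfolding R_def by blast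
    moreover have fin': "finite (length ` {y\<in>G. prefix l y})" using G'(1) by simp
    ultimately have "Max (length ` {y\<in>G. prefix l y}) \<in> length ` {y\<in>G. prefix l y}" by (intro Max_in) auto
    then obtain y where y0: "y \<in> G" "prefix l y" "length y = Max (length ` {y\<in>G. prefix l y})" by auto
    have y: "y \<in> G" "prefix l y" "\<And>z. z \<in> G \<Longrightarrow> prefix l z \<Longrightarrow> length z \<le> length y"
      using y0 Max_ge[OF fin'] by auto
    have "y \<notin> nodes p" using anti[of l y] l y by blast
    moreover have "\<not> (\<exists>z\<in>G. prefix (y @ [False]) z)"
    proof
      assume "\<exists>z\<in>G. prefix (y @ [False]) z"
      then obtain z where z: "z \<in> G" "prefix (y @ [False]) z" by blast
      then have "prefix l z" using y(2) by (meson append_prefixD prefix_order.trans)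
      moreover have "length y < length z" using prefix_length_le[OF z(2)] by simp
      ultimately show False using y(3) z(1) by fastforce
    qed
    ultimately have "y @ [False] \<in> N" using y(1) unfolding N_def by blast
    then show ?thesis using y(2) by (meson UnI2 prefix_order.trans prefixI)
  qed blast
  moreover have "\<exists>\<kappa>\<in>cones p. prefix \<kappa> \<mu>" if "\<mu> \<in> R \<union> N" for \<mu>
    using that G'(4) unfolding R_def N_def by (auto, meson prefix_order.trans prefixI)
  ultimately have extq: "extends_part C ?q p"
    using G'(3-5) unfolding extends_part_def part.sel by blast
  let ?g = "\<lambda>\<sigma>. \<sigma> @ replicate u False"
  have g: "extending ?g" by (simp add: extending_def)
  have "extends_part C (shrink ?g ?q) p"
    by (rule extends_part_shrink_left[OF extq g])
  then show ?thesis using wf_shrink[OF wfq g] by (intro exI[of _ "shrink ?g ?q"]) auto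
qed

lemma extends_part_refl: "extends_part C p p"
  unfolding extends_part_def by blast

text \<open>The nodes by which \<open>q\<close> exceeds \<open>p\<close> have the right color under
  \<open>C\<close>; agreement on them carries it over to \<open>C'\<close>.\<close>

lemma gen_extends_part:
  assumes "extends_part C q p" "\<And>b x. b \<in> coords p \<Longrightarrow> x \<in> nodes q \<Longrightarrow>
      C' (prod_encode (b, str_code x)) = C (prod_encode (b, str_code x))"
  shows "gen q C' \<subseteq> gen p C'"
proof
  fix G assume G: "G \<in> gen q C'"
  have "(\<exists>\<kappa>\<in>cones p. prefix \<kappa> x) \<and> matches C' p x" if x: "x \<in> G - nodes p" for x
  proof (cases "x \<in> nodes q")
    case True
    with x assms show ?thesis unfolding extends_part_def matches_def by simp
  next
    case False
    with x G have "\<exists>\<kappa>\<in>cones q. prefix \<kappa> x" "matches C' q x" unfolding gen_def by blast+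
    with assms(1) show ?thesis unfolding extends_part_def matches_def by (metis prefix_order.trans)
  qed
  with G assms(1) show "G \<in> gen p C'" unfolding gen_def extends_part_def by blast
qed

text \<open>Replacing a part by an extension \<open>z\<close> splits its cones, and every other part has to choose among the
  new cones. If \<open>z\<close> does not find its color, then it fails above one particular cone of the old part,
  where no part of the same kind can succeed either. Hence parts of that kind may
  choose in one fixed way, and their number drops; so the kinds can be treated one after another, although
  the parts of the other kinds multiply.\<close>

definition dense_for :: "(part \<Rightarrow> bool) \<Rightarrow> part \<Rightarrow> bool" where
  "dense_for ok p \<longleftrightarrow> finite (cones p) \<and> (\<forall>g. extending g \<longrightarrow> (\<exists>z. ok z \<and> finite (cones z) \<and> coords z = coords p \<and> hue z = hue p \<and>
     (\<forall>\<mu>\<in>cones z. \<exists>\<kappa>\<in>g ` cones p. prefix \<kappa> \<mu>) \<and> (\<forall>\<kappa>\<in>g ` cones p. \<exists>\<mu>\<in>cones z. prefix \<kappa> \<mu>)))"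

lemma dense_for_shrink:
  assumes "dense_for ok p" "extending f" shows "dense_for ok (shrink f p)"
  unfolding dense_for_def
proof (intro conjI allI impI)
  fix g assume g: "extending g"
  show "\<exists>z. ok z \<and> finite (cones z) \<and> coords z = coords (shrink f p) \<and> hue z = hue (shrink f p) \<and>
     (\<forall>\<mu>\<in>cones z. \<exists>\<kappa>\<in>g ` cones (shrink f p). prefix \<kappa> \<mu>) \<and> (\<forall>\<kappa>\<in>g ` cones (shrink f p). \<exists>\<mu>\<in>cones z. prefix \<kappa> \<mu>)"
    using assms extending_comp[OF g assms(2)] unfolding dense_for_def shrink_sel image_comp by blast
qed (use assms in \<open>simp add: dense_for_def\<close>)

abbreviation kind :: "part \<Rightarrow> nat set \<times> nat" where "kind p \<equiv> (coords p, hue p)"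

lemma covers_eliminate_kind:
  assumes closed: "\<And>z g. ok z \<Longrightarrow> extending g \<Longrightarrow> ok (shrink g z)"
    and "finite X" "finite Z" "covers Q (X \<union> Z)" "\<And>z. z \<in> Z \<Longrightarrow> ok z" "\<And>x. x \<in> X \<Longrightarrow> dense_for ok x"
  shows "\<exists>X' Z'. finite X' \<and> finite Z' \<and> covers Q (X' \<union> Z') \<and> (\<forall>z\<in>Z'. ok z) \<and>
     (\<forall>x\<in>X'. dense_for ok x) \<and> kind ` X' \<subseteq> kind ` X - {t}"
  using assms(2-)
proof (induction "card {x\<in>X. kind x = t}" arbitrary: X Z rule: less_induct)
  case less
  show ?case
  proof (cases "\<exists>x\<in>X. kind x = t")
    case False
    then show ?thesis using less.prems by (intro exI[of _ X] exI[of _ Z]) auto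
  next
    case True
    then obtain x where x: "x \<in> X" "kind x = t" by blast
    obtain z where z: "ok z" "finite (cones z)" "coords z = coords x" "hue z = hue x"
      "\<forall>\<mu>\<in>cones z. \<exists>\<kappa>\<in>cones x. prefix \<kappa> \<mu>" "\<forall>\<kappa>\<in>cones x. \<exists>\<mu>\<in>cones z. prefix \<kappa> \<mu>"
      using less.prems(5)[OF x(1), unfolded dense_for_def, THEN conjunct2, THEN spec, of id] extending_id
      unfolding image_id id_apply by blast
    have finx: "finite (cones x)" using less.prems(5)[OF x(1)] unfolding dense_for_def by blast
    \<comment> \<open>\<open>d\<close> sends each cone of \<open>x\<close> to some cone of
      \<open>z\<close> above it and fixes all other strings; a selector in \<open>sel\<close>
      departs from \<open>d\<close> at one cone at most.\<close>
    define d where "d = (\<lambda>\<kappa>. if \<kappa> \<in> cones x then (SOME \<mu>. \<mu> \<in> cones z \<and> prefix \<kappa> \<mu>) else \<kappa>)"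
    have d: "d \<kappa> \<in> cones z" "prefix \<kappa> (d \<kappa>)" if "\<kappa> \<in> cones x" for \<kappa>
      using someI_ex[of "\<lambda>\<mu>. \<mu> \<in> cones z \<and> prefix \<kappa> \<mu>"] z(6) that unfolding d_def by auto
    have extd: "extending d" unfolding extending_def using d(2) by (metis d_def prefix_order.refl)
    define sel where "sel = insert d {d(\<kappa> := \<mu>) | \<kappa> \<mu>. \<kappa> \<in> cones x \<and> \<mu> \<in> cones z \<and> prefix \<kappa> \<mu>}"
    have "sel \<subseteq> insert d ((\<lambda>(\<kappa>, \<mu>). d(\<kappa> := \<mu>)) ` (cones x \<times> cones z))" unfolding sel_def by auto
    then have finsel: "finite sel" by (rule finite_subset) (simp add: finx z(2))
    have extsel: "extending s" if "s \<in> sel" for s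
      using that extd unfolding sel_def extending_def by auto
    \<comment> \<open>Parts of the kind of \<open>x\<close> are raised by \<open>d\<close> alone,
      and \<open>x\<close> itself is dropped, so their number decreases; the others are raised by
      every selector.\<close>
    define X' where "X' = shrink d ` {y\<in>X - {x}. kind y = t} \<union> (\<lambda>(s, y). shrink s y) ` (sel \<times> {y\<in>X. kind y \<noteq> t})"
    define Z' where "Z' = insert z ((\<lambda>(s, y). shrink s y) ` (sel \<times> Z))"
    have fin: "finite X'" "finite Z'" unfolding X'_def Z'_def using less.prems finsel by auto
    have smaller: "card {y\<in>X'. kind y = t} < card {y\<in>X. kind y = t}"
    proof -
      have "{y\<in>X'. kind y = t} \<subseteq> shrink d ` ({y\<in>X. kind y = t} - {x})" unfolding X'_def by auto
      then have "card {y\<in>X'. kind y = t} \<le> card (shrink d ` ({y\<in>X. kind y = t} - {x}))"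
        using less.prems(1) by (intro card_mono) auto
      also have "\<dots> \<le> card ({y\<in>X. kind y = t} - {x})" using less.prems(1) by (intro card_image_le) auto
      also have "\<dots> < card {y\<in>X. kind y = t}" using less.prems(1) x by (intro card_Diff1_less) auto
      finally show ?thesis .
    qed
    have cov: "covers Q (X' \<union> Z')"
      unfolding covers_def
    proof (intro ballI allI impI)
      fix C h assume C: "C \<in> Q" and h: "extending h"
      show "\<exists>p\<in>X' \<union> Z'. \<forall>\<kappa>\<in>cones p. matches C p (h \<kappa>)"
      proof (cases "\<forall>\<mu>\<in>cones z. matches C z (h \<mu>)")
        case True
        then show ?thesis unfolding Z'_def by blast
      next
        case False
        then obtain \<mu> where \<mu>: "\<mu> \<in> cones z" "\<not> matches C z (h \<mu>)" by blast
        then obtain \<kappa> where \<kappa>: "\<kappa> \<in> cones x" "prefix \<kappa> \<mu>" using z(5) by blast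
        \<comment> \<open>The selector is steered towards the end \<open>\<mu>\<close> at which
          \<open>z\<close> fails.\<close>
        define s where "s = d(\<kappa> := \<mu>)"
        have s: "s \<in> sel" unfolding sel_def s_def using \<mu> \<kappa> by blast
        obtain y where y: "y \<in> X \<union> Z" "\<forall>\<nu>\<in>cones y. matches C y ((h \<circ> s) \<nu>)"
          using less.prems(3) C extending_comp[OF h extsel[OF s]] unfolding covers_def by blast
        have shr: "\<forall>\<nu>\<in>cones (shrink s y). matches C (shrink s y) (h \<nu>)" using y(2) by auto
        consider "y \<in> Z" | "y \<in> X" "kind y \<noteq> t" | "y \<in> X" "kind y = t" using y(1) by blast
        then show ?thesis
        proof cases
          case 1
          then have "shrink s y \<in> Z'" unfolding Z'_def using s by blast
          with shr show ?thesis by blast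
        next
          case 2
          then have "shrink s y \<in> X'" unfolding X'_def using s by blast
          with shr show ?thesis by blast
        next
          case 3
          \<comment> \<open>A part with the cone \<open>\<kappa>\<close> would need at
            \<open>h \<mu>\<close> the same color in the same coordinates as \<open>z\<close>, which
            fails there. Without that cone, \<open>s\<close> and \<open>d\<close> agree on
            \<open>y\<close>.\<close>
          have "\<kappa> \<notin> cones y"
          proof
            assume "\<kappa> \<in> cones y"
            then have "matches C y (h \<mu>)" using y(2) by (auto simp: s_def)
            then show False using \<mu>(2) 3(2) x(2) z(3,4) unfolding matches_def by auto
          qed
          then have "\<forall>\<nu>\<in>cones (shrink d y). matches C (shrink d y) (h \<nu>)"
            using y(2) by (auto simp: s_def split: if_splits)
          moreover have "y \<noteq> x" using \<kappa>(1) \<open>\<kappa> \<notin> cones y\<close> by blast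
          then have "shrink d y \<in> X'" unfolding X'_def using 3 by blast
          ultimately show ?thesis by blast
        qed
      qed
    qed
    have doneZ: "ok y" if "y \<in> Z'" for y
      using that z(1) less.prems(4) closed extsel unfolding Z'_def by auto
    have denseX: "dense_for ok y" if "y \<in> X'" for y
      using that less.prems(5) dense_for_shrink extsel extd unfolding X'_def by auto
    have "\<exists>X'' Z''. finite X'' \<and> finite Z'' \<and> covers Q (X'' \<union> Z'') \<and> (\<forall>z\<in>Z''. ok z) \<and>
      (\<forall>x\<in>X''. dense_for ok x) \<and> kind ` X'' \<subseteq> kind ` X' - {t}"
      by (rule less.hyps[OF smaller fin cov]) (erule doneZ, erule denseX)
    then obtain X'' Z'' where *: "finite X''" "finite Z''" "covers Q (X'' \<union> Z'')" "\<forall>z\<in>Z''. ok z"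
      "\<forall>x\<in>X''. dense_for ok x" "kind ` X'' \<subseteq> kind ` X' - {t}"
      by (elim exE conjE) (rule that)
    have sub: "kind ` X' \<subseteq> kind ` X" unfolding X'_def by auto
    have "kind ` X'' \<subseteq> kind ` X - {t}"
      by (rule subset_trans[OF *(6) Diff_mono[OF sub subset_refl]])
    with *(1-5) show ?thesis by (intro exI[of _ X''] exI[of _ Z''] conjI)
  qed
qed

lemma covers_eliminate:
  assumes closed: "\<And>z g. ok z \<Longrightarrow> extending g \<Longrightarrow> ok (shrink g z)"
    and "finite X" "finite Z" "covers Q (X \<union> Z)" "\<And>z. z \<in> Z \<Longrightarrow> ok z" "\<And>x. x \<in> X \<Longrightarrow> dense_for ok x"
  shows "\<exists>Z'. finite Z' \<and> covers Q Z' \<and> (\<forall>z\<in>Z'. ok z)"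
  using assms(2-)
proof (induction "card (kind ` X)" arbitrary: X Z rule: less_induct)
  case less
  show ?case
  proof (cases "X = {}")
    case True
    then show ?thesis using less.prems by auto
  next
    case False
    then obtain x where x: "x \<in> X" by blast
    obtain X' Z' where *: "finite X'" "finite Z'" "covers Q (X' \<union> Z')" "\<forall>z\<in>Z'. ok z"
      "\<forall>x\<in>X'. dense_for ok x" "kind ` X' \<subseteq> kind ` X - {kind x}"
      using covers_eliminate_kind[OF closed less.prems, of "kind x"] by blast
    have "kind ` X' \<subset> kind ` X" using *(6) x by blast
    then have "card (kind ` X') < card (kind ` X)" using less.prems(1) by (intro psubset_card_mono) auto
    then show ?thesis using less.hyps[of X' Z'] * by blast
  qed
qed

text \<open>Badness persists, so the parts can be treated in turn: a part is made bad by raising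
  further if this is possible at all, and otherwise stays good forever.\<close>

lemma stabilize:
  assumes mono: "\<And>p g f. bad p g \<Longrightarrow> extending f \<Longrightarrow> bad p (f \<circ> g)"
    and "finite U"
  shows "\<exists>f. extending f \<and> (\<forall>p\<in>U. bad p (f \<circ> g) \<or> (\<forall>f'. extending f' \<longrightarrow> \<not> bad p (f' \<circ> (f \<circ> g))))"
  using assms(2)
proof (induction U)
  case empty
  then show ?case using extending_id by blast
next
  case (insert p U)
  then obtain f where f: "extending f"
    "\<And>q. q \<in> U \<Longrightarrow> bad q (f \<circ> g) \<or> (\<forall>f'. extending f' \<longrightarrow> \<not> bad q (f' \<circ> (f \<circ> g)))" by blast
  show ?case
  proof (cases "\<exists>f'. extending f' \<and> bad p (f' \<circ> (f \<circ> g))")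
    case False
    then show ?thesis using f by blast
  next
    case True
    then obtain f' where f': "extending f'" "bad p (f' \<circ> (f \<circ> g))" by blast
    have "bad q ((f' \<circ> f) \<circ> g) \<or> (\<forall>f''. extending f'' \<longrightarrow> \<not> bad q (f'' \<circ> ((f' \<circ> f) \<circ> g)))" if "q \<in> U" for q
    proof (cases "bad q (f \<circ> g)")
      case True
      then show ?thesis using mono[OF True f'(1)] by (simp add: comp_assoc)
    next
      case False
      then have "\<not> bad q ((f'' \<circ> f') \<circ> (f \<circ> g))" if "extending f''" for f''
        using f(2)[OF \<open>q \<in> U\<close>] extending_comp[OF that f'(1)] by blast
      then show ?thesis by (simp add: comp_assoc)
    qed
    moreover have "bad p ((f' \<circ> f) \<circ> g)" using f'(2) by (simp add: comp_assoc)
    ultimately show ?thesis using extending_comp[OF f'(1) f(1)] by blast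
  qed
qed


section \<open>Meeting one requirement\<close>

lemma set_encode_less:
  assumes "X \<subseteq> {..<m}" shows "set_encode X < 2 ^ m"
proof -
  have "set_encode X \<le> sum ((^) 2) {..<m}"
    unfolding set_encode_def using assms by (intro sum_mono2) auto
  also have "\<dots> < 2 ^ m" by (induction m) auto
  finally show ?thesis .
qed

locale requirement =
  fixes k :: nat and D :: "nat set" and S :: "bool list set" and e :: prog and l :: nat
  assumes no_enumeration: "\<not> computes_bounded_enumeration D S"
begin

definition run :: "bool list set \<Rightarrow> nat \<Rightarrow> nat \<Rightarrow> bool" where
  "run G n y \<longleftrightarrow> eval (D \<oplus> str_code ` G) e n y"

definition good :: "nat \<Rightarrow> nat \<Rightarrow> bool" where
  "good n y \<longleftrightarrow> card (set_decode y) \<le> l \<and> set_decode y \<inter> str_code ` (S \<inter> {\<sigma>. length \<sigma> = n}) \<noteq> {}"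

definition spoils :: "bool list set \<Rightarrow> bool" where
  "spoils G \<longleftrightarrow> (\<exists>n y. run G n y \<and> \<not> good n y)"

text \<open>Divergence at \<open>n\<close> and a wrong value at \<open>n\<close> are treated alike.
  All later trees are included, so by the use principle their union has no good value at
  \<open>n\<close> either.\<close>

definition satisfied :: "part \<Rightarrow> (nat \<Rightarrow> nat) set \<Rightarrow> bool" where
  "satisfied p Q \<longleftrightarrow> (\<exists>n. \<forall>C\<in>Q. \<forall>G\<in>gen p C. \<forall>y. run G n y \<longrightarrow> \<not> good n y)"

text \<open>Tied to one coloring, but stable under raising the cones.\<close>

definition spoilable :: "part \<Rightarrow> (nat \<Rightarrow> nat) \<Rightarrow> bool" where
  "spoilable p C \<longleftrightarrow> (\<forall>g. extending g \<longrightarrow> (\<exists>G\<in>gen (shrink g p) C. spoils G))"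

lemma run_unique: "run G n y \<Longrightarrow> run G n z \<Longrightarrow> y = z"
  unfolding run_def by (rule eval_deterministic)

lemma satisfied_shrink: "satisfied p Q \<Longrightarrow> extending g \<Longrightarrow> satisfied (shrink g p) Q"
  unfolding satisfied_def using gen_shrink by blast

lemma spoilable_shrink: "spoilable p C \<Longrightarrow> extending g \<Longrightarrow> spoilable (shrink g p) C"
  unfolding spoilable_def shrink_shrink using extending_comp by blast

text \<open>A violation is a finite tree with a halting run, hence enumerable; this is uniform in
  the pair \<open>m\<close> of a level and a code of the set to be met.\<close>

lemma closed_family_gen:
  assumes fin: "finite (nodes p)" "finite (cones p)" "finite (coords p)"
  shows "closed_family k D (\<lambda>m. {C. (\<forall>x. C x < k) \<and>
    (\<forall>G\<in>gen p C. \<forall>y. run G (pfst m) y \<longrightarrow> set_decode y \<inter> set_decode (psnd m) \<noteq> {})})"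
proof -
  let ?f = "set_encode (str_code ` nodes p)" and ?c = "set_encode (str_code ` cones p)"
  \<comment> \<open>All conditions on a violating tree except the colors, which
    \<open>closed_family_avoid_uniform\<close> adds.\<close>
  define Z where "Z = (\<lambda>m g. (meet_closed (inv str_code ` set_decode g) \<and>
     (\<forall>x<?f. x \<in> set_decode ?f \<longrightarrow> x \<in> set_decode g) \<and>
     (\<forall>x<g. x \<in> set_decode g \<and> \<not> x \<in> set_decode ?f \<longrightarrow> (\<exists>j<?c. j \<in> set_decode ?c \<and> code_prefix j x))) \<and>
     (\<exists>y. eval (D \<oplus> set_decode g) e (pfst m) y \<and> (\<forall>z<y. z \<in> set_decode y \<longrightarrow> \<not> z \<in> set_decode (psnd m))))"
  have cep: "cep D (\<lambda>x. Z (pfst x) (psnd x))"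
    unfolding Z_def
    by (rule cep_conj, rule cep_decp)
      (intro decp_conj decp_meet_closed decp_intros decp_code_prefix computable_intros,
       intro cep_ex cep_conj cep_eval' cep_decp[OF decp_ball] decp_intros computable_intros)
  have Z: "Z m (set_encode (str_code ` G)) \<longleftrightarrow> meet_closed G \<and> nodes p \<subseteq> G \<and>
      (\<forall>x\<in>G - nodes p. \<exists>\<kappa>\<in>cones p. prefix \<kappa> x) \<and>
      (\<exists>y. run G (pfst m) y \<and> set_decode y \<inter> set_decode (psnd m) = {})" if G: "finite G" for m G
  proof -
    have bound: "(\<forall>x<w. x \<in> set_decode w \<longrightarrow> A x) \<longleftrightarrow> (\<forall>x\<in>set_decode w. A x)"
      "(\<forall>x<w. x \<in> set_decode w \<and> B x \<longrightarrow> A x) \<longleftrightarrow> (\<forall>x\<in>set_decode w. B x \<longrightarrow> A x)"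
      "(\<exists>x<w. x \<in> set_decode w \<and> A x) \<longleftrightarrow> (\<exists>x\<in>set_decode w. A x)" for w A B
      using set_decode_less by blast+
    have dec: "set_decode (set_encode (str_code ` G)) = str_code ` G" "set_decode ?f = str_code ` nodes p"
      "set_decode ?c = str_code ` cones p"
      using G fin by simp_all
    have inv: "inv str_code ` str_code ` G = G" by (simp add: image_comp)
    have mem: "str_code x \<in> str_code ` X \<longleftrightarrow> x \<in> X" for x X
      using inj_str_code by (simp add: inj_image_mem_iff)
    show ?thesis
      unfolding Z_def bound
      unfolding dec inv ball_simps bex_simps mem code_prefix_def inv_str_code run_def[symmetric]
      by blast
  qed
  have eq: "(\<forall>g. Z m g \<longrightarrow> \<not> (\<forall>x\<in>set_decode g - str_code ` nodes p. \<forall>b\<in>coords p. C (prod_encode (b, x)) = hue p)) \<longleftrightarrow>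
      (\<forall>G\<in>gen p C. \<forall>y. run G (pfst m) y \<longrightarrow> set_decode y \<inter> set_decode (psnd m) \<noteq> {})" for C m
  proof -
    have matched: "(\<forall>x\<in>set_decode (set_encode (str_code ` G)) - str_code ` nodes p. \<forall>b\<in>coords p. C (prod_encode (b, x)) = hue p) \<longleftrightarrow>
        (\<forall>x\<in>G - nodes p. matches C p x)" if "finite G" for G
      using inj_str_code that by (simp add: image_set_diff[symmetric] matches_def)
    show ?thesis
    proof (intro iffI ballI allI impI notI)
      fix G y assume *: "\<forall>g. Z m g \<longrightarrow> \<not> (\<forall>x\<in>set_decode g - str_code ` nodes p. \<forall>b\<in>coords p. C (prod_encode (b, x)) = hue p)"
        and G: "G \<in> gen p C" and y: "run G (pfst m) y" "set_decode y \<inter> set_decode (psnd m) = {}"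
      have "finite G" "meet_closed G" "nodes p \<subseteq> G" "\<forall>x\<in>G - nodes p. \<exists>\<kappa>\<in>cones p. prefix \<kappa> x"
        "\<forall>x\<in>G - nodes p. matches C p x"
        using G unfolding gen_def by auto
      with y have "Z m (set_encode (str_code ` G))" using Z by blast
      with * show False using matched[OF \<open>finite G\<close>] \<open>\<forall>x\<in>G - nodes p. matches C p x\<close> by blast
    next
      fix g assume *: "\<forall>G\<in>gen p C. \<forall>y. run G (pfst m) y \<longrightarrow> set_decode y \<inter> set_decode (psnd m) \<noteq> {}"
        and g: "Z m g" "\<forall>x\<in>set_decode g - str_code ` nodes p. \<forall>b\<in>coords p. C (prod_encode (b, x)) = hue p"
      define G where "G = inv str_code ` set_decode g"
      have G: "finite G" "g = set_encode (str_code ` G)" unfolding G_def by (simp_all add: image_comp)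
      from g(1) obtain y where *: "meet_closed G" "nodes p \<subseteq> G" "\<forall>x\<in>G - nodes p. \<exists>\<kappa>\<in>cones p. prefix \<kappa> x"
        "run G (pfst m) y" "set_decode y \<inter> set_decode (psnd m) = {}"
        unfolding G(2) Z[OF G(1)] by blast
      have "\<forall>x\<in>G - nodes p. matches C p x" using g(2) matched[OF G(1)] unfolding G(2) by blast
      then have "G \<in> gen p C" unfolding gen_def using G(1) * by simp
      then show False using *(4,5) \<open>\<forall>G\<in>gen p C. \<forall>y. run G (pfst m) y \<longrightarrow> set_decode y \<inter> set_decode (psnd m) \<noteq> {}\<close> by blast
    qed
  qed
  show ?thesis
    using closed_family_avoid_uniform[OF cep finite_imageI[OF fin(1)] fin(3), of k str_code "hue p"]
    unfolding eq .
qed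

text \<open>Otherwise a set of at most \<open>N\<close> strings meeting all the nonempty classes, and hence the class of
  the true level of \<open>S\<close>, could be found effectively for every level.\<close>

lemma unhittable:
  assumes Q: "closed_family k D Q"
    and ne: "\<And>n. Q (prod_encode (n, set_encode (str_code ` (S \<inter> {\<sigma>. length \<sigma> = n})))) \<noteq> {}"
  shows "\<exists>n. \<forall>H. finite H \<and> card H \<le> N \<longrightarrow>
    (\<exists>v<2 ^ 2 ^ Suc n. Q (prod_encode (n, v)) \<noteq> {} \<and> H \<inter> set_decode v = {})"
proof (rule ccontr)
  assume none: "\<not> ?thesis"
  have H: "\<exists>H. finite H \<and> card H \<le> N \<and>
      (\<forall>v<2 ^ 2 ^ Suc n. Q (prod_encode (n, v)) = {} \<or> H \<inter> set_decode v \<noteq> {})" for n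
    using none[unfolded not_ex, THEN spec, of n] by (simp only: not_all not_imp not_ex de_Morgan_conj not_not de_Morgan_disj conj_assoc imp_conv_disj)
  \<comment> \<open>Emptiness of a class is enumerable and meeting a coded set is decidable, so a
    suitable \<open>h\<close> can be searched for.\<close>
  let ?R = "\<lambda>n h. card (set_decode h) \<le> N \<and>
      (\<forall>v<2 ^ 2 ^ Suc n. Q (prod_encode (n, v)) = {} \<or> (\<exists>x<h. x \<in> set_decode h \<and> x \<in> set_decode v))"
  have "cep D (\<lambda>x. ?R (pfst x) (psnd x))"
    by (intro cep_conj cep_ball cep_disj cep_comp[OF cep_closed_family_empty[OF Q]] cep_decp[OF decp_le]
        cep_decp[OF decp_bex] decp_intros computable_intros)
  moreover have "\<exists>h. ?R n h" for n
  proof -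
    obtain H where "finite H" "card H \<le> N"
      "\<forall>v<2 ^ 2 ^ Suc n. Q (prod_encode (n, v)) = {} \<or> H \<inter> set_decode v \<noteq> {}" using H by blast
    moreover have "set_decode (set_encode H) = H" using \<open>finite H\<close> by simp
    ultimately have "?R n (set_encode H)" using set_decode_less[of _ "set_encode H"] by (metis disjoint_iff)
    then show ?thesis ..
  qed
  ultimately obtain h where h: "computable_in D h" "\<And>n. ?R n (h n)"
    using cep_uniformization[of D ?R] by blast
  let ?g = "\<lambda>n. inv str_code ` set_decode (h n)"
  have "enumeration N S ?g"
    unfolding enumeration_def
  proof (intro allI conjI)
    fix n
    have "card (?g n) \<le> card (set_decode (h n))" by (rule card_image_le) simp
    then show "card (?g n) \<le> N" using h(2)[of n] by linarith
    let ?v = "set_encode (str_code ` (S \<inter> {\<sigma>. length \<sigma> = n}))"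
    \<comment> \<open>Strings of length \<open>n\<close> have codes below \<open>2 ^ Suc n\<close>,
      so the code of the true level is in the range of \<open>v\<close> that was examined.\<close>
    have sub: "str_code ` (S \<inter> {\<sigma>. length \<sigma> = n}) \<subseteq> {..<2 ^ Suc n}"
      using str_code_bounds(2) Suc_lessD by blast
    then have "?v < 2 ^ 2 ^ Suc n" by (rule set_encode_less)
    moreover have "set_decode ?v = str_code ` (S \<inter> {\<sigma>. length \<sigma> = n})"
      using sub finite_subset by (intro set_encode_inverse) blast
    ultimately obtain x where "x \<in> set_decode (h n)" "x \<in> str_code ` (S \<inter> {\<sigma>. length \<sigma> = n})"
      using h(2)[of n] ne[of n] by blast
    then show "?g n \<inter> S \<inter> {\<sigma>. length \<sigma> = n} \<noteq> {}" by force
  qed simp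
  moreover have "(\<lambda>n. set_encode (str_code ` ?g n)) = h" by (simp add: image_comp fun_eq_iff)
  ultimately show False
    using no_enumeration h(1) unfolding computes_bounded_enumeration_def bounded_enumeration_def by metis
qed

text \<open>The derived part may refer to coordinates of a longer tuple; what must survive is that
  each tuple of \<open>Q'\<close> comes with one of \<open>Q\<close> that inherits the demanded
  colors.\<close>

definition child :: "(nat \<Rightarrow> nat) set \<Rightarrow> (nat \<Rightarrow> nat) set \<Rightarrow> (bool list \<Rightarrow> bool list) \<Rightarrow> part \<Rightarrow> part \<Rightarrow> bool" where
  "child Q Q' g p p' \<longleftrightarrow> nodes p' = nodes p \<and> cones p' = g ` cones p \<and> hue p' = hue p \<and>
     finite (coords p') \<and> coords p' \<noteq> {} \<and> (\<forall>C'\<in>Q'. \<exists>C\<in>Q. \<forall>\<tau>. matches C' p' \<tau> \<longrightarrow> matches C p \<tau>)"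

text \<open>One \<open>C'\<close> witnesses all spoilable parts; it is the coloring that
  \<open>requirement_step\<close> later freezes.\<close>

definition split_into :: "part set \<Rightarrow> (nat \<Rightarrow> nat) set \<Rightarrow> part set \<Rightarrow> (bool list \<Rightarrow> bool list) \<Rightarrow>
    (nat \<Rightarrow> nat) set \<Rightarrow> (nat \<Rightarrow> nat) \<Rightarrow> part set \<Rightarrow> bool" where
  "split_into W Q P g Q' C' P' \<longleftrightarrow> closed_family k D (\<lambda>_. Q') \<and> C' \<in> Q' \<and> finite P' \<and> covers Q' P' \<and>
     (\<forall>p'\<in>P'. \<exists>p\<in>P. child Q Q' g p p' \<and> (p \<in> W \<or> satisfied p' Q' \<or> spoilable p' C'))"

lemma split_into_shrink:
  assumes "split_into W Q P g Q' C' P'" "extending f"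
  shows "split_into W Q P (f \<circ> g) Q' C' (shrink f ` P')"
  unfolding split_into_def
proof (intro conjI ballI)
  show "closed_family k D (\<lambda>_. Q')" "C' \<in> Q'" "finite (shrink f ` P')" "covers Q' (shrink f ` P')"
    using assms covers_shrink unfolding split_into_def by blast+
  fix q assume "q \<in> shrink f ` P'"
  then obtain p' p where "q = shrink f p'" "p \<in> P" "child Q Q' g p p'"
    "p \<in> W \<or> satisfied p' Q' \<or> spoilable p' C'"
    using assms(1) unfolding split_into_def by blast
  then show "\<exists>p\<in>P. child Q Q' (f \<circ> g) p q \<and> (p \<in> W \<or> satisfied q Q' \<or> spoilable q C')"
    using satisfied_shrink spoilable_shrink assms(2)
    unfolding child_def by (intro bexI[of _ p]) (auto simp: image_comp)
qed

lemma gen_child: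
  assumes "child Q Q' g p p'" "C' \<in> Q'"
  shows "\<exists>C\<in>Q. gen p' C' \<subseteq> gen (shrink g p) C"
proof -
  obtain C where C: "C \<in> Q" "\<And>\<tau>. matches C' p' \<tau> \<Longrightarrow> matches C p \<tau>"
    using assms unfolding child_def by blast
  have "gen p' C' \<subseteq> gen (shrink g p) C"
    using assms(1) C(2) unfolding gen_def child_def by auto
  with C(1) show ?thesis by blast
qed

text \<open>In a joint tuple the coordinate \<open>(v, b)\<close> holds the coordinate
  \<open>b\<close> of tuple \<open>v\<close>, so \<open>C \<circ> place v\<close> is the component
  \<open>v\<close>.\<close>

definition place :: "nat \<Rightarrow> nat \<Rightarrow> nat" where
  "place v x = prod_encode (prod_encode (v, pfst x), psnd x)"

definition lift :: "nat \<Rightarrow> part \<Rightarrow> part" where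
  "lift v p = Part (nodes p) (cones p) ((\<lambda>b. prod_encode (v, b)) ` coords p) (hue p)"

lemma lift_sel [simp]: "nodes (lift v p) = nodes p" "cones (lift v p) = cones p"
  "coords (lift v p) = (\<lambda>b. prod_encode (v, b)) ` coords p" "hue (lift v p) = hue p"
  by (simp_all add: lift_def)

lemma matches_lift: "matches C (lift v p) \<tau> \<longleftrightarrow> matches (C \<circ> place v) p \<tau>"
  by (simp add: matches_def place_def)

lemma gen_lift: "gen (lift v p) C = gen p (C \<circ> place v)"
  unfolding gen_def by (simp add: matches_lift)

lemma shrink_lift: "shrink g (lift v p) = lift v (shrink g p)"
  by (simp add: lift_def shrink_def)

text \<open>Demanding the color in all components from \<open>A\<close> subjects each tree of the
  part to the classes of all \<open>v\<close> in \<open>A\<close> at once.\<close>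

definition amalgam :: "(bool list \<Rightarrow> bool list) \<Rightarrow> part \<Rightarrow> nat set \<Rightarrow> (nat \<Rightarrow> part) \<Rightarrow> part" where
  "amalgam g p A q = Part (nodes p) (g ` cones p) (\<Union>v\<in>A. (\<lambda>b. prod_encode (v, b)) ` coords (q v)) (hue p)"

lemma matches_amalgam:
  assumes "\<And>v. v \<in> A \<Longrightarrow> hue (q v) = hue p"
  shows "matches C (amalgam g p A q) \<tau> \<longleftrightarrow> (\<forall>v\<in>A. matches (C \<circ> place v) (q v) \<tau>)"
  using assms by (auto simp: matches_def place_def amalgam_def)

text \<open>\<open>W\<close> collects the parts that have been dealt with at an outer level of the recursion. For the
  parts in \<open>W1\<close> the coloring \<open>C\<close> itself shows that the class belonging to the true level of \<open>S\<close> is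
  nonempty, so that \<open>unhittable\<close> applies to them.\<close>

lemma exists_split:
  assumes "finite P" "\<And>p. p \<in> P \<Longrightarrow> wf_part p"
    and "closed_family k D (\<lambda>_. Q)" "Q \<noteq> {}" "extending g0" "covers Q (shrink g0 ` P)"
  shows "\<exists>f Q' C' P'. extending f \<and> split_into W Q P (f \<circ> g0) Q' C' P'"
  using assms(3-)
proof (induction "card (P - W)" arbitrary: W Q g0 rule: less_induct)
  case less
  obtain C where C: "C \<in> Q" using less.prems(2) by blast
  \<comment> \<open>Bad means that no wrong output can be produced under \<open>C\<close>. A part
    that is not bad after stabilizing admits wrong outputs however far its cones are raised.\<close>
  let ?bad = "\<lambda>p g. \<forall>G\<in>gen (shrink g p) C. \<not> spoils G"
  have "?bad p (f \<circ> g)" if "?bad p g" "extending f" for p f g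
    using that gen_shrink[OF that(2), of "shrink g p" C] by (auto simp: shrink_shrink)
  from stabilize[of ?bad P g0, OF this assms(1)] obtain f where f: "extending f"
    "\<And>p. p \<in> P \<Longrightarrow> ?bad p (f \<circ> g0) \<or> (\<forall>f'. extending f' \<longrightarrow> \<not> ?bad p (f' \<circ> (f \<circ> g0)))"
    by blast
  define g where "g = f \<circ> g0"
  define W1 where "W1 = {p\<in>P. p \<notin> W \<and> ?bad p g}"
  have extg: "extending g" unfolding g_def using extending_comp f(1) less.prems(3) by blast
  have covg: "covers Q (shrink g ` P)"
    using covers_shrink[OF less.prems(4) f(1)] by (simp add: g_def image_comp shrink_shrink comp_def)
  have good_part: "p \<in> W1 \<or> p \<in> W \<or> spoilable (shrink g p) C" if "p \<in> P" for p
  proof (cases "?bad p g")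
    case False
    then have "spoilable (shrink g p) C" unfolding spoilable_def shrink_shrink
      using f(2)[OF that] unfolding g_def by blast
    then show ?thesis by blast
  qed (use that W1_def in blast)
  show ?case
  proof (cases "W1 = {}")
    case True
    have ch: "child Q Q g p (shrink g p)" if "p \<in> P" for p
      using assms(2)[OF that] unfolding child_def wf_part_def by auto
    have "split_into W Q P g Q C (shrink g ` P)"
      unfolding split_into_def using less.prems(1) C covg assms(1) ch good_part True by blast
    then show ?thesis using f(1) g_def by blast
  next
    case False
    define hits where "hits = (\<lambda>p m. {C. (\<forall>x. C x < k) \<and> (\<forall>G\<in>gen (shrink g p) C. \<forall>y. run G (pfst m) y \<longrightarrow>
        set_decode y \<inter> set_decode (psnd m) \<noteq> {})})"
    define F where "F = (\<lambda>m. Q \<inter> {C. (\<forall>x. C x < k) \<and> (\<forall>p\<in>W1. C \<in> hits p m)})"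
    have finW1: "finite W1" unfolding W1_def using assms(1) by simp
    have "closed_family k D (hits p)" if "p \<in> W1" for p
      unfolding hits_def
      by (rule closed_family_gen) (use that assms(2)[of p] in \<open>auto simp: W1_def wf_part_def\<close>)
    then have F: "closed_family k D F"
      unfolding F_def by (intro closed_family_Int less.prems(1) closed_family_INT finW1) auto
    have FQ: "F m \<subseteq> Q" for m unfolding F_def by blast
    have Fhit: "set_decode y \<inter> set_decode v \<noteq> {}"
      if "B \<in> F (prod_encode (n, v))" "p \<in> W1" "G \<in> gen (shrink g p) B" "run G n y" for B n v p G y
      using that unfolding F_def hits_def by auto
    have valid: "B x < k" if "B \<in> Q" for B x using closed_family_valid[OF less.prems(1) that] .
    have "F (prod_encode (n, set_encode (str_code ` (S \<inter> {\<sigma>. length \<sigma> = n})))) \<noteq> {}" for n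
    proof -
      have "finite {\<sigma> :: bool list. length \<sigma> = n}"
        using finite_lists_length_eq[of "UNIV :: bool set" n] by simp
      then have "set_decode (set_encode (str_code ` (S \<inter> {\<sigma>. length \<sigma> = n}))) = str_code ` (S \<inter> {\<sigma>. length \<sigma> = n})"
        by (intro set_encode_inverse finite_imageI finite_Int) blast
      moreover have "good n y" if "p \<in> W1" "G \<in> gen (shrink g p) C" "run G n y" for p G y
        using that unfolding W1_def spoils_def by blast
      ultimately have "C \<in> F (prod_encode (n, set_encode (str_code ` (S \<inter> {\<sigma>. length \<sigma> = n}))))"
        unfolding F_def hits_def using C valid unfolding good_def by auto
      then show ?thesis by blast
    qed
    \<comment> \<open>Room for \<open>l\<close> strings per part: hitting sets chosen separately for
      all parts are together still too few to hit every set in \<open>V\<close>.\<close>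
    from unhittable[OF F this, of "l * card P"] obtain n where n:
      "\<And>H. finite H \<Longrightarrow> card H \<le> l * card P \<Longrightarrow>
        \<exists>v<2 ^ 2 ^ Suc n. F (prod_encode (n, v)) \<noteq> {} \<and> H \<inter> set_decode v = {}" by blast
    define V where "V = {v. v < 2 ^ 2 ^ Suc n \<and> F (prod_encode (n, v)) \<noteq> {}}"
    have finV: "finite V" unfolding V_def by simp
    have "P - (W \<union> W1) \<subset> P - W" using False unfolding W1_def by blast
    then have less_card: "card (P - (W \<union> W1)) < card (P - W)" using assms(1) by (intro psubset_card_mono) auto
    \<comment> \<open>The recursive calls for the different \<open>v\<close> raise the cones further
      and further; earlier results are raised along, so that one \<open>h\<close> serves
      all.\<close>
    have "\<exists>h. extending h \<and> (\<forall>v\<in>V'. \<exists>Q' C' P'. split_into (W \<union> W1) (F (prod_encode (n, v))) P (h \<circ> g) Q' C' P')"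
      if "finite V'" "V' \<subseteq> V" for V'
      using that
    proof (induction V')
      case empty
      then show ?case using extending_id by blast
    next
      case (insert v V')
      then obtain h where h: "extending h"
        "\<And>w. w \<in> V' \<Longrightarrow> \<exists>Q' C' P'. split_into (W \<union> W1) (F (prod_encode (n, w))) P (h \<circ> g) Q' C' P'" by blast
      have "closed_family k D (\<lambda>_. F (prod_encode (n, v)))"
        by (rule closed_family_comp[OF F computable_const])
      moreover have "F (prod_encode (n, v)) \<noteq> {}" using insert.prems unfolding V_def by blast
      moreover have "covers (F (prod_encode (n, v))) (shrink (h \<circ> g) ` P)"
        using covers_mono[OF covers_shrink[OF covg h(1)] FQ subset_refl]
        by (simp add: image_comp shrink_shrink comp_def)
      ultimately obtain h' Q' C' P' where h': "extending h'"
        "split_into (W \<union> W1) (F (prod_encode (n, v))) P (h' \<circ> (h \<circ> g)) Q' C' P'"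
        using less.hyps[OF less_card] extending_comp[OF h(1) extg] by blast
      have "\<exists>Q' C' P'. split_into (W \<union> W1) (F (prod_encode (n, w))) P (h' \<circ> h \<circ> g) Q' C' P'" if "w \<in> insert v V'" for w
        using h'(2) h(2) split_into_shrink[OF _ h'(1)] that by (metis comp_assoc insertE)
      then show ?case using extending_comp[OF h'(1) h(1)] by blast
    qed
    from this[OF finV subset_refl] obtain h where h: "extending h"
      "\<And>v. v \<in> V \<Longrightarrow> \<exists>Q' C' P'. split_into (W \<union> W1) (F (prod_encode (n, v))) P (h \<circ> g) Q' C' P'" by blast
    then obtain Qv Cv Pv where sp:
      "\<And>v. v \<in> V \<Longrightarrow> split_into (W \<union> W1) (F (prod_encode (n, v))) P (h \<circ> g) (Qv v) (Cv v) (Pv v)" by metis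
    define Q' where "Q' = {C. (\<forall>x. C x < k) \<and> (\<forall>v\<in>V. C \<in> {C. (\<forall>x. C x < k) \<and> C \<circ> place v \<in> Qv v})}"
    \<comment> \<open>The witnesses of all components side by side. Other places get color 0, which
      is below \<open>k\<close> because \<open>Q\<close> contains a coloring.\<close>
    define C' where "C' = (\<lambda>x. if pfst (pfst x) \<in> V then Cv (pfst (pfst x)) (prod_encode (psnd (pfst x), psnd x)) else 0)"
    have clQ': "closed_family k D (\<lambda>_. Q')"
      unfolding Q'_def
    proof (rule closed_family_INT[OF finV])
      fix v assume "v \<in> V"
      then have "closed_family k D (\<lambda>_. Qv v)" using sp unfolding split_into_def by blast
      moreover have "computable_in D (place v)" unfolding place_def by (intro computable_intros)
      ultimately show "closed_family k D (\<lambda>_. {C. (\<forall>x. C x < k) \<and> C \<circ> place v \<in> Qv v})"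
        by (rule closed_family_reindex)
    qed
    have projQ': "B \<circ> place v \<in> Qv v" if "B \<in> Q'" "v \<in> V" for B v using that unfolding Q'_def by blast
    have projC': "C' \<circ> place v = Cv v" if "v \<in> V" for v
      using that unfolding C'_def place_def by (auto simp: fun_eq_iff)
    have "C' x < k" for x
    proof (cases "pfst (pfst x) \<in> V")
      case True
      then have "closed_family k D (\<lambda>_. Qv (pfst (pfst x)))" "Cv (pfst (pfst x)) \<in> Qv (pfst (pfst x))"
        using sp unfolding split_into_def by blast+
      from closed_family_valid[OF this] True show ?thesis unfolding C'_def by simp
    next
      case False
      then show ?thesis using valid[OF C, of 0] unfolding C'_def by simp
    qed
    moreover have "Cv v \<in> Qv v" if "v \<in> V" for v using sp[OF that] unfolding split_into_def by blast
    ultimately have C': "C' \<in> Q'" unfolding Q'_def using projC' by simp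
    define U where "U = (\<Union>v\<in>V. \<Union>q\<in>Pv v. (\<lambda>b. prod_encode (v, b)) ` coords q)"
    have finPv: "finite (Pv v)" "\<And>q. q \<in> Pv v \<Longrightarrow> finite (coords q)" if "v \<in> V" for v
      using sp[OF that] unfolding split_into_def child_def by blast+
    have finU: "finite U" unfolding U_def using finV finPv by auto
    define P' where "P' = {p'. coords p' \<subseteq> U \<and>
      (\<exists>p\<in>P. child Q Q' (h \<circ> g) p p' \<and> (p \<in> W \<or> satisfied p' Q' \<or> spoilable p' C'))}"
    have "P' \<subseteq> (\<lambda>(p, B). Part (nodes p) ((h \<circ> g) ` cones p) B (hue p)) ` (P \<times> Pow U)"
    proof
      fix p' assume "p' \<in> P'"
      then obtain p where p: "p \<in> P" "coords p' \<subseteq> U" "nodes p' = nodes p" "cones p' = (h \<circ> g) ` cones p" "hue p' = hue p"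
        unfolding P'_def child_def by blast
      then have "p' = Part (nodes p) ((h \<circ> g) ` cones p) (coords p') (hue p)" by (metis part.collapse)
      with p(1,2) show "p' \<in> (\<lambda>(p, B). Part (nodes p) ((h \<circ> g) ` cones p) B (hue p)) ` (P \<times> Pow U)" by force
    qed
    then have finP': "finite P'" by (rule finite_subset) (simp add: assms(1) finU)
    have "covers Q' P'"
      unfolding covers_def
    proof (intro ballI allI impI)
      fix B s assume B: "B \<in> Q'" and s: "extending s"
      have "\<exists>q\<in>Pv v. \<forall>\<kappa>\<in>cones q. matches (B \<circ> place v) q (s \<kappa>)" if "v \<in> V" for v
        using sp[OF that] projQ'[OF B that] s unfolding split_into_def covers_def by blast
      then obtain q where q: "\<And>v. v \<in> V \<Longrightarrow> q v \<in> Pv v"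
        "\<And>v \<kappa>. v \<in> V \<Longrightarrow> \<kappa> \<in> cones (q v) \<Longrightarrow> matches (B \<circ> place v) (q v) (s \<kappa>)" by metis
      have "\<forall>v\<in>V. \<exists>p\<in>P. child (F (prod_encode (n, v))) (Qv v) (h \<circ> g) p (q v) \<and>
          (p \<in> W \<union> W1 \<or> satisfied (q v) (Qv v) \<or> spoilable (q v) (Cv v))"
        using sp q(1) unfolding split_into_def by blast
      then obtain r where r: "\<And>v. v \<in> V \<Longrightarrow> r v \<in> P"
        "\<And>v. v \<in> V \<Longrightarrow> child (F (prod_encode (n, v))) (Qv v) (h \<circ> g) (r v) (q v)"
        "\<And>v. v \<in> V \<Longrightarrow> r v \<in> W \<union> W1 \<or> satisfied (q v) (Qv v) \<or> spoilable (q v) (Cv v)" by metis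
      have UV: "(\<lambda>b. prod_encode (v, b)) ` coords (q v) \<subseteq> U" if "v \<in> V" for v
        unfolding U_def using that q(1) by blast
      show "\<exists>p\<in>P'. \<forall>\<kappa>\<in>cones p. matches B p (s \<kappa>)"
      \<comment> \<open>A component whose part does not rely on \<open>W1\<close> can be used alone.
        Otherwise all components point to parts in \<open>W1\<close>, and pigeonhole
        applies.\<close>
      proof (cases "\<exists>v\<in>V. r v \<in> W \<or> satisfied (q v) (Qv v) \<or> spoilable (q v) (Cv v)")
        case True
        then obtain v where v: "v \<in> V" "r v \<in> W \<or> satisfied (q v) (Qv v) \<or> spoilable (q v) (Cv v)" by blast
        have "child Q Q' (h \<circ> g) (r v) (lift v (q v))"
          using r(2)[OF v(1)] projQ'[OF _ v(1)] FQ unfolding child_def lift_sel matches_lift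
          by (simp add: image_is_empty del: o_apply) (meson subsetD)
        moreover have "satisfied (lift v (q v)) Q'" if "satisfied (q v) (Qv v)"
          using that projQ'[OF _ v(1)] unfolding satisfied_def gen_lift by blast
        moreover have "spoilable (lift v (q v)) C'" if "spoilable (q v) (Cv v)"
          using that projC'[OF v(1)] unfolding spoilable_def shrink_lift gen_lift by simp
        ultimately have "lift v (q v) \<in> P'"
          unfolding P'_def using v UV[OF v(1)] r(1)[OF v(1)] by auto
        moreover have "\<forall>\<kappa>\<in>cones (lift v (q v)). matches B (lift v (q v)) (s \<kappa>)"
          using q(2)[OF v(1)] by (simp add: matches_lift)
        ultimately show ?thesis by blast
      next
        case no: False
        then have rW1: "r v \<in> W1" if "v \<in> V" for v using r(3)[OF that] that by blast
        \<comment> \<open>Otherwise each part has a hitting set of size at most \<open>l\<close> for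
          the \<open>v\<close> assigned to it, and the union contradicts the choice of
          \<open>n\<close>.\<close>
        have "\<exists>p\<in>P. \<forall>H. finite H \<and> card H \<le> l \<longrightarrow> (\<exists>v\<in>V. r v = p \<and> H \<inter> set_decode v = {})"
        proof (rule ccontr)
          assume "\<not> ?thesis"
          then obtain H where H: "\<And>p. p \<in> P \<Longrightarrow> finite (H p)" "\<And>p. p \<in> P \<Longrightarrow> card (H p) \<le> l"
            "\<And>p v. p \<in> P \<Longrightarrow> v \<in> V \<Longrightarrow> r v = p \<Longrightarrow> H p \<inter> set_decode v \<noteq> {}" by metis
          have "card (\<Union>p\<in>P. H p) \<le> (\<Sum>p\<in>P. card (H p))" by (rule card_UN_le[OF assms(1)])
          also have "\<dots> \<le> l * card P" using sum_mono[of P "\<lambda>p. card (H p)" "\<lambda>_. l"] H(2) by (simp add: mult.commute)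
          finally have "\<exists>v<2 ^ 2 ^ Suc n. F (prod_encode (n, v)) \<noteq> {} \<and> (\<Union>p\<in>P. H p) \<inter> set_decode v = {}"
            using n H(1) assms(1) by simp
          then obtain v where "v \<in> V" "(\<Union>p\<in>P. H p) \<inter> set_decode v = {}" unfolding V_def by blast
          then show False using H(3)[of "r v" v] r(1) by blast
        qed
        then obtain p where p0: "p \<in> P"
          "\<forall>H. finite H \<and> card H \<le> l \<longrightarrow> (\<exists>v\<in>V. r v = p \<and> H \<inter> set_decode v = {})" by (rule bexE)
        note p = p0(1) p0(2)[THEN spec, THEN mp, OF conjI]
        define A where "A = {v\<in>V. r v = p}"
        have AV: "v \<in> V" "r v = p" if "v \<in> A" for v using that unfolding A_def by auto
        \<comment> \<open>The empty set is among the sets \<open>H\<close> considered, so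
          \<open>A\<close> is not empty.\<close>
        obtain v0 where v0: "v0 \<in> A" using p(2)[of "{}"] unfolding A_def by auto
        have pW1: "p \<in> W1" using rW1 AV[OF v0] by blast
        have hueA: "hue (q v) = hue p" if "v \<in> A" for v
          using r(2)[OF AV(1)[OF that]] AV(2)[OF that] unfolding child_def by simp
        let ?a = "amalgam (h \<circ> g) p A q"
        have match: "matches B' ?a \<tau> \<longleftrightarrow> (\<forall>v\<in>A. matches (B' \<circ> place v) (q v) \<tau>)" for B' \<tau>
          by (rule matches_amalgam) (rule hueA)
        have proj: "\<exists>B0\<in>F (prod_encode (n, v)). \<forall>\<tau>. matches B' ?a \<tau> \<longrightarrow> matches B0 p \<tau>"
          if B': "B' \<in> Q'" and v: "v \<in> A" for B' v
        proof -
          obtain B0 where "B0 \<in> F (prod_encode (n, v))" "\<forall>\<tau>. matches (B' \<circ> place v) (q v) \<tau> \<longrightarrow> matches B0 p \<tau>"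
            using r(2)[OF AV(1)[OF v]] projQ'[OF B' AV(1)[OF v]] AV(2)[OF v]
            unfolding child_def by blast
          with match v show ?thesis by blast
        qed
        have "child Q Q' (h \<circ> g) p ?a"
          unfolding child_def
        proof (intro conjI ballI)
          have "finite A" using finV unfolding A_def by simp
          moreover have "finite (coords (q v))" if "v \<in> A" for v
            by (rule finPv(2)[OF AV(1)[OF that] q(1)[OF AV(1)[OF that]]])
          ultimately show "finite (coords ?a)" unfolding amalgam_def part.sel by blast
          have "coords (q v0) \<noteq> {}" using r(2) AV[OF v0] unfolding child_def by blast
          then show "coords ?a \<noteq> {}" unfolding amalgam_def using v0 by auto
          show "\<exists>C\<in>Q. \<forall>\<tau>. matches B' ?a \<tau> \<longrightarrow> matches C p \<tau>" if "B' \<in> Q'" for B'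
            using proj[OF that v0] FQ by blast
        qed (simp_all add: amalgam_def)
        \<comment> \<open>A good output would have at most \<open>l\<close> elements and yet meet
          every \<open>v\<close> in \<open>A\<close>.\<close>
        moreover have "satisfied ?a Q'"
          unfolding satisfied_def
        proof (intro exI[of _ n] ballI allI impI notI)
          fix B' G y assume B': "B' \<in> Q'" and G: "G \<in> gen ?a B'" and y: "run G n y" "good n y"
          have "set_decode y \<inter> set_decode v \<noteq> {}" if v: "v \<in> A" for v
          proof -
            obtain B0 where B0: "B0 \<in> F (prod_encode (n, v))" "\<And>\<tau>. matches B' ?a \<tau> \<Longrightarrow> matches B0 p \<tau>"
              using proj[OF B' v] by blast
            have "G \<in> gen (shrink (h \<circ> g) p) B0"
              using G B0(2) unfolding gen_def by (auto simp: amalgam_def)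
            then have "G \<in> gen (shrink g p) B0"
              using gen_shrink[OF h(1)] unfolding shrink_shrink[symmetric] by blast
            then show ?thesis using Fhit[OF B0(1) pW1 _ y(1)] by blast
          qed
          moreover have "card (set_decode y) \<le> l" using y(2) unfolding good_def by blast
          ultimately show False using p(2)[of "set_decode y"] unfolding A_def by auto
        qed
        moreover have "coords ?a \<subseteq> U" unfolding amalgam_def using UV AV(1) by auto
        ultimately have "?a \<in> P'" unfolding P'_def using p(1) by blast
        moreover have "matches B ?a (s \<kappa>)" if "\<kappa> \<in> cones ?a" for \<kappa>
        proof -
          have "matches (B \<circ> place v) (q v) (s \<kappa>)" if v: "v \<in> A" for v
          proof (rule q(2)[OF AV(1)[OF v]])
            show "\<kappa> \<in> cones (q v)"
              using r(2)[OF AV(1)[OF v]] AV(2)[OF v] \<open>\<kappa> \<in> cones ?a\<close> unfolding child_def amalgam_def by simp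
          qed
          then show ?thesis using match by blast
        qed
        ultimately show ?thesis by blast
      qed
    qed
    then have "split_into W Q P (h \<circ> g) Q' C' P'"
      unfolding split_into_def using clQ' C' finP' unfolding P'_def by blast
    moreover have "h \<circ> g = (h \<circ> f) \<circ> g0" by (simp add: g_def comp_assoc)
    ultimately show ?thesis using extending_comp[OF h(1) f(1)] by metis
  qed
qed

end


section \<open>Construction of the tree\<close>

definition condition :: "nat \<Rightarrow> nat set \<Rightarrow> (nat \<Rightarrow> nat) set \<Rightarrow> part set \<Rightarrow> bool" where
  "condition k D Q P \<longleftrightarrow> closed_family k D (\<lambda>_. Q) \<and> Q \<noteq> {} \<and> finite P \<and> (\<forall>p\<in>P. wf_part p) \<and> covers Q P"

text \<open>Successive conditions may use different coordinates, so parts are compared through the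
  trees that they admit.\<close>

definition below :: "(nat \<Rightarrow> nat) set \<Rightarrow> part \<Rightarrow> (nat \<Rightarrow> nat) set \<Rightarrow> part \<Rightarrow> bool" where
  "below Q' p' Q p \<longleftrightarrow> (\<forall>C'\<in>Q'. \<exists>C\<in>Q. gen p' C' \<subseteq> gen p C)"

lemma below_trans: "below Q'' p'' Q' p' \<Longrightarrow> below Q' p' Q p \<Longrightarrow> below Q'' p'' Q p"
  unfolding below_def by (meson subset_trans)

lemma nodes_in_gen: "wf_part p \<Longrightarrow> nodes p \<in> gen p C"
  using wf_meet_closed_nodes unfolding gen_def wf_part_def by blast

lemma below_nodes:
  assumes "below Q' p' Q p" "wf_part p'" "Q' \<noteq> {}" shows "nodes p \<subseteq> nodes p'"
  using assms nodes_in_gen[OF assms(2)] unfolding below_def gen_def by blast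

lemma wf_part_cong:
  assumes "wf_part p" "nodes q = nodes p" "cones q = cones p" "finite (coords q)" "coords q \<noteq> {}"
  shows "wf_part q"
  using assms unfolding wf_part_def by simp

text \<open>Extensions are built for the one coloring \<open>C\<close>. Restricting to the tuples
  that agree with \<open>C\<close> on their finitely many nodes makes them valid throughout the
  class.\<close>

lemma freeze_coloring:
  assumes Q: "closed_family k D (\<lambda>_. Q)" "C \<in> Q" and Z: "finite Z" "\<And>z. z \<in> Z \<Longrightarrow> wf_part z"
  shows "\<exists>Q'. closed_family k D (\<lambda>_. Q') \<and> C \<in> Q' \<and> Q' \<subseteq> Q \<and>
    (\<forall>C'\<in>Q'. \<forall>z\<in>Z. \<forall>p. extends_part C z p \<longrightarrow> gen z C' \<subseteq> gen p C')"
proof -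
  define X where "X = (\<Union>z\<in>Z. (\<lambda>(b, x). prod_encode (b, str_code x)) ` (coords z \<times> nodes z))"
  have "finite X" unfolding X_def using Z by (auto simp: wf_part_def)
  let ?Q = "Q \<inter> {C'. (\<forall>x. C' x < k) \<and> (\<forall>x\<in>X. C' x = C x)}"
  have "closed_family k D (\<lambda>_. ?Q)"
    by (rule closed_family_Int[OF Q(1) closed_family_agree[OF \<open>finite X\<close>]])
  moreover have "C \<in> ?Q" using Q closed_family_valid[OF Q] by blast
  moreover have "gen z C' \<subseteq> gen p C'" if "C' \<in> ?Q" "z \<in> Z" "extends_part C z p" for C' z p
  proof (rule gen_extends_part[OF that(3)])
    fix b x assume "b \<in> coords p" "x \<in> nodes z"
    then have "prod_encode (b, str_code x) \<in> X"
      using that(2,3) unfolding X_def extends_part_def by force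
    with that(1) show "C' (prod_encode (b, str_code x)) = C (prod_encode (b, str_code x))" by blast
  qed
  ultimately show ?thesis by blast
qed

lemma dense_forI:
  assumes "finite (cones p)"
    and "\<And>g. extending g \<Longrightarrow> \<exists>z C. ok z \<and> finite (cones z) \<and> extends_part C z (shrink g p)"
  shows "dense_for ok p"
  unfolding dense_for_def
proof (intro conjI allI impI assms(1))
  fix g assume "extending g"
  then obtain z C where z: "ok z" "finite (cones z)" "extends_part C z (shrink g p)" using assms(2) by blast
  have "coords z = coords p" "hue z = hue p" "\<forall>\<mu>\<in>cones z. \<exists>\<kappa>\<in>g ` cones p. prefix \<kappa> \<mu>"
    "\<forall>\<kappa>\<in>g ` cones p. \<exists>\<mu>\<in>cones z. prefix \<kappa> \<mu>"
    using z(3) unfolding extends_part_def shrink_sel by blast+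
  with z(1,2) show "\<exists>z. ok z \<and> finite (cones z) \<and> coords z = coords p \<and> hue z = hue p \<and>
      (\<forall>\<mu>\<in>cones z. \<exists>\<kappa>\<in>g ` cones p. prefix \<kappa> \<mu>) \<and> (\<forall>\<kappa>\<in>g ` cones p. \<exists>\<mu>\<in>cones z. prefix \<kappa> \<mu>)"
    by (intro exI[of _ z] conjI)
qed

text \<open>Parts that are only spoilable after splitting are extended by a tree with a wrong
  output; the ends of the extension lie beyond the use of that computation, so the output cannot
  change any more.\<close>

lemma (in requirement) requirement_step:
  assumes "condition k D Q P"
  shows "\<exists>Q' P'. condition k D Q' P' \<and> (\<forall>p'\<in>P'. satisfied p' Q' \<and> (\<exists>p\<in>P. below Q' p' Q p))"
proof -
  have c: "closed_family k D (\<lambda>_. Q)" "Q \<noteq> {}" "finite P" "\<And>p. p \<in> P \<Longrightarrow> wf_part p" "covers Q P"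
    using assms unfolding condition_def by blast+
  have "covers Q (shrink id ` P)" using c(5) by simp
  from exists_split[OF c(3,4,1,2) extending_id this, of "{}"]
  obtain f Q1 C1 P1 where f: "extending f" and sp: "split_into {} Q P f Q1 C1 P1" by auto
  have s: "closed_family k D (\<lambda>_. Q1)" "C1 \<in> Q1" "finite P1" "covers Q1 P1"
    "\<And>p'. p' \<in> P1 \<Longrightarrow> \<exists>p\<in>P. child Q Q1 f p p'"
    "\<And>p'. p' \<in> P1 \<Longrightarrow> satisfied p' Q1 \<or> spoilable p' C1"
    using sp unfolding split_into_def by blast+
  have wf1: "wf_part p'" if p': "p' \<in> P1" for p'
  proof -
    obtain p where p: "p \<in> P" "child Q Q1 f p p'" using s(5) p' by blast
    show ?thesis
      by (rule wf_part_cong[OF wf_shrink[OF c(4)[OF p(1)] f]]) (use p(2) in \<open>auto simp: child_def\<close>)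
  qed
  let ?ok = "\<lambda>z. wf_part z \<and> satisfied z Q1 \<and> (\<exists>p\<in>P1. extends_part C1 z p)"
  let ?X = "{p\<in>P1. spoilable p C1}" and ?Z = "{p\<in>P1. satisfied p Q1}"
  have dense: "dense_for ?ok x" if x: "x \<in> ?X" for x
  proof (rule dense_forI)
    show "finite (cones x)" using wf1 x unfolding wf_part_def by blast
    fix g assume g: "extending g"
    then obtain G n y where G: "G \<in> gen (shrink g x) C1" "run G n y" "\<not> good n y"
      using x unfolding spoilable_def spoils_def by blast
    from eval_join_use[OF G(2)[unfolded run_def]] obtain u where
      u: "\<And>X'. (\<forall>i<u. i \<in> X' \<longleftrightarrow> i \<in> str_code ` G) \<Longrightarrow> eval (D \<oplus> X') e n y" by blast
    have wfx: "wf_part (shrink g x)" using wf_shrink wf1 x g by blast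
    from grow_part[OF wfx G(1), of u] obtain q where q: "wf_part q" "nodes q = G"
      "extends_part C1 q (shrink g x)" "\<And>\<mu>. \<mu> \<in> cones q \<Longrightarrow> u \<le> length \<mu>" by blast
    have "run G' n y" if G': "G' \<in> gen q C" for G' C
      unfolding run_def
    proof (rule u, intro allI impI)
      fix i assume i: "i < u"
      have "G \<subseteq> G'" using G' q(2) unfolding gen_def by blast
      \<comment> \<open>A string above an end has length at least \<open>u\<close>, hence a code of
        at least \<open>u\<close>.\<close>
      moreover have "x \<in> G" if x': "x \<in> G'" "str_code x < u" for x
      proof (rule ccontr)
        assume "x \<notin> G"
        then obtain \<kappa> where "\<kappa> \<in> cones q" "prefix \<kappa> x" using G' q(2) x'(1) unfolding gen_def by blast
        then show False using q(4) prefix_length_le str_code_ge_length[of x] x'(2) by fastforce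
      qed
      ultimately show "i \<in> str_code ` G' \<longleftrightarrow> i \<in> str_code ` G" using i by blast
    qed
    then have "satisfied q Q1" unfolding satisfied_def using G(3) run_unique by blast
    then have "?ok q" using q(1) extends_part_shrink_right[OF q(3) g] x by blast
    moreover have "finite (cones q)" using q(1) unfolding wf_part_def by blast
    ultimately show "\<exists>z C. ?ok z \<and> finite (cones z) \<and> extends_part C z (shrink g x)"
      using q(3) by (intro exI[of _ q] exI[of _ C1]) simp
  qed
  have "?ok (shrink g z)" if "?ok z" "extending g" for z g
    using that wf_shrink satisfied_shrink extends_part_shrink_left by blast
  moreover have "finite ?X" "finite ?Z" using s(3) by simp_all
  moreover have "?X \<union> ?Z = P1" using s(6) by blast
  then have "covers Q1 (?X \<union> ?Z)" using s(4) by simp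
  moreover have "?ok z" if "z \<in> ?Z" for z using that wf1 extends_part_refl by blast
  ultimately have "\<exists>Z'. finite Z' \<and> covers Q1 Z' \<and> (\<forall>z\<in>Z'. ?ok z)"
    using dense by (rule covers_eliminate)
  then obtain Z' where Z': "finite Z'" "covers Q1 Z'" "\<And>z. z \<in> Z' \<Longrightarrow> ?ok z" by blast
  from freeze_coloring[OF s(1,2) Z'(1)] Z'(3) obtain Q2 where Q2: "closed_family k D (\<lambda>_. Q2)" "C1 \<in> Q2" "Q2 \<subseteq> Q1"
    "\<And>C' z p. C' \<in> Q2 \<Longrightarrow> z \<in> Z' \<Longrightarrow> extends_part C1 z p \<Longrightarrow> gen z C' \<subseteq> gen p C'" by blast
  have "condition k D Q2 Z'"
    unfolding condition_def using Q2 Z' covers_mono[OF Z'(2) Q2(3) subset_refl] by blast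
  moreover have "satisfied z Q2" if "z \<in> Z'" for z
    using Z'(3)[OF that] Q2(3) unfolding satisfied_def by blast
  moreover have "\<exists>p\<in>P. below Q2 z Q p" if z: "z \<in> Z'" for z
  proof -
    obtain p1 where p1: "p1 \<in> P1" "extends_part C1 z p1" using Z'(3)[OF z] by blast
    obtain p where p: "p \<in> P" "child Q Q1 f p p1" using s(5) p1(1) by blast
    have "\<exists>C\<in>Q. gen z C' \<subseteq> gen p C" if C': "C' \<in> Q2" for C'
    proof -
      obtain C where "C \<in> Q" "gen p1 C' \<subseteq> gen (shrink f p) C" using gen_child[OF p(2)] C' Q2(3) by blast
      then show ?thesis using Q2(4)[OF C' z p1(2)] gen_shrink[OF f] by blast
    qed
    with p(1) show ?thesis unfolding below_def by blast
  qed
  ultimately show ?thesis by blast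
qed

lemma set_decode_power2 [simp]: "set_decode (2 ^ x) = {x}"
  using set_encode_inverse[of "{x}"] by (simp add: set_encode_def)

text \<open>The avoidance lemma for singletons, which have the codes \<open>2 ^ x\<close>.\<close>

lemma closed_family_unmatched:
  assumes "finite (coords p)"
  shows "closed_family k D (\<lambda>_. {C. (\<forall>x. C x < k) \<and> (\<forall>\<nu>. prefix \<mu> \<nu> \<longrightarrow> \<not> matches C p \<nu>)})"
proof -
  let ?Z = "\<lambda>(m::nat) e. \<exists>x. e = 2 ^ x \<and> code_prefix (str_code \<mu>) x"
  have "cep D (\<lambda>x. ?Z (pfst x) (psnd x))"
    by (intro cep_ex cep_decp decp_conj decp_eq decp_code_prefix computable_intros)
  from closed_family_avoid_uniform[OF this finite.emptyI assms, of k "hue p"]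
  have *: "closed_family k D (\<lambda>m. {C. (\<forall>x. C x < k) \<and>
    (\<forall>e. ?Z m e \<longrightarrow> \<not> (\<forall>x\<in>set_decode e - {}. \<forall>b\<in>coords p. C (prod_encode (b, x)) = hue p))})" .
  have "(\<forall>e. ?Z m e \<longrightarrow> \<not> (\<forall>x\<in>set_decode e - {}. \<forall>b\<in>coords p. C (prod_encode (b, x)) = hue p)) \<longleftrightarrow>
      (\<forall>\<nu>. prefix \<mu> \<nu> \<longrightarrow> \<not> matches C p \<nu>)" for m :: nat and C
  proof -
    have all: "(\<forall>e. (\<exists>x. e = 2 ^ x \<and> K x) \<longrightarrow> A e) \<longleftrightarrow> (\<forall>x. K x \<longrightarrow> A (2 ^ x))" for K A
      by blast
    have "(\<forall>e. ?Z m e \<longrightarrow> \<not> (\<forall>x\<in>set_decode e - {}. \<forall>b\<in>coords p. C (prod_encode (b, x)) = hue p)) \<longleftrightarrow>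
      (\<forall>x. prefix \<mu> (inv str_code x) \<longrightarrow> \<not> matches C p (inv str_code x))"
      unfolding all code_prefix_def matches_def by simp
    also have "\<dots> \<longleftrightarrow> (\<forall>\<nu>. prefix \<mu> \<nu> \<longrightarrow> \<not> matches C p \<nu>)" by (metis inv_str_code(1))
    finally show ?thesis .
  qed
  with * show ?thesis by simp
qed

text \<open>The color of a part may be missing above one of its cones. Then the class is cut down to
  tuples for which it is missing there, and the covering can do without that part; all other parts
  are extended by a node above every cone.\<close>

lemma growth_step:
  assumes "condition k D Q P"
  shows "\<exists>Q' P'. condition k D Q' P' \<and>
    (\<forall>p'\<in>P'. \<exists>p\<in>P. below Q' p' Q p \<and> (\<forall>\<kappa>\<in>cones p. \<exists>y\<in>nodes p'. prefix \<kappa> y))"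
proof -
  have c: "closed_family k D (\<lambda>_. Q)" "Q \<noteq> {}" "finite P" "\<And>p. p \<in> P \<Longrightarrow> wf_part p" "covers Q P"
    using assms unfolding condition_def by blast+
  obtain C where C: "C \<in> Q" using c(2) by blast
  let ?bad = "\<lambda>p g. \<exists>\<kappa>\<in>cones p. \<forall>\<nu>. prefix (g \<kappa>) \<nu> \<longrightarrow> \<not> matches C p \<nu>"
  have "?bad p (f \<circ> g)" if "?bad p g" "extending f" for p f g
    using that prefix_order.trans unfolding extending_def comp_apply by blast
  from stabilize[of ?bad P id, OF this c(3)] obtain g where g: "extending g"
    "\<And>p. p \<in> P \<Longrightarrow> ?bad p g \<or> (\<forall>f. extending f \<longrightarrow> \<not> ?bad p (f \<circ> g))"
    unfolding comp_id by blast
  define P1 where "P1 = {p\<in>P. \<not> ?bad p g}"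
  have "\<forall>p\<in>P - P1. \<exists>\<kappa>. \<kappa> \<in> cones p \<and> (\<forall>\<nu>. prefix (g \<kappa>) \<nu> \<longrightarrow> \<not> matches C p \<nu>)"
    unfolding P1_def by blast
  from bchoice[OF this] obtain \<delta> where
    "\<forall>p\<in>P - P1. \<delta> p \<in> cones p \<and> (\<forall>\<nu>. prefix (g (\<delta> p)) \<nu> \<longrightarrow> \<not> matches C p \<nu>)" ..
  then have \<delta>: "\<And>p. p \<in> P - P1 \<Longrightarrow> \<delta> p \<in> cones p"
    "\<And>p \<nu>. p \<in> P - P1 \<Longrightarrow> prefix (g (\<delta> p)) \<nu> \<Longrightarrow> \<not> matches C p \<nu>"
    by blast+
  define Q1 where "Q1 = Q \<inter> {B. (\<forall>x. B x < k) \<and> (\<forall>p\<in>P - P1. B \<in> {B. (\<forall>x. B x < k) \<and> (\<forall>\<nu>. prefix (g (\<delta> p)) \<nu> \<longrightarrow> \<not> matches B p \<nu>)})}"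
  have clQ1: "closed_family k D (\<lambda>_. Q1)"
    unfolding Q1_def
  proof (intro closed_family_Int c(1) closed_family_INT)
    show "finite (P - P1)" using c(3) by simp
    show "closed_family k D (\<lambda>_. {B. (\<forall>x. B x < k) \<and> (\<forall>\<nu>. prefix (g (\<delta> p)) \<nu> \<longrightarrow> \<not> matches B p \<nu>)})"
      if "p \<in> P - P1" for p
      by (rule closed_family_unmatched) (use c(4)[of p] that in \<open>auto simp: wf_part_def\<close>)
  qed
  have CQ1: "C \<in> Q1" unfolding Q1_def using C \<delta>(2) closed_family_valid[OF c(1) C] by blast
  have cov1: "covers Q1 (shrink g ` P1)"
    unfolding covers_def
  proof (intro ballI allI impI)
    fix B h assume B: "B \<in> Q1" and h: "extending h"
    obtain p where p: "p \<in> P" "\<forall>\<kappa>\<in>cones p. matches B p ((h \<circ> g) \<kappa>)"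
      using c(5) B extending_comp[OF h g(1)] unfolding covers_def Q1_def by blast
    \<comment> \<open>A part outside \<open>P1\<close> cannot find its color at the node that
      \<open>h\<close> picks above \<open>g (\<delta> p)\<close>.\<close>
    have "p \<in> P1"
    proof (rule ccontr)
      assume "p \<notin> P1"
      then have "\<delta> p \<in> cones p" "\<not> matches B p (h (g (\<delta> p)))"
        using \<delta>(1) p(1) B h unfolding Q1_def extending_def by blast+
      then show False using p(2) by auto
    qed
    then show "\<exists>p\<in>shrink g ` P1. \<forall>\<kappa>\<in>cones p. matches B p (h \<kappa>)"
      using p(2) by (intro bexI[of _ "shrink g p"]) auto
  qed
  let ?ok = "\<lambda>z. wf_part z \<and> (\<exists>p\<in>P. extends_part C z p \<and> (\<forall>\<kappa>\<in>cones p. \<exists>y\<in>nodes z. prefix \<kappa> y))"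
  have dense: "dense_for ?ok x" if x: "x \<in> shrink g ` P1" for x
  proof (rule dense_forI)
    obtain p where p: "p \<in> P" "x = shrink g p" "p \<in> P1" using x unfolding P1_def by blast
    show "finite (cones x)" using p c(4)[OF p(1)] unfolding wf_part_def by simp
    fix f assume f: "extending f"
    let ?x = "shrink f x"
    have wfx: "wf_part ?x" using wf_shrink f g(1) c(4)[OF p(1)] p(2) by blast
    have "\<not> ?bad p (f \<circ> g)" using g(2)[OF p(1)] f p(3) unfolding P1_def by blast
    then have ex: "\<exists>\<nu>. prefix \<mu> \<nu> \<and> matches C ?x \<nu>" if "\<mu> \<in> cones ?x" for \<mu>
      using that p(2) by auto
    define s where "s = (\<lambda>\<mu>. if \<mu> \<in> cones ?x then SOME \<nu>. prefix \<mu> \<nu> \<and> matches C ?x \<nu> else \<mu>)"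
    have s: "prefix \<mu> (s \<mu>)" "matches C ?x (s \<mu>)" if "\<mu> \<in> cones ?x" for \<mu>
      using someI_ex[OF ex[OF that]] that unfolding s_def by simp_all
    have exts: "extending s" unfolding extending_def using s(1) by (metis s_def prefix_order.refl)
    have wfs: "wf_part (shrink s ?x)" by (rule wf_shrink[OF wfx exts])
    \<comment> \<open>One matching node above each cone; these are the cones of
      \<open>shrink s ?x\<close>, so meet closure comes from \<open>wf_shrink\<close>.\<close>
    let ?G = "nodes ?x \<union> s ` cones ?x"
    have "?G \<in> gen ?x C"
      unfolding gen_def
    proof (intro CollectI conjI ballI)
      show "finite ?G" using wfx unfolding wf_part_def by simp
      show "meet_closed ?G" using wfs unfolding wf_part_def shrink_sel by blast
      fix y assume "y \<in> ?G - nodes ?x"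
      then obtain \<mu> where \<mu>: "\<mu> \<in> cones ?x" "y = s \<mu>" by blast
      then show "\<exists>\<kappa>\<in>cones ?x. prefix \<kappa> y" "matches C ?x y" using s by blast+
    qed simp
    from grow_part[OF wfx this, of 0] obtain q where q: "wf_part q" "nodes q = ?G" "extends_part C q ?x" by blast
    have "extends_part C q p"
      using extends_part_shrink_right[OF q(3) f] unfolding p(2) by (rule extends_part_shrink_right) (rule g(1))
    moreover have "\<exists>y\<in>nodes q. prefix \<kappa> y" if "\<kappa> \<in> cones p" for \<kappa>
    proof -
      have "f (g \<kappa>) \<in> cones ?x" using that p(2) by simp
      moreover have "prefix \<kappa> (f (g \<kappa>))" using f g(1) prefix_order.trans unfolding extending_def by blast
      ultimately show ?thesis using s(1) prefix_order.trans unfolding q(2) by blast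
    qed
    ultimately have "?ok q" using q(1) p(1) by blast
    moreover have "finite (cones q)" using q(1) unfolding wf_part_def by blast
    ultimately show "\<exists>z C. ?ok z \<and> finite (cones z) \<and> extends_part C z (shrink f x)"
      using q(3) by (intro exI[of _ q] exI[of _ C]) simp
  qed
  have cl: "?ok (shrink f z)" if "?ok z" "extending f" for z f
    using that wf_shrink extends_part_shrink_left by (simp, blast)
  have fin: "finite (shrink g ` P1)" using c(3) unfolding P1_def by simp
  have cov': "covers Q1 (shrink g ` P1 \<union> {})" using cov1 by simp
  have "\<exists>Z'. finite Z' \<and> covers Q1 Z' \<and> (\<forall>z\<in>Z'. ?ok z)"
    by (rule covers_eliminate[of ?ok, OF cl fin finite.emptyI cov' _ dense]) auto
  then obtain Z' where Z': "finite Z'" "covers Q1 Z'" "\<And>z. z \<in> Z' \<Longrightarrow> ?ok z" by blast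
  from freeze_coloring[OF clQ1 CQ1 Z'(1)] Z'(3) obtain Q2 where Q2: "closed_family k D (\<lambda>_. Q2)" "C \<in> Q2" "Q2 \<subseteq> Q1"
    "\<And>C' z p. C' \<in> Q2 \<Longrightarrow> z \<in> Z' \<Longrightarrow> extends_part C z p \<Longrightarrow> gen z C' \<subseteq> gen p C'" by blast
  have "condition k D Q2 Z'"
    unfolding condition_def using Q2 Z' covers_mono[OF Z'(2) Q2(3) subset_refl] by blast
  moreover have "\<exists>p\<in>P. below Q2 z Q p \<and> (\<forall>\<kappa>\<in>cones p. \<exists>y\<in>nodes z. prefix \<kappa> y)" if z: "z \<in> Z'" for z
  proof -
    obtain p where p: "p \<in> P" "extends_part C z p" "\<forall>\<kappa>\<in>cones p. \<exists>y\<in>nodes z. prefix \<kappa> y" using Z'(3)[OF z] by blast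
    have "below Q2 z Q p" unfolding below_def using Q2(3) Q2(4)[OF _ z p(2)] unfolding Q1_def by blast
    with p show ?thesis by blast
  qed
  ultimately show ?thesis by blast
qed

text \<open>Starting points of chains of length \<open>n\<close>. Only predecessors are known to
  exist, so the elements that can be continued have to be singled out.\<close>

primrec reach :: "(nat \<Rightarrow> 'a set) \<Rightarrow> (nat \<Rightarrow> 'a \<Rightarrow> 'a \<Rightarrow> bool) \<Rightarrow> nat \<Rightarrow> nat \<Rightarrow> 'a \<Rightarrow> bool" where
  "reach P R 0 s p \<longleftrightarrow> p \<in> P s"
| "reach P R (Suc n) s p \<longleftrightarrow> p \<in> P s \<and> (\<exists>q. R s p q \<and> reach P R n (Suc s) q)"

text \<open>Koenig's lemma: by finiteness of a level some element starts chains of every length, and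
  the same argument applies to its successors.\<close>

lemma inverse_limit:
  assumes fin: "\<And>s. finite (P s)" and ne: "\<And>s. P s \<noteq> {}"
    and parent: "\<And>s q. q \<in> P (Suc s) \<Longrightarrow> \<exists>p\<in>P s. R s p q"
  shows "\<exists>f. \<forall>s. f s \<in> P s \<and> R s (f s) (f (Suc s))"
proof -
  have reachP: "p \<in> P s" if "reach P R n s p" for n s p using that by (cases n) auto
  have anti1: "reach P R n s p" if "reach P R (Suc n) s p" for n s p
    using that
  proof (induction n arbitrary: s p)
    case (Suc n)
    then obtain q where "p \<in> P s" "R s p q" "reach P R (Suc n) (Suc s) q" unfolding reach.simps(2)[of _ _ "Suc n"] by blast
    with Suc.IH show ?case by auto
  qed simp
  have anti: "reach P R n s p" if "reach P R m s p" "n \<le> m" for n m s p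
    using that(2,1) by (induction rule: dec_induct) (use anti1 in blast)+
  have ex: "\<exists>p. reach P R n s p" for n s
  proof (induction n arbitrary: s)
    case 0
    then show ?case using ne by auto
  next
    case (Suc n)
    then obtain q where q: "reach P R n (Suc s) q" by blast
    then have "q \<in> P (Suc s)" using reachP by blast
    then obtain p where "p \<in> P s" "R s p q" using parent by blast
    then have "reach P R (Suc n) s p" using q by auto
    then show ?case by (rule exI)
  qed
  \<comment> \<open>If each element of \<open>A\<close> failed at some length, all would fail at the
    maximum of these lengths.\<close>
  have unif: "\<exists>p\<in>A. \<forall>n. reach P R n s p" if A: "A \<subseteq> P s" and all: "\<And>n. \<exists>p\<in>A. reach P R n s p" for A s
  proof (rule ccontr)
    assume "\<not> ?thesis"
    then obtain m where m: "\<And>p. p \<in> A \<Longrightarrow> \<not> reach P R (m p) s p" by metis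
    have "finite A" using fin A finite_subset by blast
    obtain p where p: "p \<in> A" "reach P R (Max (m ` A)) s p" using all by blast
    have "m p \<le> Max (m ` A)" using p(1) \<open>finite A\<close> by simp
    with p m anti show False by blast
  qed
  have "\<exists>f. \<forall>s. (\<forall>n. reach P R n s (f s)) \<and> R s (f s) (f (Suc s))"
  proof (rule dependent_nat_choice)
    show "\<exists>p. \<forall>n. reach P R n 0 p" using unif[of "P 0" 0] ex reachP by blast
    fix p s assume p: "\<forall>n. reach P R n s p"
    have "\<exists>q\<in>{q\<in>P (Suc s). R s p q}. \<forall>n. reach P R n (Suc s) q"
    proof (rule unif)
      fix n
      have "reach P R (Suc n) s p" using p ..
      then show "\<exists>q\<in>{q\<in>P (Suc s). R s p q}. reach P R n (Suc s) q" using reachP by auto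
    qed auto
    then show "\<exists>q. (\<forall>n. reach P R n (Suc s) q) \<and> R s p q" by blast
  qed
  then show ?thesis using reachP by blast
qed

definition least_ext :: "bool list set \<Rightarrow> bool list \<Rightarrow> bool list \<Rightarrow> bool" where
  "least_ext T x y \<longleftrightarrow> y \<in> T \<and> prefix x y \<and> (\<forall>z\<in>T. prefix x z \<longrightarrow> prefix y z)"

text \<open>A shortest element above \<open>x\<close> works: its meet with any other one is again in
  the set and above \<open>x\<close>, hence not shorter.\<close>

lemma ex_least_ext:
  assumes "meet_closed T" "y \<in> T" "prefix x y"
  shows "\<exists>y. least_ext T x y"
proof -
  obtain y where y: "y \<in> T \<and> prefix x y" "\<And>z. z \<in> T \<and> prefix x z \<Longrightarrow> length y \<le> length z"
    using ex_has_least_nat[of "\<lambda>y. y \<in> T \<and> prefix x y" y length] assms(2,3) by blast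
  have "prefix y z" if z: "z \<in> T" "prefix x z" for z
  proof -
    obtain w where w: "w \<in> T" "prefix w y" "prefix w z" "prefix x w"
      using assms(1) y(1) z unfolding meet_closed_def by blast
    then have "length y \<le> length w" using y(2) by blast
    with w(2) have "w = y" by (metis prefix_length_le prefix_length_prefix prefix_order.antisym prefix_order.refl)
    with w(3) show ?thesis by simp
  qed
  with y(1) show ?thesis unfolding least_ext_def by blast
qed

text \<open>The head of the list is the latest bit, so that recursion on lists appends bits;
  \<open>infinite_perfect_treeI\<close> reverses the string.\<close>

primrec branch :: "bool list set \<Rightarrow> bool list \<Rightarrow> bool list" where
  "branch T [] = (SOME y. least_ext T [] y)"
| "branch T (b # \<sigma>) = (SOME y. least_ext T (branch T \<sigma> @ [b]) y)"

text \<open>Each further bit leads to the least element beyond that bit. The bits keep different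
  branches apart, and leastness leaves no element out.\<close>

lemma infinite_perfect_treeI:
  assumes ne: "T \<noteq> {}" and mc: "meet_closed T"
    and ext: "\<And>x b. x \<in> T \<Longrightarrow> \<exists>y\<in>T. prefix (x @ [b]) y"
  shows "infinite_perfect_tree T"
proof -
  define h where "h = (\<lambda>\<sigma>. branch T (rev \<sigma>))"
  have h0: "least_ext T [] (h [])"
    unfolding h_def using ne ex_least_ext[OF mc] by (auto intro: someI_ex)
  have hsnoc: "least_ext T (h \<sigma> @ [b]) (h (\<sigma> @ [b]))" if "h \<sigma> \<in> T" for \<sigma> b
    using ext[OF that, of b] ex_least_ext[OF mc] unfolding h_def by (auto intro: someI_ex)
  have hT: "h \<sigma> \<in> T" for \<sigma>
    by (induction \<sigma> rule: rev_induct) (use h0 hsnoc in \<open>auto simp: least_ext_def\<close>)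
  have step: "prefix (h \<sigma> @ [b]) (h (\<sigma> @ [b]))" for \<sigma> b
    using hsnoc[OF hT] unfolding least_ext_def by blast
  have mono: "prefix (h \<sigma>) (h (\<sigma> @ \<rho>))" for \<sigma> \<rho>
  proof (induction \<rho> rule: rev_induct)
    case (snoc b \<rho>)
    then show ?case using step[of "\<sigma> @ \<rho>" b] by (metis append.assoc append_prefixD prefix_order.trans)
  qed simp
  have mono': "prefix (h \<sigma> @ [b]) (h (\<sigma> @ b # \<rho>))" for \<sigma> b \<rho>
    using prefix_order.trans[OF step[of \<sigma> b] mono[of "\<sigma> @ [b]" \<rho>]] by simp
  have refl: "prefix \<sigma> \<tau>" if le: "prefix (h \<sigma>) (h \<tau>)" for \<sigma> \<tau>
  proof (rule ccontr)
    assume no: "\<not> prefix \<sigma> \<tau>"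
    show False
    proof (cases "prefix \<tau> \<sigma>")
      case True
      with no obtain b \<rho> where "\<sigma> = \<tau> @ b # \<rho>" by (metis append_Nil2 neq_Nil_conv prefixE prefix_order.refl)
      then have "prefix (h \<tau> @ [b]) (h \<tau>)" using mono'[of \<tau> b \<rho>] le prefix_order.trans by blast
      then show False using prefix_length_le by fastforce
    next
      case False
      then have "parallel \<sigma> \<tau>" using no by blast
      from parallel_decomp[OF this] obtain \<rho> a as b bs where
        *: "a \<noteq> b" "\<sigma> = \<rho> @ a # as" "\<tau> = \<rho> @ b # bs"
        by (elim exE conjE) (rule that)
      have "prefix (h \<rho> @ [a]) (h \<tau>)" "prefix (h \<rho> @ [b]) (h \<tau>)"
        using mono'[of \<rho> a as] mono'[of \<rho> b bs] le * prefix_order.trans by blast+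
      then have "h \<rho> @ [a] = h \<rho> @ [b]"
        using prefix_same_cases[of "h \<rho> @ [a]" "h \<tau>" "h \<rho> @ [b]"] by (auto simp: prefix_def)
      then show False using *(1) by simp
    qed
  qed
  have iff: "prefix (h \<sigma>) (h \<tau>) \<longleftrightarrow> prefix \<sigma> \<tau>" for \<sigma> \<tau>
    using refl mono by (auto simp: prefix_def)
  have "inj h" by (rule injI) (metis iff prefix_order.antisym prefix_order.refl)
  moreover have "x \<in> range h" if x: "x \<in> T" for x
  proof -
    have len: "length \<sigma> \<le> length (h \<sigma>)" for \<sigma>
    proof (induction \<sigma> rule: rev_induct)
      case (snoc b \<sigma>)
      then show ?case using prefix_length_le[OF step[of \<sigma> b]] by simp
    qed simp
    have "prefix (h []) x" using h0 x unfolding least_ext_def by simp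
    moreover have "\<forall>\<sigma>. prefix (h \<sigma>) x \<longrightarrow> length \<sigma> < Suc (length x)"
      using len prefix_length_le order.trans less_Suc_eq_le by metis
    \<comment> \<open>Take the longest \<open>\<sigma>\<close> whose image is below
      \<open>x\<close>; were the image not \<open>x\<close>, leastness would put the image of a
      longer string below \<open>x\<close>.\<close>
    ultimately obtain \<sigma> where \<sigma>: "prefix (h \<sigma>) x" "\<And>\<tau>. prefix (h \<tau>) x \<Longrightarrow> length \<tau> \<le> length \<sigma>"
      using ex_has_greatest_nat[of "\<lambda>\<sigma>. prefix (h \<sigma>) x" "[]" length "Suc (length x)"] by blast
    have "h \<sigma> = x"
    proof (rule ccontr)
      assume "h \<sigma> \<noteq> x"
      with \<sigma>(1) obtain b \<rho> where "x = h \<sigma> @ b # \<rho>" by (metis append_Nil2 neq_Nil_conv prefixE)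
      then have "prefix (h \<sigma> @ [b]) x" by simp
      then have "prefix (h (\<sigma> @ [b])) x" using hsnoc[OF hT] x unfolding least_ext_def by blast
      then show False using \<sigma>(2)[of "\<sigma> @ [b]"] by simp
    qed
    then show ?thesis by blast
  qed
  ultimately have "bij_betw h UNIV T" unfolding bij_betw_def using hT by blast
  with iff show ?thesis unfolding infinite_perfect_tree_def by blast
qed

instance prog :: countable
  by countable_datatype

text \<open>At the root, covering is immediate: the color of coordinate 0 at the chosen node names
  the part.\<close>

lemma initial_condition:
  assumes "Pi01_class D k Q" "Q \<noteq> {}"
  shows "condition k D {C. (\<forall>x. C x < k) \<and> (\<lambda>\<sigma>. C (prod_encode (0, str_code \<sigma>))) \<in> Q}
    ((\<lambda>i. Part {} {[]} {0} i) ` {..<k})"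
  unfolding condition_def
proof (intro conjI ballI)
  let ?Q = "{C. (\<forall>x. C x < k) \<and> (\<lambda>\<sigma>. C (prod_encode (0, str_code \<sigma>))) \<in> Q}"
  show "closed_family k D (\<lambda>_. ?Q)" by (rule closed_family_Pi01[OF assms(1)])
  obtain C where C: "C \<in> Q" using assms(2) by blast
  then have "\<forall>\<sigma>. C \<sigma> < k" using assms(1) unfolding Pi01_class_def colorings_def by blast
  \<comment> \<open>The coordinate is ignored, so all coordinates hold the same coloring.\<close>
  with C have "(\<lambda>x. C (inv str_code (psnd x))) \<in> ?Q" by simp
  then show "?Q \<noteq> {}" by (metis empty_iff)
  show "wf_part p" if "p \<in> (\<lambda>i. Part {} {[]} {0} i) ` {..<k}" for p
    using that unfolding wf_part_def meet_closed_def by auto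
  show "covers ?Q ((\<lambda>i. Part {} {[]} {0} i) ` {..<k})"
    unfolding covers_def
  proof (intro ballI allI impI)
    fix C h assume "C \<in> ?Q" "extending h"
    then show "\<exists>p\<in>(\<lambda>i. Part {} {[]} {0} i) ` {..<k}. \<forall>\<kappa>\<in>cones p. matches C p (h \<kappa>)"
      by (intro bexI[of _ "Part {} {[]} {0} (C (prod_encode (0, str_code (h []))))"]) (auto simp: matches_def)
  qed
qed simp

text \<open>Growth comes first so that \<open>satisfied\<close> refers to the final class; the nodes
  gained are kept by \<open>below_nodes\<close>.\<close>

lemma condition_step:
  assumes "\<not> computes_bounded_enumeration D S" "condition k D Q P"
  shows "\<exists>Q' P'. condition k D Q' P' \<and> (\<forall>p'\<in>P'. \<exists>p\<in>P. below Q' p' Q p \<and>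
    (\<forall>\<kappa>\<in>cones p. \<exists>y\<in>nodes p'. prefix \<kappa> y) \<and> requirement.satisfied D S e l p' Q')"
proof -
  interpret requirement k D S e l by unfold_locales (rule assms(1))
  obtain Q1 P1 where 1: "condition k D Q1 P1"
    "\<And>p1. p1 \<in> P1 \<Longrightarrow> \<exists>p\<in>P. below Q1 p1 Q p \<and> (\<forall>\<kappa>\<in>cones p. \<exists>y\<in>nodes p1. prefix \<kappa> y)"
    using growth_step[OF assms(2)] by blast
  obtain Q2 P2 where 2: "condition k D Q2 P2"
    "\<And>p2. p2 \<in> P2 \<Longrightarrow> satisfied p2 Q2 \<and> (\<exists>p1\<in>P1. below Q2 p2 Q1 p1)"
    using requirement_step[OF 1(1)] by blast
  have "\<exists>p\<in>P. below Q2 p2 Q p \<and> (\<forall>\<kappa>\<in>cones p. \<exists>y\<in>nodes p2. prefix \<kappa> y) \<and> satisfied p2 Q2" if p2: "p2 \<in> P2" for p2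
  proof -
    obtain p1 where p1: "p1 \<in> P1" "below Q2 p2 Q1 p1" "satisfied p2 Q2" using 2(2)[OF p2] by blast
    obtain p where p: "p \<in> P" "below Q1 p1 Q p" "\<forall>\<kappa>\<in>cones p. \<exists>y\<in>nodes p1. prefix \<kappa> y"
      using 1(2)[OF p1(1)] by blast
    have "nodes p1 \<subseteq> nodes p2" using below_nodes[OF p1(2)] p2 2(1) unfolding condition_def by blast
    with p p1 below_trans show ?thesis by blast
  qed
  with 2(1) show ?thesis by blast
qed

lemma finite_subset_mono_UN:
  assumes mono: "\<And>s t. s \<le> t \<Longrightarrow> F s \<subseteq> F t" and "finite A" "A \<subseteq> (\<Union>s. F (s::nat))"
  shows "\<exists>t. \<forall>t'\<ge>t. A \<subseteq> F t'"
  using assms(2,3)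
proof (induction A)
  case (insert a A)
  then obtain t s where "\<forall>t'\<ge>t. A \<subseteq> F t'" "a \<in> F s" by auto
  then have "\<forall>t'\<ge>max s t. insert a A \<subseteq> F t'" using mono[of s] by auto
  then show ?case by blast
qed simp

theorem theorem4p4:
  fixes k :: nat and D :: "nat set" and S :: "bool list set" and Q :: "(bool list \<Rightarrow> nat) set"
  assumes "k \<ge> 1"
    and "\<not> computes_bounded_enumeration D S"
    and "Pi01_class D k Q"
    and "Q \<noteq> {}"
  shows "\<exists>C\<in>Q. \<exists>T. infinite_perfect_tree T \<and> (\<exists>c. \<forall>\<sigma>\<in>T. C \<sigma> = c) \<and>
           \<not> computes_bounded_enumeration (D \<oplus> str_code ` T) S"
proof -
  define Q0 where "Q0 = {C. (\<forall>x. C x < k) \<and> (\<lambda>\<sigma>. C (prod_encode (0, str_code \<sigma>))) \<in> Q}"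
  define P0 where "P0 = (\<lambda>i. Part {} {[]} {0} i) ` {..<k}"
  \<comment> \<open>Stage \<open>s\<close> treats the program and the bound numbered
    \<open>s\<close>; every such pair has a number.\<close>
  let ?req = "\<lambda>s. from_nat s :: prog \<times> nat"
  let ?rel = "\<lambda>s A B p p'. below B p' A p \<and> (\<forall>\<kappa>\<in>cones p. \<exists>y\<in>nodes p'. prefix \<kappa> y) \<and>
    requirement.satisfied D S (fst (?req s)) (snd (?req s)) p' B"
  have "\<exists>X. \<forall>s. (condition k D (fst (X s)) (snd (X s)) \<and> (s = 0 \<longrightarrow> X s = (Q0, P0))) \<and>
      (\<forall>p'\<in>snd (X (Suc s)). \<exists>p\<in>snd (X s). ?rel s (fst (X s)) (fst (X (Suc s))) p p')"
  proof (rule dependent_nat_choice)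
    show "\<exists>x. condition k D (fst x) (snd x) \<and> ((0::nat) = 0 \<longrightarrow> x = (Q0, P0))"
      using initial_condition[OF assms(3,4)] unfolding Q0_def P0_def by simp
    fix x and s :: nat assume "condition k D (fst x) (snd x) \<and> (s = 0 \<longrightarrow> x = (Q0, P0))"
    then obtain Q' P' where "condition k D Q' P'" "\<forall>p'\<in>P'. \<exists>p\<in>snd x. ?rel s (fst x) Q' p p'"
      using condition_step[OF assms(2)] by blast
    then show "\<exists>y. (condition k D (fst y) (snd y) \<and> (Suc s = 0 \<longrightarrow> y = (Q0, P0))) \<and>
        (\<forall>p'\<in>snd y. \<exists>p\<in>snd x. ?rel s (fst x) (fst y) p p')"
      by (intro exI[of _ "(Q', P')"]) simp
  qed
  then obtain X where X0: "\<forall>s. (condition k D (fst (X s)) (snd (X s)) \<and> (s = 0 \<longrightarrow> X s = (Q0, P0))) \<and>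
      (\<forall>p'\<in>snd (X (Suc s)). \<exists>p\<in>snd (X s). ?rel s (fst (X s)) (fst (X (Suc s))) p p')" by (rule exE)
  note X = X0[THEN spec, THEN conjunct1, THEN conjunct1]
    X0[THEN spec, of 0, THEN conjunct1, THEN conjunct2, THEN mp, OF refl]
    X0[THEN spec, THEN conjunct2, THEN bspec]
  have "snd (X s) \<noteq> {}" for s
    using X(1)[of s] extending_id unfolding condition_def covers_def by blast
  moreover have "finite (snd (X s))" for s using X(1)[of s] unfolding condition_def by blast
  ultimately have "\<exists>p. \<forall>s. p s \<in> snd (X s) \<and> ?rel s (fst (X s)) (fst (X (Suc s))) (p s) (p (Suc s))"
    using X(3) by (intro inverse_limit)
  then obtain p where p: "\<And>s. p s \<in> snd (X s)" "\<And>s. below (fst (X (Suc s))) (p (Suc s)) (fst (X s)) (p s)"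
    "\<And>s \<kappa>. \<kappa> \<in> cones (p s) \<Longrightarrow> \<exists>y\<in>nodes (p (Suc s)). prefix \<kappa> y"
    "\<And>s. requirement.satisfied D S (fst (?req s)) (snd (?req s)) (p (Suc s)) (fst (X (Suc s)))" by blast
  have wf: "wf_part (p s)" and ne: "fst (X s) \<noteq> {}" for s
    using X(1)[of s] p(1)[of s] unfolding condition_def by blast+
  have below: "below (fst (X t)) (p t) (fst (X s)) (p s)" if "s \<le> t" for s t
    using that
  proof (induction rule: dec_induct)
    case base
    then show ?case unfolding below_def by blast
  next
    case (step t)
    then show ?case using below_trans p(2) by blast
  qed
  define F where "F = (\<lambda>s. nodes (p s))"
  have mono: "F s \<subseteq> F t" if "s \<le> t" for s t
    unfolding F_def by (rule below_nodes[OF below[OF that] wf ne])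
  \<comment> \<open>The tuple \<open>C\<close> depends on \<open>t\<close>; a single coloring for
    the whole tree is only obtained below.\<close>
  have genF: "\<exists>C\<in>fst (X s). F t \<in> gen (p s) C" if "s \<le> t" for s t
    using below[OF that] nodes_in_gen[OF wf] ne[of t] unfolding below_def F_def by blast
  define T where "T = (\<Union>s. F s)"
  have approx: "\<exists>t. \<forall>t'\<ge>t. A \<subseteq> F t'" if "finite A" "A \<subseteq> T" for A
    using finite_subset_mono_UN[of F A] mono that unfolding T_def by blast
  have FT: "F t \<subseteq> T" for t unfolding T_def by blast
  have "infinite_perfect_tree T"
  proof (rule infinite_perfect_treeI)
    have "[] \<in> cones (p 0)" using p(1)[of 0] X(2) unfolding P0_def by auto
    then show "T \<noteq> {}" using p(3) FT[of "Suc 0"] unfolding F_def by blast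
    show "meet_closed T"
      unfolding meet_closed_iff
    proof (intro ballI)
      fix x y assume "x \<in> T" "y \<in> T"
      then obtain t where "{x, y} \<subseteq> F t" using approx[of "{x, y}"] by auto
      then show "\<exists>w\<in>T. is_meet w x y"
        using wf_meet_closed_nodes[OF wf, of t] FT[of t] unfolding meet_closed_iff F_def by blast
    qed
    fix x b assume "x \<in> T"
    then obtain s where "x \<in> nodes (p s)" unfolding T_def F_def by blast
    then obtain y where y: "y \<in> nodes (p s) \<union> cones (p s)" "prefix (x @ [b]) y"
      using wf[of s] unfolding wf_part_def by blast
    show "\<exists>y\<in>T. prefix (x @ [b]) y"
    proof (cases "y \<in> nodes (p s)")
      case True
      then show ?thesis using y(2) FT[of s] unfolding F_def by blast
    next
      case False
      then obtain z where "z \<in> F (Suc s)" "prefix y z" using p(3) y(1) unfolding F_def by blast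
      then show ?thesis using y(2) FT prefix_order.trans by blast
    qed
  qed
  moreover have "\<exists>C\<in>Q. \<exists>c. \<forall>\<sigma>\<in>T. C \<sigma> = c"
  proof -
    obtain i where i: "p 0 = Part {} {[]} {0} i" using p(1)[of 0] X(2) unfolding P0_def by auto
    have colF: "\<exists>C\<in>Q0. \<forall>x\<in>F t. C (prod_encode (0, str_code x)) = i" for t
      using genF[of 0 t] X(2) unfolding i gen_def matches_def by auto
    have "closed_family k D (\<lambda>_. Q0)" using X(1)[of 0] X(2) unfolding condition_def by simp
    then obtain W where W: "Q0 = avoiding k W" unfolding closed_family_def by blast
    \<comment> \<open>A node of \<open>T\<close> with a color other than \<open>i\<close> is
      forbidden as well. Compactness applies since each stage concerns only finitely many nodes of
      \<open>T\<close>, and these lie in one \<open>F t\<close>.\<close>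
    let ?W = "\<lambda>w. W w \<or> (\<exists>x\<in>T. \<exists>j. j \<noteq> i \<and> w = set_encode {prod_encode (prod_encode (0, str_code x), j)})"
    have "avoiding k ?W \<noteq> {}"
    proof (rule avoiding_compact)
      fix s
      have "finite {x. str_code x < s}"
        using finite_vimageI[OF finite_lessThan[of s] inj_str_code] by (simp add: vimage_def)
      then obtain t where t: "{x\<in>T. str_code x < s} \<subseteq> F t" using approx[of "{x\<in>T. str_code x < s}"] by auto
      obtain C where C: "C \<in> Q0" "\<forall>x\<in>F t. C (prod_encode (0, str_code x)) = i" using colF by blast
      have "\<not> pattern_in w C" if w: "w < s" "?W w" for w
      proof (cases "W w")
        case True
        then show ?thesis using C(1) unfolding W avoiding_def by blast
      next
        case False
        then obtain x j where x: "x \<in> T" "j \<noteq> i" "w = set_encode {prod_encode (prod_encode (0, str_code x), j)}"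
          using w(2) by blast
        have dec: "set_decode w = {prod_encode (prod_encode (0, str_code x), j)}"
          unfolding x(3) by (rule set_encode_inverse) simp
        have "str_code x \<le> prod_encode (prod_encode (0, str_code x), j)"
          using le_prod_encode_1 le_prod_encode_2 le_trans by blast
        also have "\<dots> < w" using set_decode_less dec by blast
        finally have "x \<in> F t" using t x(1) w(1) by auto
        then show ?thesis using C(2) x(2) unfolding pattern_in_def dec by auto
      qed
      moreover have "\<forall>x. C x < k" using C(1) unfolding Q0_def by blast
      ultimately show "\<exists>C. (\<forall>x. C x < k) \<and> (\<forall>w<s. ?W w \<longrightarrow> \<not> pattern_in w C)" by blast
    qed
    then obtain C where C: "C \<in> avoiding k ?W" by blast
    then have "C \<in> Q0" unfolding W avoiding_def by blast
    then have inQ: "(\<lambda>\<sigma>. C (prod_encode (0, str_code \<sigma>))) \<in> Q" unfolding Q0_def by blast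
    have "C (prod_encode (0, str_code x)) = i" if x: "x \<in> T" for x
    proof (rule ccontr)
      let ?w = "set_encode {prod_encode (prod_encode (0, str_code x), C (prod_encode (0, str_code x)))}"
      assume "C (prod_encode (0, str_code x)) \<noteq> i"
      with x have "?W ?w" by blast
      moreover have "pattern_in ?w C" unfolding pattern_in_def by simp
      ultimately show False using C unfolding avoiding_def by blast
    qed
    then have "\<forall>\<sigma>\<in>T. (\<lambda>\<sigma>. C (prod_encode (0, str_code \<sigma>))) \<sigma> = i" by blast
    then show ?thesis by (intro bexI[OF _ inQ] exI)
  qed
  moreover have "\<not> computes_bounded_enumeration (D \<oplus> str_code ` T) S"
  proof
    assume "computes_bounded_enumeration (D \<oplus> str_code ` T) S"
    then obtain g l e where g: "enumeration l S g"
      "\<And>n. eval (D \<oplus> str_code ` T) e n (set_encode (str_code ` g n))"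
      unfolding computes_bounded_enumeration_def bounded_enumeration_def computable_in_def by blast
    interpret requirement k D S e l by unfold_locales (rule assms(2))
    define s where "s = to_nat (e, l)"
    have "satisfied (p (Suc s)) (fst (X (Suc s)))" using p(4)[of s] unfolding s_def by simp
    then obtain n where n: "\<And>C G y. C \<in> fst (X (Suc s)) \<Longrightarrow> G \<in> gen (p (Suc s)) C \<Longrightarrow> run G n y \<Longrightarrow> \<not> good n y"
      unfolding satisfied_def by blast
    have fin: "finite (g n)" "card (g n) \<le> l" "g n \<inter> S \<inter> {\<sigma>. length \<sigma> = n} \<noteq> {}"
      using g(1) unfolding enumeration_def by blast+
    then have "good n (set_encode (str_code ` g n))"
      unfolding good_def using card_image_le[OF fin(1), of str_code] by auto
    moreover obtain u where u: "\<And>Y. (\<forall>i<u. i \<in> Y \<longleftrightarrow> i \<in> str_code ` T) \<Longrightarrow> eval (D \<oplus> Y) e n (set_encode (str_code ` g n))"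
      using eval_join_use[OF g(2)] by blast
    have "finite {x. str_code x < u}"
      using finite_vimageI[OF finite_lessThan[of u] inj_str_code] by (simp add: vimage_def)
    then obtain t where t: "\<forall>t'\<ge>t. {x\<in>T. str_code x < u} \<subseteq> F t'" using approx[of "{x\<in>T. str_code x < u}"] by auto
    define t' where "t' = max t (Suc s)"
    have "run (F t') n (set_encode (str_code ` g n))"
      unfolding run_def
    proof (rule u, intro allI impI)
      fix i assume "i < u"
      moreover have "{x\<in>T. str_code x < u} \<subseteq> F t'" using t unfolding t'_def by simp
      ultimately show "i \<in> str_code ` F t' \<longleftrightarrow> i \<in> str_code ` T" using FT[of t'] by blast
    qed
    moreover obtain C where "C \<in> fst (X (Suc s))" "F t' \<in> gen (p (Suc s)) C"
      using genF[of "Suc s" t'] unfolding t'_def by auto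
    ultimately show False using n by blast
  qed
  ultimately show ?thesis by blast
qed

end
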